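(* Let $(V,E,\Psi)$ be a strongly connected planar box-like self-affine GIFS satisfying the rectangular open set condition (ROSC). Let $\{X_v\}_{v\in V}$ be the unique graph-directed self-affine carpet family associated with $(V,E,\Psi)$. Then for all $v\in V$, $$\dim_BX_v=\hat\gamma(0).$$
   Context: Graph: $(V,E)$ is a finite directed graph (loops and multiple edges allowed) in which every vertex is the initial vertex of at least one edge; $i(e),t(e)$ are the initial and terminal vertices of $e\in E$. It is strongly connected if for all $v,v'\in V$ there is a finite word of edges $w_1\cdots w_k$ ($k\ge1$) with $i(w_1)=v$, $t(w_{j-1})=i(w_j)$ for $1<j\le k$, $t(w_k)=v'$. A planar box-like self-affine GIFS $(V,E,\Psi)$ consists of such a graph and maps $\psi_e(\xi)=T_e\xi+t_e$ on $\mathbb R^2$, $t_e\in\mathbb R^2$, where each $T_e$ is either diagonal, $T_e=\begin{pmatrix}\pm a_e&0\\0&\pm b_e\end{pmatrix}$, or anti-diagonal, $T_e=\begin{pmatrix}0&\pm a_e\\ \pm b_e&0\end{pmatrix}$, with $0<a_e,b_e<1$. ROSC: for every $v\in V$, the sets $\psi_e((0,1)^2)$ with $i(e)=v$ are pairwise disjoint subsets of $(0,1)^2$. $\{X_v\}_{v\in V}$ is the unique family of non-empty compact sets with $X_v=\bigcup_{e:\,i(e)=v}\psi_e(X_{t(e)})$. $\dim_B$ denotes box dimension (part of the claim is that it exists). Fix any associated positive vector $(p_e)_{e\in E}$ ($p_e>0$, $\sum_{e:\,i(e)=v}p_e=1$ for all $v$), let $\{\mu_v\}$ be the unique family of Borel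 probability measures, $\mu_v$ supported on $X_v$, with $\mu_v=\sum_{e:\,i(e)=v}p_e\,\mu_{t(e)}\circ\psi_e^{-1}$, and $\mu_v^x,\mu_v^y$ the projections of $\mu_v$ to the $x$- and $y$-axis. For a compactly supported Borel probability measure $\nu$, $\tau_\nu(0)$ (the $L^q$-spectrum at $q=0$) is the box dimension of $\operatorname{supp}\nu$. Put $\tau_{x,v}(0)=\tau_{\mu_v^x}(0)$, $\tau_{y,v}(0)=\tau_{\mu_v^y}(0)$ (the box dimensions of the projections of $X_v$ to the $x$- and $y$-axis); these exist, and $t(0):=\tau_{x,v}(0)+\tau_{y,v}(0)$ does not depend on $v$. For $e\in E$, $\tau_{x,e}(0)=\tau_{x,t(e)}(0)$, $\tau_{y,e}(0)=\tau_{y,t(e)}(0)$. For $x,y\in\mathbb R$, $\mathcal G^{(0)}_{x,y}$ is the $(2\#E)\times(2\#E)$ matrix with index set $\{e(1),e(2):e\in E\}$ whose $2\times2$ block with rows $e(1),e(2)$ and columns $e'(1),e'(2)$ is $$\begin{pmatrix}a_{e'}^{x+\tau_{x,e'}(0)}b_{e'}^{y-\tau_{x,e'}(0)}&0\\0&b_{e'}^{x+\tau_{y,e'}(0)}a_{e'}^{y-\tau_{y,e'}(0)}\end{pmatrix}$$ if $t(e)=i(e')$ and $T_{e'}$ is diagonal, $$\begin{pmatrix}0&a_{e'}^{x+\tau_{y,e'}(0)}b_{e'}^{y-\tau_{y,e'}(0)}\\ b_{e'}^{x+\tau_{x,e'}(0)}a_{e'}^{y-\tau_{x,e'}(0)}&0\end{pmatrix}$$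 if $t(e)=i(e')$ and $T_{e'}$ is anti-diagonal, and zero otherwise. $\rho$ is the spectral radius. $\hat\gamma(0)$ is the unique real number with $\rho(\mathcal G^{(0)}_{0,\hat\gamma(0)})=\rho(\mathcal G^{(0)}_{\hat\gamma(0)-t(0),\,t(0)})=1$ (it is well defined). *)

theory Defs
  imports
    "HOL-Probability.Probability"
    "Graph_Theory.Arc_Walk"
    "Jordan_Normal_Form.Spectral_Radius"
begin

subsection \<open>Box dimension\<close>

definition covering_number :: "real \<Rightarrow> 'a::metric_space set \<Rightarrow> nat" where
  "covering_number \<delta> S =
     (LEAST n. \<exists>C. finite C \<and> card C = n \<and> S \<subseteq> \<Union>C \<and> (\<forall>U\<in>C. bounded U \<and> diameter U \<le> \<delta>))"

definition has_box_dimension :: "'a::metric_space set \<Rightarrow> real \<Rightarrow> bool" where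
  "has_box_dimension S d \<longleftrightarrow>
     ((\<lambda>\<delta>. ln (real (covering_number \<delta> S)) / (- ln \<delta>)) \<longlongrightarrow> d) (at_right 0)"

text \<open>Only meaningful when the box dimension exists; otherwise the value is unspecified.\<close>

definition box_dimension :: "'a::metric_space set \<Rightarrow> real" where
  "box_dimension S = (THE d. has_box_dimension S d)"

definition measure_support :: "'a::topological_space measure \<Rightarrow> 'a set" where
  "measure_support M = {x. \<forall>U. open U \<longrightarrow> x \<in> U \<longrightarrow> emeasure M U > 0}"

subsection \<open>Planar box-like self-affine graph-directed systems\<close>

text \<open>
  The plane is \<^typ>\<open>real \<times> real\<close>. A box-like map is \<open>\<xi> \<mapsto> T \<xi> + t\<close>, where \<open>T\<close> has exactly one
  non-zero entry in each row, on the diagonal or on the anti-diagonal. The fields \<open>row1\<close> and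
  \<open>row2\<close> are the signed entries \<open>\<plusminus>a\<close> and \<open>\<plusminus>b\<close> in the first and second row.
\<close>

record box_map =
  antidiagonal :: bool
  row1 :: real
  row2 :: real
  translation :: "real \<times> real"

definition apply_box :: "box_map \<Rightarrow> real \<times> real \<Rightarrow> real \<times> real" where
  "apply_box f \<xi> =
     (if antidiagonal f then (row1 f * snd \<xi>, row2 f * fst \<xi>)
      else (row1 f * fst \<xi>, row2 f * snd \<xi>)) + translation f"

definition box_a :: "box_map \<Rightarrow> real" where "box_a f = \<bar>row1 f\<bar>"
definition box_b :: "box_map \<Rightarrow> real" where "box_b f = \<bar>row2 f\<bar>"

definition box_like_gifs :: "('v, 'e) pre_digraph \<Rightarrow> ('e \<Rightarrow> box_map) \<Rightarrow> bool" where
  "box_like_gifs G \<Psi> \<longleftrightarrow>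
     fin_digraph G \<and>
     (\<forall>v\<in>verts G. out_arcs G v \<noteq> {}) \<and>
     (\<forall>e\<in>arcs G. 0 < box_a (\<Psi> e) \<and> box_a (\<Psi> e) < 1 \<and> 0 < box_b (\<Psi> e) \<and> box_b (\<Psi> e) < 1)"

text \<open>
  Unlike \<open>strongly_connected\<close> of the graph library, this asks for a non-empty walk also
  when the two vertices coincide.
\<close>

definition strongly_connected_graph :: "('v, 'e) pre_digraph \<Rightarrow> bool" where
  "strongly_connected_graph G \<longleftrightarrow>
     (\<forall>v\<in>verts G. \<forall>v'\<in>verts G. \<exists>w. w \<noteq> [] \<and> pre_digraph.awalk G v w v')"

definition open_unit_square :: "(real \<times> real) set" where
  "open_unit_square = {0<..<1} \<times> {0<..<1}"

definition rosc :: "('v, 'e) pre_digraph \<Rightarrow> ('e \<Rightarrow> box_map) \<Rightarrow> bool" where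
  "rosc G \<Psi> \<longleftrightarrow>
     (\<forall>v\<in>verts G.
        (\<forall>e\<in>out_arcs G v. apply_box (\<Psi> e) ` open_unit_square \<subseteq> open_unit_square) \<and>
        disjoint_family_on (\<lambda>e. apply_box (\<Psi> e) ` open_unit_square) (out_arcs G v))"

definition carpet_family ::
  "('v, 'e) pre_digraph \<Rightarrow> ('e \<Rightarrow> box_map) \<Rightarrow> ('v \<Rightarrow> (real \<times> real) set) \<Rightarrow> bool" where
  "carpet_family G \<Psi> X \<longleftrightarrow>
     (\<forall>v\<in>verts G. X v \<noteq> {} \<and> compact (X v) \<and>
        X v = (\<Union>e\<in>out_arcs G v. apply_box (\<Psi> e) ` X (head G e)))"

definition positive_vector :: "('v, 'e) pre_digraph \<Rightarrow> ('e \<Rightarrow> real) \<Rightarrow> bool" where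
  "positive_vector G p \<longleftrightarrow>
     (\<forall>e\<in>arcs G. p e > 0) \<and> (\<forall>v\<in>verts G. (\<Sum>e\<in>out_arcs G v. p e) = 1)"

definition invariant_measures ::
  "('v, 'e) pre_digraph \<Rightarrow> ('e \<Rightarrow> box_map) \<Rightarrow> ('v \<Rightarrow> (real \<times> real) set) \<Rightarrow> ('e \<Rightarrow> real)
    \<Rightarrow> ('v \<Rightarrow> (real \<times> real) measure) \<Rightarrow> bool" where
  "invariant_measures G \<Psi> X p \<mu> \<longleftrightarrow>
     (\<forall>v\<in>verts G.
        prob_space (\<mu> v) \<and> sets (\<mu> v) = sets borel \<and> measure_support (\<mu> v) \<subseteq> X v \<and>
        (\<forall>A\<in>sets borel. measure (\<mu> v) A =
           (\<Sum>e\<in>out_arcs G v. p e * measure (\<mu> (head G e)) (apply_box (\<Psi> e) -` A))))"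

subsection \<open>The pressure matrices and the critical exponent at $q = 0$\<close>

text \<open>The \<open>L\<^sup>q\<close>-spectrum of a compactly supported Borel probability measure at \<open>q = 0\<close>.\<close>

definition lq_spectrum_0 :: "'a::metric_space measure \<Rightarrow> real" where
  "lq_spectrum_0 \<nu> = box_dimension (measure_support \<nu>)"

definition tau_x :: "('v \<Rightarrow> (real \<times> real) measure) \<Rightarrow> 'v \<Rightarrow> real" where
  "tau_x \<mu> v = lq_spectrum_0 (distr (\<mu> v) borel fst)"

definition tau_y :: "('v \<Rightarrow> (real \<times> real) measure) \<Rightarrow> 'v \<Rightarrow> real" where
  "tau_y \<mu> v = lq_spectrum_0 (distr (\<mu> v) borel snd)"

definition t_zero :: "('v, 'e) pre_digraph \<Rightarrow> ('v \<Rightarrow> (real \<times> real) measure) \<Rightarrow> real" where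
  "t_zero G \<mu> = (THE t. \<forall>v\<in>verts G. t = tau_x \<mu> v + tau_y \<mu> v)"

text \<open>
  The non-zero \<open>2 \<times> 2\<close> blocks: \<open>i\<close> and \<open>j\<close> are \<open>0\<close> for the index \<open>e(1)\<close> and \<open>1\<close> for \<open>e(2)\<close>;
  \<open>s\<close> and \<open>u\<close> stand for the values of \<open>\<tau>\<^sub>x\<close> and \<open>\<tau>\<^sub>y\<close> at the column edge.
\<close>

definition pressure_block ::
  "box_map \<Rightarrow> real \<Rightarrow> real \<Rightarrow> real \<Rightarrow> real \<Rightarrow> nat \<Rightarrow> nat \<Rightarrow> real" where
  "pressure_block f s u x y i j =
     (let a = box_a f; b = box_b f in
      if antidiagonal f then
        (if i = 0 \<and> j = 1 then a powr (x + u) * b powr (y - u)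
         else if i = 1 \<and> j = 0 then b powr (x + s) * a powr (y - s)
         else 0)
      else
        (if i = 0 \<and> j = 0 then a powr (x + s) * b powr (y - s)
         else if i = 1 \<and> j = 1 then b powr (x + u) * a powr (y - u)
         else 0))"

text \<open>
  The edges are enumerated as \<open>e\<^sub>0, \<dots>, e\<^sub>m\<^sub>-\<^sub>1\<close> by \<^const>\<open>from_nat_into\<close>; rows and columns \<open>2 k\<close> and
  \<open>2 k + 1\<close> carry the indices \<open>e\<^sub>k(1)\<close> and \<open>e\<^sub>k(2)\<close>. The spectral radius does not depend on
  the enumeration.
\<close>

definition pressure_matrix ::
  "('v, 'e) pre_digraph \<Rightarrow> ('e \<Rightarrow> box_map) \<Rightarrow> ('v \<Rightarrow> (real \<times> real) measure)
    \<Rightarrow> real \<Rightarrow> real \<Rightarrow> complex mat" where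
  "pressure_matrix G \<Psi> \<mu> x y =
     mat (2 * card (arcs G)) (2 * card (arcs G))
       (\<lambda>(m, n).
          let e = from_nat_into (arcs G) (m div 2); e' = from_nat_into (arcs G) (n div 2) in
          if head G e = tail G e'
          then complex_of_real (pressure_block (\<Psi> e')
                 (tau_x \<mu> (head G e')) (tau_y \<mu> (head G e')) x y (m mod 2) (n mod 2))
          else 0)"

definition gamma_hat_0 ::
  "('v, 'e) pre_digraph \<Rightarrow> ('e \<Rightarrow> box_map) \<Rightarrow> ('v \<Rightarrow> (real \<times> real) measure) \<Rightarrow> real" where
  "gamma_hat_0 G \<Psi> \<mu> =
     (THE \<gamma>. spectral_radius (pressure_matrix G \<Psi> \<mu> 0 \<gamma>) = 1 \<and>
             spectral_radius (pressure_matrix G \<Psi> \<mu> (\<gamma> - t_zero G \<mu>) (t_zero G \<mu>)) = 1)"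

end

theory Submission
  imports Defs "HOL-Library.Sublist"
begin

text \<open>
  Follow a word \<open>w\<close> of edges from \<open>v\<close> until the shorter side of the box \<open>\<psi>\<^sub>w([0,1]\<^sup>2)\<close> is about
  \<open>\<delta>\<close>. At scale \<open>\<delta>\<close> the part of \<open>X\<^sub>v\<close> in that box looks like its projection to the longer side, so
  it needs about \<open>(L/\<delta>)\<^sup>s\<close> sets of diameter \<open>\<delta>\<close>, where \<open>L\<close> is the longer side and \<open>s\<close> the box
  dimension of the projection. With \<open>\<delta>\<close> equal to the shorter side up to a constant, that is
  \<open>\<delta>\<close> to the power \<open>-\<gamma>\<close> times \<open>L\<^sup>s\<close> times \<open>\<delta>\<close> to the power \<open>\<gamma> - s\<close>. Hence \<open>X\<^sub>v\<close> has dimension \<open>\<gamma>\<close> if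
  the sum of these weights over the stopped words neither grows nor decays like a power of \<open>\<delta>\<close>.

  The natural bookkeeping is by states: pairs of a vertex and one of the two coordinate directions,
  where \<open>False\<close> is \<open>x\<close>, \<open>True\<close> is \<open>y\<close>, and an anti-diagonal edge switches the direction.
  Projections of the carpets to the axes form a graph-directed self-similar family in the line whose
  vertices are the states. They satisfy no separation condition, but up to a
  constant factor in the scale their covering numbers are supermultiplicative, so their box dimensions exist, and these are constant
  on classes of states that reach each other (\<open>has_box_dimension_proj\<close>, \<open>sdim_eq\<close>). The weight with the
  direction fixed at the start of the word is therefore multiplicative, its sums over words
  are iterates of a positive transfer operator on functions of states, and the pressure matrix
  with parameters \<open>0\<close> and \<open>\<gamma>\<close> is this operator: the index \<open>e(1)\<close> or \<open>e(2)\<close> stands for the state at the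
  head of \<open>e\<close>. Its spectral radius is the exponential growth rate of the iterates
  (\<open>growth_ge_spectral_radius\<close>, \<open>growth_le_of_spectral_radius_less\<close>), and it decreases
  strictly and continuously in \<open>\<gamma>\<close>.

  If the radius is below 1, a function with \<open>transfer h \<le> h\<close> bounds the sums over stopped words, which
  gives the upper bound for the dimension (\<open>cov_upper\<close>). If the radius is above 1, there is
  a function with \<open>transfer h \<ge> r h\<close> and \<open>r > 1\<close> on one class of states. ROSC lets a set of
  diameter \<open>\<delta>\<close> meet only boundedly many stopped boxes, which gives a lower bound
  (\<open>cov_lower\<close>), provided that the weight along the longer side dominates the one along the
  shorter side. This is the case when \<open>\<gamma>\<close> is at most \<open>t\<close>, the sum of the
  dimensions of the two projections. Since \<open>r > 1\<close>, the lower bound exceeds \<open>\<gamma>\<close> by a fixed amount, and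
  \<open>X\<^sub>v\<close>, being contained in a product, has upper box dimension at most \<open>t\<close>; so a radius above 1
  occurs only for \<open>\<gamma> < t\<close> (\<open>box_dimension_eq_critical_exponent\<close>).

  Finally, exchanging the two directions turns the matrix with parameters \<open>\<gamma> - t\<close> and \<open>t\<close> into the one
  with parameters \<open>0\<close> and \<open>\<gamma>\<close>, so both conditions that define the critical exponent are
  the same condition (\<open>spectral_radius_flip\<close>).
\<close>

section \<open>Covering numbers\<close>

abbreviation cov :: "real \<Rightarrow> 'a::metric_space set \<Rightarrow> nat" where
  "cov \<equiv> covering_number"

text \<open>
  Diameters are bounded pointwise, which avoids the boundedness side condition of \<^const>\<open>diameter\<close>;
  for \<open>0 \<le> \<delta>\<close> these are the covers over which the covering number minimises.
\<close>

definition delta_cover :: "real \<Rightarrow> 'a::metric_space set \<Rightarrow> 'a set set \<Rightarrow> bool" where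
  "delta_cover \<delta> S C \<longleftrightarrow> finite C \<and> S \<subseteq> \<Union>C \<and> (\<forall>U\<in>C. \<forall>x\<in>U. \<forall>y\<in>U. dist x y \<le> \<delta>)"

lemma delta_coverD:
  assumes "delta_cover \<delta> S C"
  shows "finite C" "S \<subseteq> \<Union>C" "\<And>U x y. U \<in> C \<Longrightarrow> x \<in> U \<Longrightarrow> y \<in> U \<Longrightarrow> dist x y \<le> \<delta>"
  using assms unfolding delta_cover_def by auto

lemma bounded_diameter_le_iff:
  fixes U :: "'a::metric_space set"
  assumes "0 \<le> \<delta>"
  shows "bounded U \<and> diameter U \<le> \<delta> \<longleftrightarrow> (\<forall>x\<in>U. \<forall>y\<in>U. dist x y \<le> \<delta>)"
proof (intro iffI conjI)
  assume "bounded U \<and> diameter U \<le> \<delta>"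
  then show "\<forall>x\<in>U. \<forall>y\<in>U. dist x y \<le> \<delta>"
    using diameter_bounded_bound[of U] by (meson order_trans)
next
  assume *: "\<forall>x\<in>U. \<forall>y\<in>U. dist x y \<le> \<delta>"
  then show "bounded U" unfolding bounded_def by blast
  show "diameter U \<le> \<delta>"
    unfolding diameter_def using * assms by (auto intro!: cSUP_least)
qed

lemma cov_eq_Least:
  assumes "0 \<le> \<delta>"
  shows "cov \<delta> S = (LEAST n. \<exists>C. delta_cover \<delta> S C \<and> card C = n)"
  unfolding covering_number_def delta_cover_def
  by (simp only: bounded_diameter_le_iff[OF assms]) (rule arg_cong[where f = Least], auto)

lemma cov_le:
  assumes "0 \<le> \<delta>" "delta_cover \<delta> S C"
  shows "cov \<delta> S \<le> card C"
  unfolding cov_eq_Least[OF assms(1)] using assms(2) by (auto intro: Least_le)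

lemma delta_cover_exists:
  assumes "compact S" "0 < \<delta>"
  shows "\<exists>C. delta_cover \<delta> S C"
proof -
  obtain k where k: "finite k" "S \<subseteq> (\<Union>x\<in>k. ball x (\<delta>/2))"
    using assms compact_eq_totally_bounded[of S] half_gt_zero by blast
  have "dist y z \<le> \<delta>" if "y \<in> ball x (\<delta>/2)" "z \<in> ball x (\<delta>/2)" for x y z :: 'a
    using that dist_triangle_half_r[of x y \<delta> z] by (auto simp: less_imp_le)
  then have "delta_cover \<delta> S ((\<lambda>x. ball x (\<delta>/2)) ` k)"
    unfolding delta_cover_def using k by blast
  then show ?thesis by blast
qed

lemma minimal_delta_cover:
  assumes "compact S" "0 < \<delta>"
  obtains C where "delta_cover \<delta> S C" "card C = cov \<delta> S"
proof -
  obtain C0 where "delta_cover \<delta> S C0" using delta_cover_exists[OF assms] by blast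
  then have "\<exists>C. delta_cover \<delta> S C \<and> card C = cov \<delta> S"
    unfolding cov_eq_Least[OF less_imp_le[OF assms(2)]]
    using LeastI[of "\<lambda>n. \<exists>C. delta_cover \<delta> S C \<and> card C = n" "card C0"] by blast
  then show ?thesis using that by blast
qed

lemma cov_antimono:
  assumes "compact S" "0 < \<delta>" "\<delta> \<le> \<delta>'"
  shows "cov \<delta>' S \<le> cov \<delta> S"
proof -
  obtain C where C: "delta_cover \<delta> S C" "card C = cov \<delta> S"
    using minimal_delta_cover assms(1,2) by blast
  then have "delta_cover \<delta>' S C" using assms(3) unfolding delta_cover_def by fastforce
  then show ?thesis using cov_le[of \<delta>' S C] C(2) assms by simp
qed

lemma cov_mono:
  assumes "compact T" "0 < \<delta>" "S \<subseteq> T"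
  shows "cov \<delta> S \<le> cov \<delta> T"
proof -
  obtain C where C: "delta_cover \<delta> T C" "card C = cov \<delta> T"
    using minimal_delta_cover assms(1,2) by blast
  then have "delta_cover \<delta> S C" using assms(3) unfolding delta_cover_def by fastforce
  then show ?thesis using cov_le[of \<delta> S C] C(2) assms by simp
qed

lemma cov_pos:
  assumes "compact S" "0 < \<delta>" "S \<noteq> {}"
  shows "1 \<le> cov \<delta> S"
proof -
  obtain C where C: "delta_cover \<delta> S C" "card C = cov \<delta> S"
    using minimal_delta_cover assms(1,2) by blast
  then have "C \<noteq> {}" "finite C" using assms(3) unfolding delta_cover_def by auto
  then show ?thesis using C(2) by (metis One_nat_def Suc_leI card_gt_0_iff)
qed

lemma cov_le_1:
  assumes "0 \<le> \<delta>" "\<And>x y. x \<in> S \<Longrightarrow> y \<in> S \<Longrightarrow> dist x y \<le> \<delta>"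
  shows "cov \<delta> S \<le> 1"
  using cov_le[of \<delta> S "{S}"] assms unfolding delta_cover_def by auto

lemma cov_Lipschitz_image:
  assumes "compact S" "0 < \<delta>" "0 < q"
    and "\<And>x y. x \<in> S \<Longrightarrow> y \<in> S \<Longrightarrow> dist (f x) (f y) \<le> q * dist x y"
  shows "cov (q * \<delta>) (f ` S) \<le> cov \<delta> S"
proof -
  obtain C where C: "delta_cover \<delta> S C" "card C = cov \<delta> S"
    using minimal_delta_cover assms(1,2) by blast
  let ?D = "(\<lambda>U. f ` (U \<inter> S)) ` C"
  have "delta_cover (q * \<delta>) (f ` S) ?D"
    unfolding delta_cover_def
  proof (intro conjI ballI)
    show "finite ?D" using delta_coverD(1)[OF C(1)] by simp
    show "f ` S \<subseteq> \<Union> ?D" using delta_coverD(2)[OF C(1)] by blast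
    fix W x y assume "W \<in> ?D" "x \<in> W" "y \<in> W"
    then obtain U a b where "U \<in> C" "a \<in> U" "b \<in> U" "a \<in> S" "b \<in> S" "x = f a" "y = f b"
      by auto
    then show "dist x y \<le> q * \<delta>"
      using assms(3,4) delta_coverD(3)[OF C(1)]
      by (metis less_imp_le mult_left_mono order_trans)
  qed
  then have "cov (q * \<delta>) (f ` S) \<le> card ?D"
    using cov_le assms(2,3) by (metis less_imp_le mult_pos_pos)
  also have "\<dots> \<le> card C" using card_image_le delta_coverD(1)[OF C(1)] by blast
  finally show ?thesis using C(2) by simp
qed

lemma cov_affine_image:
  fixes K :: "real set"
  assumes K: "compact K" and \<delta>: "0 < \<delta>" and r: "r \<noteq> 0"
  shows "cov \<delta> ((\<lambda>x. r * x + c) ` K) = cov (\<delta> / \<bar>r\<bar>) K"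
proof (rule antisym)
  let ?f = "\<lambda>x. r * x + c" and ?g = "\<lambda>x. (x - c) / r"
  have df: "dist (?f x) (?f y) = \<bar>r\<bar> * dist x y" for x y
    by (simp add: dist_real_def flip: abs_mult right_diff_distrib)
  have dg: "dist (?g x) (?g y) = (1 / \<bar>r\<bar>) * dist x y" for x y
    using r by (simp add: dist_real_def flip: diff_divide_distrib)
  show "cov \<delta> (?f ` K) \<le> cov (\<delta> / \<bar>r\<bar>) K"
    using cov_Lipschitz_image[OF K, of "\<delta>/\<bar>r\<bar>" "\<bar>r\<bar>" ?f] \<delta> r df by simp
  have cK: "compact (?f ` K)"
    by (intro compact_continuous_image K continuous_intros)
  have "?g ` ?f ` K = K" using r by (force simp: image_image)
  then show "cov (\<delta> / \<bar>r\<bar>) K \<le> cov \<delta> (?f ` K)"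
    using cov_Lipschitz_image[OF cK \<delta>, of "1/\<bar>r\<bar>" ?g] r dg by simp
qed

lemma cov_UN_le:
  assumes "finite I" "0 < \<delta>" "\<And>i. i \<in> I \<Longrightarrow> compact (T i)"
  shows "cov \<delta> (\<Union>i\<in>I. T i) \<le> (\<Sum>i\<in>I. cov \<delta> (T i))"
proof -
  have "\<exists>C. \<forall>i\<in>I. delta_cover \<delta> (T i) (C i) \<and> card (C i) = cov \<delta> (T i)"
    by (rule bchoice) (meson minimal_delta_cover[OF assms(3,2)])
  then obtain C where C: "\<And>i. i \<in> I \<Longrightarrow> delta_cover \<delta> (T i) (C i)"
    "\<And>i. i \<in> I \<Longrightarrow> card (C i) = cov \<delta> (T i)" by blast
  have "delta_cover \<delta> (\<Union>i\<in>I. T i) (\<Union>i\<in>I. C i)"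
    unfolding delta_cover_def
  proof (intro conjI ballI)
    show "finite (\<Union>i\<in>I. C i)" using delta_coverD(1)[OF C(1)] assms(1) by blast
    show "(\<Union>i\<in>I. T i) \<subseteq> \<Union>(\<Union>i\<in>I. C i)" using delta_coverD(2)[OF C(1)] by blast
    fix U x y assume "U \<in> (\<Union>i\<in>I. C i)" "x \<in> U" "y \<in> U"
    then show "dist x y \<le> \<delta>" using delta_coverD(3)[OF C(1)] by blast
  qed
  then have "cov \<delta> (\<Union>i\<in>I. T i) \<le> card (\<Union>i\<in>I. C i)"
    using assms(2) by (intro cov_le) auto
  also have "\<dots> \<le> (\<Sum>i\<in>I. card (C i))" using card_UN_le[OF assms(1)] .
  finally show ?thesis using C(2) by simp
qed

text \<open>
  Double counting in an optimal cover of \<open>S\<close>: the members that meet \<open>T i\<close> cover \<open>T i\<close>, and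
  each member is used for at most \<open>K\<close> indices. Both lower bounds for covering
  numbers below rest on this.
\<close>

lemma sum_cov_le:
  assumes "finite I" "compact S" "0 < \<delta>"
    and sub: "\<And>i. i \<in> I \<Longrightarrow> T i \<subseteq> S"
    and overlap: "\<And>U. \<lbrakk>U \<subseteq> S; \<And>x y. x \<in> U \<Longrightarrow> y \<in> U \<Longrightarrow> dist x y \<le> \<delta>\<rbrakk>
                    \<Longrightarrow> card {i\<in>I. U \<inter> T i \<noteq> {}} \<le> K"
  shows "(\<Sum>i\<in>I. cov \<delta> (T i)) \<le> K * cov \<delta> S"
proof -
  obtain C where C: "delta_cover \<delta> S C" "card C = cov \<delta> S"
    using minimal_delta_cover assms(2,3) by blast
  note fin = delta_coverD(1)[OF C(1)]
  have "cov \<delta> (T i) \<le> card {U\<in>C. U \<inter> T i \<noteq> {}}" if "i \<in> I" for i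
  proof (rule cov_le)
    have "T i \<subseteq> \<Union>{U\<in>C. U \<inter> T i \<noteq> {}}" using delta_coverD(2)[OF C(1)] sub[OF that] by blast
    then show "delta_cover \<delta> (T i) {U\<in>C. U \<inter> T i \<noteq> {}}"
      using fin delta_coverD(3)[OF C(1)] unfolding delta_cover_def by auto
  qed (use assms in simp)
  then have "(\<Sum>i\<in>I. cov \<delta> (T i)) \<le> (\<Sum>i\<in>I. card {U\<in>C. U \<inter> T i \<noteq> {}})"
    by (intro sum_mono) auto
  also have "\<dots> = (\<Sum>i\<in>I. \<Sum>U\<in>C. if U \<inter> T i \<noteq> {} then 1 else 0)"
    using fin by (simp add: sum.If_cases Int_def)
  also have "\<dots> = (\<Sum>U\<in>C. \<Sum>i\<in>I. if U \<inter> T i \<noteq> {} then 1 else 0)"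
    by (rule sum.swap)
  also have "\<dots> = (\<Sum>U\<in>C. card {i\<in>I. U \<inter> T i \<noteq> {}})"
    using assms(1) by (simp add: sum.If_cases Int_def)
  also have "\<dots> \<le> (\<Sum>U\<in>C. K)"
  proof (rule sum_mono)
    fix U assume "U \<in> C"
    have "{i\<in>I. U \<inter> T i \<noteq> {}} = {i\<in>I. (U \<inter> S) \<inter> T i \<noteq> {}}" using sub by blast
    then show "card {i\<in>I. U \<inter> T i \<noteq> {}} \<le> K"
      using overlap[of "U \<inter> S"] delta_coverD(3)[OF C(1) \<open>U \<in> C\<close>] by auto
  qed
  finally show ?thesis using C(2) by (simp add: mult.commute)
qed

text \<open>
  A \<open>\<delta>/2\<close>-separated subset of maximal cardinality has no room for another point, so the closed
  balls of radius \<open>\<delta>/2\<close> around its points cover \<open>S\<close>.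
\<close>

lemma cov_le_separated:
  fixes S :: "'a::metric_space set"
  assumes "compact S" "0 < \<delta>"
  obtains F where "F \<subseteq> S" "finite F" "cov \<delta> S \<le> card F"
    "\<And>x y. x \<in> F \<Longrightarrow> y \<in> F \<Longrightarrow> x \<noteq> y \<Longrightarrow> \<delta>/2 < dist x y"
proof -
  define sep where
    "sep F \<longleftrightarrow> F \<subseteq> S \<and> finite F \<and> (\<forall>x\<in>F. \<forall>y\<in>F. x \<noteq> y \<longrightarrow> \<delta>/2 < dist x y)" for F
  obtain C where C: "delta_cover (\<delta>/2) S C"
    using delta_cover_exists[OF assms(1), of "\<delta>/2"] assms(2) by auto
  have bound: "card F \<le> card C" if "sep F" for F
  proof -
    have "F \<subseteq> S" using that unfolding sep_def by simp
    then have "\<forall>x\<in>F. \<exists>U\<in>C. x \<in> U" using delta_coverD(2)[OF C] by blast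
    then obtain g where g: "\<And>x. x \<in> F \<Longrightarrow> g x \<in> C \<and> x \<in> g x" by metis
    have "inj_on g F"
    proof (rule inj_onI, rule ccontr)
      fix x y assume *: "x \<in> F" "y \<in> F" "g x = g y" "x \<noteq> y"
      then have "dist x y \<le> \<delta>/2" using g delta_coverD(3)[OF C] by metis
      moreover have "\<delta>/2 < dist x y" using * that unfolding sep_def by blast
      ultimately show False by simp
    qed
    then show ?thesis using g delta_coverD(1)[OF C] by (intro card_inj_on_le) auto
  qed
  have "sep {}" unfolding sep_def by simp
  \<comment> \<open>Each member of a \<open>\<delta>/2\<close>-cover contains at most one point of a separated set, so a maximum exists.\<close>
  then obtain F where F: "sep F" and max: "\<And>F'. sep F' \<Longrightarrow> card F' \<le> card F"
    using ex_has_greatest_nat[of sep "{}" card "card C + 1"] bound by (metis le_imp_less_Suc Suc_eq_plus1 less_imp_le)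
  have cov: "\<exists>y\<in>F. dist y x \<le> \<delta>/2" if "x \<in> S" for x
  proof (rule ccontr)
    assume far: "\<not> ?thesis"
    then have "x \<notin> F" using assms(2) by force
    moreover have "sep (insert x F)"
      using F far that unfolding sep_def by (auto simp: not_le dist_commute)
    ultimately show False using max[of "insert x F"] F unfolding sep_def by auto
  qed
  have "dist y z \<le> \<delta>" if "y \<in> cball x (\<delta>/2)" "z \<in> cball x (\<delta>/2)" for x y z :: 'a
    using that dist_triangle_le[of y x z \<delta>] by (auto simp: dist_commute)
  moreover have "S \<subseteq> \<Union>((\<lambda>x. cball x (\<delta>/2)) ` F)" using cov by auto
  moreover have "finite F" using F unfolding sep_def by blast
  ultimately have "delta_cover \<delta> S ((\<lambda>x. cball x (\<delta>/2)) ` F)"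
    unfolding delta_cover_def by blast
  then have "cov \<delta> S \<le> card ((\<lambda>x. cball x (\<delta>/2)) ` F)"
    using cov_le assms(2) by (metis less_imp_le)
  also have "\<dots> \<le> card F" using F card_image_le unfolding sep_def by blast
  finally have "cov \<delta> S \<le> card F" .
  moreover have "\<delta>/2 < dist x y" if "x \<in> F" "y \<in> F" "x \<noteq> y" for x y
    using F that unfolding sep_def by blast
  moreover have "F \<subseteq> S" "finite F" using F unfolding sep_def by auto
  ultimately show ?thesis using that[of F] by blast
qed

lemma cov_le_projections:
  fixes S :: "(real \<times> real) set"
  assumes "compact S" "0 < \<delta>"
  shows "cov (2 * \<delta>) S \<le> cov \<delta> (fst ` S) * cov \<delta> (snd ` S)"
proof -
  have c: "compact (fst ` S)" "compact (snd ` S)"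
    using assms(1) by (auto intro!: compact_continuous_image continuous_intros)
  obtain C where C: "delta_cover \<delta> (fst ` S) C" "card C = cov \<delta> (fst ` S)"
    using minimal_delta_cover[OF c(1) assms(2)] by blast
  obtain D where D: "delta_cover \<delta> (snd ` S) D" "card D = cov \<delta> (snd ` S)"
    using minimal_delta_cover[OF c(2) assms(2)] by blast
  let ?E = "(\<lambda>(U, W). U \<times> W) ` (C \<times> D)"
  have "delta_cover (2 * \<delta>) S ?E"
    unfolding delta_cover_def
  proof (intro conjI ballI)
    show "finite ?E" using delta_coverD(1)[OF C(1)] delta_coverD(1)[OF D(1)] by simp
    show "S \<subseteq> \<Union>?E"
    proof
      fix z assume "z \<in> S"
      then obtain U W where "U \<in> C" "W \<in> D" "fst z \<in> U" "snd z \<in> W"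
        using delta_coverD(2)[OF C(1)] delta_coverD(2)[OF D(1)] by blast
      then have "U \<times> W \<in> ?E" "z \<in> U \<times> W" by (auto simp: mem_Times_iff)
      then show "z \<in> \<Union>?E" by blast
    qed
    fix Z x y assume "Z \<in> ?E" "x \<in> Z" "y \<in> Z"
    then obtain U W where "U \<in> C" "W \<in> D" "fst x \<in> U" "fst y \<in> U" "snd x \<in> W" "snd y \<in> W"
      by auto
    then have "dist (fst x) (fst y) \<le> \<delta>" "dist (snd x) (snd y) \<le> \<delta>"
      using delta_coverD(3)[OF C(1)] delta_coverD(3)[OF D(1)] by blast+
    moreover have "dist x y \<le> dist (fst x) (fst y) + dist (snd x) (snd y)"
      by (cases x; cases y) (simp add: dist_Pair_Pair sqrt_sum_squares_le_sum)
    ultimately show "dist x y \<le> 2 * \<delta>" by simp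
  qed
  then have "cov (2 * \<delta>) S \<le> card ?E"
    using cov_le[of "2 * \<delta>"] assms(2) by simp
  also have "\<dots> \<le> card (C \<times> D)"
    using delta_coverD(1)[OF C(1)] delta_coverD(1)[OF D(1)] by (intro card_image_le) simp
  finally show ?thesis using C(2) D(2) by (simp add: card_cartesian_product)
qed

lemma cov_unit_interval:
  fixes \<delta> :: real
  assumes "0 < \<delta>" "\<delta> \<le> 1"
  shows "real (cov \<delta> {0..1::real}) \<le> 2 / \<delta>"
proof -
  define n where "n = nat \<lfloor>1 / \<delta>\<rfloor>"
  have n: "real n \<le> 1 / \<delta>" using assms by (simp add: n_def)
  let ?C = "(\<lambda>k. {real k * \<delta> .. (real k + 1) * \<delta>}) ` {..n}"
  have "delta_cover \<delta> {0..1} ?C"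
    unfolding delta_cover_def
  proof (intro conjI ballI)
    show "{0..1} \<subseteq> \<Union>?C"
    proof
      fix x :: real assume x: "x \<in> {0..1}"
      define k where "k = nat \<lfloor>x / \<delta>\<rfloor>"
      have rk: "real k = of_int \<lfloor>x / \<delta>\<rfloor>" using x assms by (simp add: k_def)
      have "k \<le> n" unfolding k_def n_def using x assms by (intro nat_mono floor_mono divide_right_mono) auto
      moreover have "real k \<le> x / \<delta>" "x / \<delta> \<le> real k + 1"
        unfolding rk using of_int_floor_le real_of_int_floor_add_one_ge by auto
      then have "real k * \<delta> \<le> x" "x \<le> (real k + 1) * \<delta>"
        using iffD1[OF pos_le_divide_eq[OF assms(1)]] iffD1[OF pos_divide_le_eq[OF assms(1)]] by blast+
      ultimately show "x \<in> \<Union>?C" by force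
    qed
    fix U x y assume "U \<in> ?C" "x \<in> U" "y \<in> U"
    then show "dist x y \<le> \<delta>" by (auto simp: dist_real_def abs_le_iff algebra_simps)
  qed simp
  then have "cov \<delta> {0..1::real} \<le> card ?C"
    using cov_le assms by (metis less_imp_le)
  also have "\<dots> \<le> n + 1" using card_image_le[of "{..n}" "\<lambda>k. {real k * \<delta> .. (real k + 1) * \<delta>}"] by simp
  finally have "real (cov \<delta> {0..1::real}) \<le> 1 / \<delta> + 1" using n by linarith
  also have "\<dots> \<le> 2 / \<delta>" using assms by (simp add: field_simps)
  finally show ?thesis .
qed

section \<open>Box dimension as a power law\<close>

text \<open>
  A crude bound that treats positive and negative exponents at once. It absorbs all constants that come
  from scales known only up to bounded factors.
\<close>

lemma powr_le_endpoints:
  fixes x :: real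
  assumes "0 < a" "a \<le> x" "x \<le> b"
  shows "x powr p \<le> a powr p + b powr p"
proof (cases "0 \<le> p")
  case True
  then have "x powr p \<le> b powr p" using assms by (intro powr_mono2) auto
  then show ?thesis by (smt (verit) powr_ge_zero)
next
  case False
  then have "x powr p \<le> a powr p" using assms by (intro powr_mono2') auto
  then show ?thesis by (smt (verit) powr_ge_zero)
qed

text \<open>
  Exponents are compared through power laws: let \<open>\<delta>\<close> tend to 0.
\<close>

lemma powr_bound_imp_le:
  fixes a b C :: real
  assumes "\<And>\<delta>. 0 < \<delta> \<Longrightarrow> \<delta> \<le> 1 \<Longrightarrow> \<delta> powr (- a) \<le> C * \<delta> powr (- b)"
  shows "a \<le> b"
proof (rule ccontr)
  assume "\<not> a \<le> b"
  then have ab: "0 < a - b" by simp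
  have C: "1 \<le> C" using assms[of 1] by simp
  \<comment> \<open>chosen such that \<open>\<delta>\<close> to the power \<open>b - a\<close> is \<open>C + 1\<close>\<close>
  define \<delta> where "\<delta> = (1 / (C + 1)) powr (1 / (a - b))"
  have \<delta>: "0 < \<delta>" "\<delta> \<le> 1" using C ab by (auto simp: \<delta>_def intro!: powr_le1)
  have "\<delta> powr (- a) * \<delta> powr b \<le> C * \<delta> powr (- b) * \<delta> powr b"
    using assms[OF \<delta>] by (intro mult_right_mono) auto
  moreover have "\<delta> powr (- a) * \<delta> powr b = C + 1"
  proof -
    have "\<delta> powr (- a) * \<delta> powr b = \<delta> powr (- (a - b))" by (simp flip: powr_add)
    also have "\<dots> = (1 / (C + 1)) powr (-1)"
    proof -
      have "1 / (a - b) * (- (a - b)) = -1" using ab by (simp add: field_simps)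
      then show ?thesis unfolding \<delta>_def powr_powr by (simp only:)
    qed
    also have "\<dots> = C + 1" using C by (simp add: powr_minus)
    finally show ?thesis .
  qed
  moreover have "C * \<delta> powr (- b) * \<delta> powr b = C" using \<delta> powr_add[of \<delta> "- b" b] by simp
  ultimately show False by simp
qed

lemma powr_divide_minus:
  fixes x y p :: real
  assumes "0 < x" "0 < y"
  shows "(x / y) powr (- p) = y powr p * x powr (- p)"
  using assms by (simp add: powr_divide powr_minus field_simps)

lemma powr_ratio_le:
  fixes A B y z p :: real
  assumes "0 < A" "0 < y" "A * y \<le> z" "z \<le> B * y"
  shows "z powr p \<le> (A powr p + B powr p) * y powr p"
proof -
  have "(z / y) powr p \<le> A powr p + B powr p"
    using assms by (intro powr_le_endpoints) (auto simp: field_simps)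
  moreover have "0 < z" using assms by (metis less_le_trans mult_pos_pos)
  then have "z powr p = (z / y) powr p * y powr p" using assms by (simp add: powr_divide)
  ultimately show ?thesis by (simp add: mult_right_mono)
qed

lemma has_box_dimension_unique:
  "has_box_dimension S d \<Longrightarrow> has_box_dimension S d' \<Longrightarrow> d = d'"
  unfolding has_box_dimension_def by (rule tendsto_unique[rotated]) auto

lemma box_dimension_eq: "has_box_dimension S d \<Longrightarrow> box_dimension S = d"
  unfolding box_dimension_def by (auto intro: has_box_dimension_unique)

lemma has_box_dimensionI:
  assumes S: "compact S" "S \<noteq> {}"
    and upper: "\<And>\<epsilon>. 0 < \<epsilon> \<Longrightarrow> \<exists>C>0. \<forall>\<delta>. 0 < \<delta> \<and> \<delta> \<le> 1 \<longrightarrow>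
                    real (cov \<delta> S) \<le> C * \<delta> powr (- (d + \<epsilon>))"
    and lower: "\<And>\<epsilon>. 0 < \<epsilon> \<Longrightarrow> \<exists>C>0. \<forall>\<delta>. 0 < \<delta> \<and> \<delta> \<le> 1 \<longrightarrow>
                    \<delta> powr (- (d - \<epsilon>)) \<le> C * real (cov \<delta> S)"
  shows "has_box_dimension S d"
  unfolding has_box_dimension_def
proof (rule tendstoI)
  fix e :: real assume e: "0 < e"
  define \<epsilon> where "\<epsilon> = e / 2"
  have \<epsilon>: "0 < \<epsilon>" using e by (simp add: \<epsilon>_def)
  obtain C1 where C1: "C1 > 0" "\<And>\<delta>. 0 < \<delta> \<and> \<delta> \<le> 1 \<Longrightarrow>
      real (cov \<delta> S) \<le> C1 * \<delta> powr (- (d + \<epsilon>))" using upper[OF \<epsilon>] by blast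
  obtain C2 where C2: "C2 > 0" "\<And>\<delta>. 0 < \<delta> \<and> \<delta> \<le> 1 \<Longrightarrow>
      \<delta> powr (- (d - \<epsilon>)) \<le> C2 * real (cov \<delta> S)" using lower[OF \<epsilon>] by blast
  define B where "B = \<bar>ln C1\<bar> + \<bar>ln C2\<bar> + 1"
  have B: "0 < B" by (simp add: B_def)
  have "eventually (\<lambda>\<delta>. \<delta> < min 1 (exp (- (B / \<epsilon>)))) (at_right (0::real))"
    by (rule eventually_at_rightI[of 0 "min 1 (exp (- (B / \<epsilon>)))"]) auto
  moreover have "eventually (\<lambda>\<delta>. 0 < \<delta>) (at_right (0::real))"
    by (simp add: eventually_at_right_less)
  ultimately show "eventually (\<lambda>\<delta>. dist (ln (real (cov \<delta> S)) / - ln \<delta>) d < e) (at_right 0)"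
  proof eventually_elim
    case (elim \<delta>)
    let ?N = "real (cov \<delta> S)" and ?l = "- ln \<delta>"
    have \<delta>: "0 < \<delta>" "\<delta> \<le> 1" "\<delta> < exp (- (B / \<epsilon>))" using elim by auto
    have "ln \<delta> < - (B / \<epsilon>)" using \<delta> by (metis ln_exp ln_less_cancel_iff exp_gt_zero)
    then have l: "B < \<epsilon> * ?l" using \<epsilon> by (simp add: field_simps)
    then have l0: "0 < ?l" using B \<epsilon> by (smt (verit) mult_nonneg_nonpos)
    have N: "1 \<le> ?N" using cov_pos[OF S(1) \<delta>(1) S(2)] by simp
    have "ln ?N \<le> ln (C1 * \<delta> powr (- (d + \<epsilon>)))" using C1(2)[of \<delta>] \<delta> N by simp
    also have "\<dots> = ln C1 + (d + \<epsilon>) * ?l" using C1(1) \<delta> by (simp add: ln_mult ln_powr algebra_simps)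
    also have "\<dots> < (d + e) * ?l" using l by (simp add: B_def \<epsilon>_def algebra_simps)
    finally have u: "ln ?N / ?l < d + e" by (rule iffD2[OF pos_divide_less_eq[OF l0]])
    have "(d - \<epsilon>) * ?l = ln (\<delta> powr (- (d - \<epsilon>)))" using \<delta> by (simp add: ln_powr algebra_simps)
    also have "\<dots> \<le> ln (C2 * ?N)" using C2 \<delta> N by (intro ln_mono) auto
    also have "\<dots> = ln C2 + ln ?N" using C2(1) N by (simp add: ln_mult)
    finally have "(d - e) * ?l < ln ?N" using l by (simp add: B_def \<epsilon>_def algebra_simps)
    then have "d - e < ln ?N / ?l" by (rule iffD2[OF pos_less_divide_eq[OF l0]])
    then show ?case using u by (simp add: dist_real_def abs_less_iff)
  qed
qed

text \<open>
  For \<open>\<delta>\<close> in a compact part of \<open>(0, K]\<close> the covering number is bounded above and below, so a power law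
  near 0 extends to \<open>(0, K]\<close> at the cost of the constant. Scales above 1 are needed
  because the sides of a stopped box may be a little shorter than the scale.
\<close>

lemma has_box_dimensionD:
  assumes S: "compact S" "S \<noteq> {}" and d: "has_box_dimension S d" and \<epsilon>: "0 < \<epsilon>" and K: "0 < K"
  shows "\<exists>C>0. \<forall>\<delta>. 0 < \<delta> \<and> \<delta> \<le> K \<longrightarrow>
      real (cov \<delta> S) \<le> C * \<delta> powr (- (d + \<epsilon>)) \<and>
      \<delta> powr (- (d - \<epsilon>)) \<le> C * real (cov \<delta> S)"
proof -
  have "eventually (\<lambda>\<delta>. dist (ln (real (cov \<delta> S)) / - ln \<delta>) d < \<epsilon>) (at_right 0)"
    using d \<epsilon> unfolding has_box_dimension_def tendsto_iff by blast
  then obtain b where b: "b > 0" "\<And>\<delta>. 0 < \<delta> \<Longrightarrow> \<delta> < b \<Longrightarrow>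
      dist (ln (real (cov \<delta> S)) / - ln \<delta>) d < \<epsilon>"
    unfolding eventually_at_right_field by blast
  define a where "a = min (min (b/2) (1/2)) K"
  have a: "0 < a" "a < b" "a < 1" "a \<le> K" using b K by (auto simp: a_def)
  define C where "C = 1 + real (cov a S) * (a powr (d + \<epsilon>) + K powr (d + \<epsilon>))
                      + (a powr (- (d - \<epsilon>)) + K powr (- (d - \<epsilon>)))"
  have C1: "1 \<le> C" unfolding C_def by (simp add: add_nonneg_nonneg)
  show ?thesis
  proof (intro exI[of _ C] conjI allI impI)
    show "0 < C" using C1 by simp
    fix \<delta> assume "0 < \<delta> \<and> \<delta> \<le> K"
    then have \<delta>: "0 < \<delta>" "\<delta> \<le> K" by auto
    let ?N = "real (cov \<delta> S)" and ?l = "- ln \<delta>"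
    have N: "1 \<le> ?N" using cov_pos[OF S(1) \<delta>(1) S(2)] by simp
    have "?N \<le> C * \<delta> powr (- (d + \<epsilon>)) \<and> \<delta> powr (- (d - \<epsilon>)) \<le> C * ?N"
    proof (cases "\<delta> \<le> a")
      case True
      then have l: "0 < ?l" using \<delta> a by simp
      have "\<bar>ln ?N / ?l - d\<bar> < \<epsilon>" using b(2)[of \<delta>] \<delta> True a by (simp add: dist_real_def)
      then have "ln ?N / ?l < d + \<epsilon>" "d - \<epsilon> < ln ?N / ?l" by linarith+
      then have 1: "ln ?N < (d + \<epsilon>) * ?l" and 2: "(d - \<epsilon>) * ?l < ln ?N"
        using iffD1[OF pos_divide_less_eq[OF l]] iffD1[OF pos_less_divide_eq[OF l]] by blast+
      have "?N = exp (ln ?N)" using N by simp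
      also have "\<dots> \<le> exp ((d + \<epsilon>) * ?l)" using 1 by simp
      also have "\<dots> = \<delta> powr (- (d + \<epsilon>))" using \<delta> by (simp add: powr_def algebra_simps)
      finally have u: "?N \<le> \<delta> powr (- (d + \<epsilon>))" .
      have "\<delta> powr (- (d - \<epsilon>)) = exp ((d - \<epsilon>) * ?l)" using \<delta> by (simp add: powr_def algebra_simps)
      also have "\<dots> \<le> exp (ln ?N)" using 2 by simp
      also have "\<dots> = ?N" using N by simp
      finally have w: "\<delta> powr (- (d - \<epsilon>)) \<le> ?N" .
      have "1 * \<delta> powr (- (d + \<epsilon>)) \<le> C * \<delta> powr (- (d + \<epsilon>))" "1 * ?N \<le> C * ?N"
        using C1 by (intro mult_right_mono; simp)+
      then show ?thesis using u w by linarith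
    next
      case False
      have "?N \<le> real (cov a S)"
        using cov_antimono[OF S(1) a(1), of \<delta>] False by simp
      also have "\<dots> = (cov a S * \<delta> powr (d + \<epsilon>)) * \<delta> powr (- (d + \<epsilon>))"
        using \<delta> powr_add[of \<delta> "d + \<epsilon>" "- (d + \<epsilon>)"] by simp
      also have "\<dots> \<le> C * \<delta> powr (- (d + \<epsilon>))"
      proof (rule mult_right_mono)
        have "cov a S * \<delta> powr (d + \<epsilon>)
            \<le> cov a S * (a powr (d + \<epsilon>) + K powr (d + \<epsilon>))"
          using powr_le_endpoints[OF a(1), of \<delta> K] False \<delta> by (intro mult_left_mono) auto
        then show "cov a S * \<delta> powr (d + \<epsilon>) \<le> C"
          unfolding C_def using powr_ge_zero[of a "-(d-\<epsilon>)"] powr_ge_zero[of K "-(d-\<epsilon>)"] by linarith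
      qed simp
      finally have u: "?N \<le> C * \<delta> powr (- (d + \<epsilon>))" .
      have "0 \<le> real (cov a S) * (a powr (d + \<epsilon>) + K powr (d + \<epsilon>))"
        by (intro mult_nonneg_nonneg add_nonneg_nonneg) auto
      then have "\<delta> powr (- (d - \<epsilon>)) \<le> C"
        unfolding C_def using powr_le_endpoints[OF a(1), of \<delta> K "-(d-\<epsilon>)"] False \<delta>
        by linarith
      also have "C * 1 \<le> C * ?N" using C1 N by (intro mult_left_mono) auto
      finally show ?thesis using u by simp
    qed
    then show "?N \<le> C * \<delta> powr (- (d + \<epsilon>))" "\<delta> powr (- (d - \<epsilon>)) \<le> C * ?N" by auto
  qed
qed

lemma has_box_dimension_mono:
  assumes S: "compact S" "S \<noteq> {}" "has_box_dimension S d"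
    and T: "compact T" "T \<noteq> {}" "has_box_dimension T e"
    and c: "0 < c" "c \<le> 1"
    and le: "\<And>\<delta>. 0 < \<delta> \<Longrightarrow> \<delta> \<le> 1 \<Longrightarrow> cov \<delta> S \<le> cov (c * \<delta>) T"
  shows "d \<le> e"
proof (rule field_le_epsilon)
  fix \<epsilon> :: real assume "0 < \<epsilon>"
  then have h: "0 < \<epsilon>/4" by simp
  obtain C where C: "C > 0" "\<And>\<delta>. 0 < \<delta> \<and> \<delta> \<le> 1 \<Longrightarrow>
      \<delta> powr (- (d - \<epsilon>/4)) \<le> C * real (cov \<delta> S)"
    using has_box_dimensionD[OF S h, of 1] by force
  obtain D where D: "D > 0" "\<And>\<delta>. 0 < \<delta> \<and> \<delta> \<le> 1 \<Longrightarrow>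
      real (cov \<delta> T) \<le> D * \<delta> powr (- (e + \<epsilon>/4))"
    using has_box_dimensionD[OF T h, of 1] by force
  have "d - \<epsilon>/4 \<le> e + \<epsilon>/4"
  proof (rule powr_bound_imp_le[where C = "C * D * c powr (- (e + \<epsilon>/4))"])
    fix \<delta> :: real assume \<delta>: "0 < \<delta>" "\<delta> \<le> 1"
    have "\<delta> powr (- (d - \<epsilon>/4)) \<le> C * real (cov \<delta> S)" using C \<delta> by auto
    also have "\<dots> \<le> C * real (cov (c * \<delta>) T)" using le[OF \<delta>] C by auto
    also have "\<dots> \<le> C * (D * (c * \<delta>) powr (- (e + \<epsilon>/4)))"
      using C(1) D(2)[of "c * \<delta>"] mult_le_one[of c \<delta>] c \<delta> by (intro mult_left_mono) auto
    also have "\<dots> = C * D * c powr (- (e + \<epsilon>/4)) * \<delta> powr (- (e + \<epsilon>/4))"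
      using c \<delta> by (simp add: powr_mult)
    finally show "\<delta> powr (- (d - \<epsilon>/4)) \<le> C * D * c powr (- (e + \<epsilon>/4)) * \<delta> powr (- (e + \<epsilon>/4))" .
  qed
  then show "d \<le> e + \<epsilon>" using \<open>0 < \<epsilon>\<close> by simp
qed

text \<open>
  Fekete's argument. With \<open>g s\<close> the logarithm of the covering number at the scale \<open>exp (- s) / c\<close>,
  the hypothesis says that \<open>g\<close> is superadditive. As \<open>g\<close> is monotone, \<open>g s / s\<close> tends to its supremum,
  which is finite by the polynomial bound.
\<close>

lemma box_dimension_of_supermultiplicative:
  fixes S :: "'a::metric_space set"
  assumes S: "compact S" "S \<noteq> {}"
    and c: "0 < c" "c < 1"
    and super: "\<And>\<delta> \<delta>'. \<lbrakk>0 < \<delta>; \<delta> \<le> 1; 0 < \<delta>'; \<delta>' \<le> 1\<rbrakk> \<Longrightarrow>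
      cov \<delta> S * cov \<delta>' S \<le> cov (c * \<delta> * \<delta>') S"
    and poly: "\<And>\<delta>. \<lbrakk>0 < \<delta>; \<delta> \<le> 1\<rbrakk> \<Longrightarrow> real (cov \<delta> S) \<le> P / \<delta>"
  shows "\<exists>d. has_box_dimension S d"
proof -
  define g where "g s = ln (real (cov (exp (- s) / c) S))" for s
  define s0 where "s0 = - ln c"
  have s0: "0 < s0" using c by (simp add: s0_def)
  have ex: "exp (- s) / c \<le> 1" if "s0 \<le> s" for s
  proof -
    have "exp (- s) \<le> exp (ln c)" using that by (subst exp_le_cancel_iff) (simp add: s0_def)
    then show ?thesis using c by simp
  qed
  have N1: "1 \<le> real (cov \<delta> S)" if "0 < \<delta>" for \<delta>
    using cov_pos[OF S(1) that S(2)] by simp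
  have g0: "0 \<le> g s" for s unfolding g_def using N1[of "exp (-s)/c"] c by simp
  have gadd: "g s + g s' \<le> g (s + s')" if "s0 \<le> s" "s0 \<le> s'" for s s'
  proof -
    have e: "c * (exp (- s) / c) * (exp (- s') / c) = exp (- (s + s')) / c"
      using c by (simp add: exp_add[symmetric])
    have "real (cov (exp (- s) / c) S) * real (cov (exp (- s') / c) S)
        \<le> real (cov (exp (- (s + s')) / c) S)"
      using super[of "exp (- s) / c" "exp (- s') / c"] ex[OF that(1)] ex[OF that(2)] c
      unfolding e by (simp flip: of_nat_mult)
    then have "ln (real (cov (exp (- s) / c) S) * real (cov (exp (- s') / c) S))
        \<le> g (s + s')"
      unfolding g_def using N1[of "exp (-s)/c"] N1[of "exp (-s')/c"] c by (intro ln_mono) auto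
    then show ?thesis
      unfolding g_def using N1[of "exp (-s)/c"] N1[of "exp (-s')/c"] c by (simp add: ln_mult)
  qed
  have gmono: "g s \<le> g s'" if "s \<le> s'" for s s'
  proof -
    have "exp (- s') / c \<le> exp (- s) / c" using that c by (simp add: divide_right_mono)
    then have "cov (exp (- s) / c) S \<le> cov (exp (- s') / c) S"
      using c by (intro cov_antimono[OF S(1)]) auto
    then show ?thesis unfolding g_def using N1[of "exp (-s)/c"] c by (intro ln_mono) auto
  qed
  have P: "1 \<le> P" using poly[of 1] N1[of 1] by simp
  have gup: "g s / s \<le> (ln (P * c) + s) / s" if "s0 \<le> s" for s
  proof (rule divide_right_mono)
    have "g s \<le> ln (P / (exp (- s) / c))"
      unfolding g_def using N1[of "exp (-s)/c"] poly[of "exp (-s)/c"] ex[OF that] c by (intro ln_mono) auto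
    also have "P / (exp (- s) / c) = (P * c) * exp s" by (simp add: exp_minus field_simps)
    also have "ln \<dots> = ln (P * c) + s" using P c by (subst ln_mult) auto
    finally show "g s \<le> ln (P * c) + s" .
  qed (use that s0 in simp)
  define A where "A = (\<lambda>s. g s / s) ` {s0..}"
  have bdd: "bdd_above A"
    unfolding A_def
  proof (rule bdd_aboveI2)
    fix s assume "s \<in> {s0..}"
    then have s: "s0 \<le> s" by simp
    have "g s / s \<le> (ln (P * c) + s) / s" using gup[OF s] .
    also have "\<dots> = ln (P * c) / s + 1" using s s0 by (simp add: field_simps)
    also have "ln (P * c) / s \<le> \<bar>ln (P * c)\<bar> / s" using s s0 by (intro divide_right_mono) auto
    also have "\<dots> \<le> \<bar>ln (P * c)\<bar> / s0" using s s0 by (intro divide_left_mono) auto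
    finally show "g s / s \<le> \<bar>ln (P * c)\<bar> / s0 + 1" by simp
  qed
  have A_ne: "A \<noteq> {}" by (auto simp: A_def)
  define D where "D = Sup A"
  have gD: "g s \<le> D * s" if "s0 \<le> s" for s
  proof -
    have "g s / s \<le> D" unfolding D_def by (rule cSup_upper) (use that bdd in \<open>auto simp: A_def\<close>)
    then show ?thesis using that s0 by (simp add: pos_divide_le_eq)
  qed
  have "0 \<le> D * s0" using gD[of s0] g0[of s0] by linarith
  then have D0: "0 \<le> D" using s0 by (simp add: zero_le_mult_iff)
  have glow: "\<exists>B. \<forall>s\<ge>s0. (D - \<epsilon>) * s - B \<le> g s" if "0 < \<epsilon>" for \<epsilon>
  proof -
    obtain y where "y \<in> A" "D - \<epsilon> < y"
      using less_cSupD[of A "Sup A - \<epsilon>"] \<open>0 < \<epsilon>\<close> A_ne unfolding D_def by auto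
    then obtain s1 where s1: "s0 \<le> s1" "D - \<epsilon> < g s1 / s1" unfolding A_def by auto
    have s1p: "0 < s1" using s1 s0 by simp
    have mult: "real (Suc n) * g s1 \<le> g (real (Suc n) * s1)" for n
    proof (induction n)
      case (Suc n)
      have "s0 \<le> real (Suc n) * s1" using s1 s1p by (smt (verit) mult_le_cancel_right1 of_nat_Suc of_nat_0_le_iff)
      then have "g (real (Suc n) * s1) + g s1 \<le> g (real (Suc n) * s1 + s1)" using gadd s1(1) by blast
      then show ?case using Suc by (simp add: algebra_simps)
    qed simp
    have "(D - \<epsilon>) * s - (g s1 + D * s1) \<le> g s" if s: "s0 \<le> s" for s
    proof (cases "s1 \<le> s")
      case True
      define n where "n = nat \<lfloor>s / s1\<rfloor>"
      have fl: "1 \<le> \<lfloor>s / s1\<rfloor>" using True s1p by (simp add: le_floor_iff)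
      then obtain m where m: "n = Suc m" unfolding n_def by (metis One_nat_def Suc_le_D le_nat_iff nat_1 zero_le_one nat_mono)
      have rn: "real n = of_int \<lfloor>s / s1\<rfloor>" using fl by (simp add: n_def)
      have "real n \<le> s / s1" using rn of_int_floor_le[of "s/s1"] by simp
      then have "real n * s1 \<le> s" by (rule iffD1[OF pos_le_divide_eq[OF s1p]])
      then have "real n * g s1 \<le> g s" using mult[of m] gmono[of "real n * s1" s] m by (metis order_trans)
      moreover have "(s / s1 - 1) * g s1 \<le> real n * g s1"
        using rn g0[of s1] real_of_int_floor_add_one_ge[of "s/s1"] by (intro mult_right_mono) linarith+
      moreover have "(D - \<epsilon>) * s \<le> g s1 / s1 * s" using s1 s s0 by (intro mult_right_mono) auto
      moreover have "0 \<le> D * s1" using D0 s1p by simp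
      ultimately show ?thesis by (simp add: algebra_simps)
    next
      case False
      have "(D - \<epsilon>) * s \<le> D * s" using \<open>0 < \<epsilon>\<close> s s0 by (intro mult_right_mono) auto
      also have "\<dots> \<le> D * s1" using D0 False by (intro mult_left_mono) auto
      finally show ?thesis using g0[of s] g0[of s1] by linarith
    qed
    then show ?thesis by blast
  qed
  have gN: "g (s0 - ln \<delta>) = ln (real (cov \<delta> S))" if "0 < \<delta>" for \<delta>
    unfolding g_def s0_def using that c by (simp add: exp_add)
  have "has_box_dimension S D"
  proof (rule has_box_dimensionI[OF S])
    fix \<epsilon> :: real assume \<epsilon>: "0 < \<epsilon>"
    show "\<exists>C>0. \<forall>\<delta>. 0 < \<delta> \<and> \<delta> \<le> 1 \<longrightarrow> real (cov \<delta> S) \<le> C * \<delta> powr (- (D + \<epsilon>))"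
    proof (intro exI[of _ "exp (D * s0)"] conjI allI impI)
      fix \<delta> :: real assume \<delta>: "0 < \<delta> \<and> \<delta> \<le> 1"
      have "ln (real (cov \<delta> S)) \<le> D * (s0 - ln \<delta>)"
        using gD[of "s0 - ln \<delta>"] \<delta> gN[of \<delta>] by simp
      also have "\<dots> \<le> D * s0 + (- (D + \<epsilon>)) * ln \<delta>"
        using \<delta> \<epsilon> by (simp add: algebra_simps mult_nonneg_nonpos)
      finally have "exp (ln (real (cov \<delta> S))) \<le> exp (D * s0 + (- (D + \<epsilon>)) * ln \<delta>)" by simp
      also have "\<dots> = exp (D * s0) * \<delta> powr (- (D + \<epsilon>))" using \<delta> by (simp add: exp_add powr_def)
      finally show "real (cov \<delta> S) \<le> exp (D * s0) * \<delta> powr (- (D + \<epsilon>))"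
        using N1[of \<delta>] \<delta> by simp
    qed simp
    obtain B where B: "\<And>s. s0 \<le> s \<Longrightarrow> (D - \<epsilon>) * s - B \<le> g s" using glow[OF \<epsilon>] by blast
    show "\<exists>C>0. \<forall>\<delta>. 0 < \<delta> \<and> \<delta> \<le> 1 \<longrightarrow> \<delta> powr (- (D - \<epsilon>)) \<le> C * real (cov \<delta> S)"
    proof (intro exI[of _ "exp (B - (D - \<epsilon>) * s0)"] conjI allI impI)
      fix \<delta> :: real assume \<delta>: "0 < \<delta> \<and> \<delta> \<le> 1"
      have "(D - \<epsilon>) * (s0 - ln \<delta>) - B \<le> ln (real (cov \<delta> S))"
        using B[of "s0 - ln \<delta>"] \<delta> gN[of \<delta>] by simp
      then have "(- (D - \<epsilon>)) * ln \<delta> \<le> (B - (D - \<epsilon>) * s0) + ln (real (cov \<delta> S))"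
        by (simp add: algebra_simps)
      then have "exp ((- (D - \<epsilon>)) * ln \<delta>) \<le> exp ((B - (D - \<epsilon>) * s0) + ln (real (cov \<delta> S)))"
        by simp
      then show "\<delta> powr (- (D - \<epsilon>)) \<le> exp (B - (D - \<epsilon>) * s0) * real (cov \<delta> S)"
        using N1[of \<delta>] \<delta> by (simp add: exp_add powr_def)
    qed simp
  qed
  then show ?thesis by blast
qed

section \<open>Words and states of a box-like system\<close>

definition coord :: "bool \<Rightarrow> real \<times> real \<Rightarrow> real" where
  "coord i \<xi> = (if i then snd \<xi> else fst \<xi>)"

lemma continuous_on_coord [continuous_intros]: "continuous_on S (coord i)"
  unfolding coord_def by (cases i) (auto intro!: continuous_intros)

text \<open>
  The measures enter only through the dimensions of the projections, so the geometry is
  developed for the carpets alone.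
\<close>

locale carpet =
  fixes G :: "('v, 'e) pre_digraph"
    and \<Psi> :: "'e \<Rightarrow> box_map"
    and X :: "'v \<Rightarrow> (real \<times> real) set"
  assumes gifs: "box_like_gifs G \<Psi>"
    and conn: "strongly_connected_graph G"
    and rosc: "rosc G \<Psi>"
    and family: "carpet_family G \<Psi> X"

sublocale carpet \<subseteq> fin_digraph G
  using gifs unfolding box_like_gifs_def by simp

context carpet
begin

definition entry :: "bool \<Rightarrow> 'e \<Rightarrow> real" where
  "entry i e = (if i then row2 (\<Psi> e) else row1 (\<Psi> e))"

definition ratio :: "bool \<Rightarrow> 'e \<Rightarrow> real" where
  "ratio i e = \<bar>entry i e\<bar>"

text \<open>
  The \<open>i\<close>-th coordinate of \<open>\<psi>\<^sub>e \<xi>\<close> is an affine function of the coordinate \<open>turn i e\<close> of \<open>\<xi>\<close>, with slope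
  \<open>entry i e\<close>. Along a word, \<open>dir\<close> iterates \<open>turn\<close>, and \<open>len i w\<close> is the side length of the
  box \<open>\<psi>\<^sub>w([0,1]\<^sup>2)\<close> in direction \<open>i\<close>.
\<close>

definition turn :: "bool \<Rightarrow> 'e \<Rightarrow> bool" where
  "turn i e \<longleftrightarrow> i \<noteq> antidiagonal (\<Psi> e)"

primrec word :: "'v \<Rightarrow> 'e list \<Rightarrow> bool" where
  "word v [] \<longleftrightarrow> True"
| "word v (e # w) \<longleftrightarrow> e \<in> out_arcs G v \<and> word (head G e) w"

primrec target :: "'v \<Rightarrow> 'e list \<Rightarrow> 'v" where
  "target v [] = v"
| "target v (e # w) = target (head G e) w"

primrec wmap :: "'e list \<Rightarrow> real \<times> real \<Rightarrow> real \<times> real" where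
  "wmap [] = id"
| "wmap (e # w) = apply_box (\<Psi> e) \<circ> wmap w"

abbreviation cylinder :: "'v \<Rightarrow> 'e list \<Rightarrow> (real \<times> real) set" where
  "cylinder v w \<equiv> wmap w ` X (target v w)"

primrec dir :: "bool \<Rightarrow> 'e list \<Rightarrow> bool" where
  "dir i [] = i"
| "dir i (e # w) = dir (turn i e) w"

primrec len :: "bool \<Rightarrow> 'e list \<Rightarrow> real" where
  "len i [] = 1"
| "len i (e # w) = ratio i e * len (turn i e) w"

lemma coord_apply_box:
  "coord i (apply_box (\<Psi> e) \<xi>) = entry i e * coord (turn i e) \<xi> + coord i (translation (\<Psi> e))"
  by (simp add: coord_def apply_box_def entry_def turn_def)

lemma coord_wmap:
  "\<exists>\<sigma> c. \<bar>\<sigma>\<bar> = len i w \<and> (\<forall>\<xi>. coord i (wmap w \<xi>) = \<sigma> * coord (dir i w) \<xi> + c)"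
proof (induction w arbitrary: i)
  case Nil
  show ?case by (rule exI[of _ 1], rule exI[of _ 0]) simp
next
  case (Cons e w)
  obtain \<sigma> c where *: "\<bar>\<sigma>\<bar> = len (turn i e) w"
    "\<And>\<xi>. coord (turn i e) (wmap w \<xi>) = \<sigma> * coord (dir (turn i e) w) \<xi> + c"
    using Cons.IH[of "turn i e"] by blast
  show ?case
    by (rule exI[of _ "entry i e * \<sigma>"], rule exI[of _ "entry i e * c + coord i (translation (\<Psi> e))"])
      (simp add: coord_apply_box * abs_mult ratio_def algebra_simps)
qed

lemma turn_Not [simp]: "turn (\<not> i) e \<longleftrightarrow> \<not> turn i e"
  unfolding turn_def by blast

lemma dir_Not [simp]: "dir (\<not> i) w \<longleftrightarrow> \<not> dir i w"
  by (induction w arbitrary: i) (simp_all only: dir.simps turn_Not)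

lemma word_append [simp]: "word v (u @ w) \<longleftrightarrow> word v u \<and> word (target v u) w"
  by (induction u arbitrary: v) auto

lemma target_append [simp]: "target v (u @ w) = target (target v u) w"
  by (induction u arbitrary: v) auto

lemma dir_append [simp]: "dir i (u @ w) = dir (dir i u) w"
  by (induction u arbitrary: i) auto

lemma len_append [simp]: "len i (u @ w) = len i u * len (dir i u) w"
  by (induction u arbitrary: i) auto

lemma wmap_append [simp]: "wmap (u @ w) = wmap u \<circ> wmap w"
  by (induction u) auto

lemma target_in_verts: "v \<in> verts G \<Longrightarrow> word v w \<Longrightarrow> target v w \<in> verts G"
  by (induction w arbitrary: v) auto

lemma word_set: "word v w \<Longrightarrow> set w \<subseteq> arcs G"
  by (induction w arbitrary: v) auto

lemma finite_words: "finite {w. word v w \<and> length w = n}"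
  by (rule finite_subset[OF _ finite_lists_length_eq[OF finite_arcs, of n]]) (auto dest: word_set)

lemma word_of_awalk: "awalk v w v' \<Longrightarrow> word v w \<and> target v w = v'"
  by (induction w arbitrary: v) (auto simp: awalk_Cons_iff)

lemma out_arcs_nonempty: "v \<in> verts G \<Longrightarrow> out_arcs G v \<noteq> {}"
  using gifs unfolding box_like_gifs_def by simp

text \<open>
  The entry \<open>1/2\<close> keeps \<open>rmin\<close> and \<open>rmax\<close> strictly between 0 and 1 also for a graph without arcs.
\<close>

definition rmin :: real where
  "rmin = Min (insert (1/2) (case_prod ratio ` (UNIV \<times> arcs G)))"

definition rmax :: real where
  "rmax = Max (insert (1/2) (case_prod ratio ` (UNIV \<times> arcs G)))"

lemma ratio_pos: "e \<in> arcs G \<Longrightarrow> 0 < ratio i e"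
  and ratio_less_1: "e \<in> arcs G \<Longrightarrow> ratio i e < 1"
  using gifs unfolding box_like_gifs_def ratio_def entry_def box_a_def box_b_def by auto

lemma rmin_le_ratio: "e \<in> arcs G \<Longrightarrow> rmin \<le> ratio i e"
  unfolding rmin_def by (rule Min_le) auto

lemma ratio_le_rmax: "e \<in> arcs G \<Longrightarrow> ratio i e \<le> rmax"
  unfolding rmax_def by (rule Max_ge) auto

lemma rmin_pos: "0 < rmin"
  unfolding rmin_def using ratio_pos by (subst Min_gr_iff) auto

lemma rmax_less_1: "rmax < 1"
  unfolding rmax_def using ratio_less_1 by (subst Max_less_iff) auto

lemma rmin_le_half: "rmin \<le> 1/2"
  unfolding rmin_def by (rule Min_le) auto

lemma rmax_ge_half: "1/2 \<le> rmax"
  unfolding rmax_def by (rule Max_ge) auto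

lemma rmin_less_1: "rmin < 1" and rmax_pos: "0 < rmax" and rmin_le_rmax: "rmin \<le> rmax"
  using rmin_le_half rmax_ge_half by auto

lemma len_pos: "word v w \<Longrightarrow> 0 < len i w"
  by (induction w arbitrary: i v) (auto intro!: mult_pos_pos ratio_pos)

lemma len_le_1: "word v w \<Longrightarrow> len i w \<le> 1"
proof (induction w arbitrary: i v)
  case (Cons e w)
  then have "len (turn i e) w \<le> 1" "0 \<le> len (turn i e) w" "ratio i e \<le> 1"
    using len_pos[of "head G e" w "turn i e"] ratio_less_1[of e i] by auto
  then show ?case by (simp add: mult_le_one)
qed simp

definition unit_square :: "(real \<times> real) set" where
  "unit_square = {0..1} \<times> {0..1}"

lemma mem_unit_square: "\<xi> \<in> unit_square \<longleftrightarrow> (\<forall>i. 0 \<le> coord i \<xi> \<and> coord i \<xi> \<le> 1)"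
  unfolding unit_square_def coord_def by (cases \<xi>) (auto simp: all_bool_eq)

lemma continuous_on_apply_box: "continuous_on S (apply_box f)"
  unfolding apply_box_def by (cases "antidiagonal f") (auto intro!: continuous_intros)

lemma inj_apply_box: "e \<in> arcs G \<Longrightarrow> inj (apply_box (\<Psi> e))"
  using ratio_pos[of e True] ratio_pos[of e False]
  by (auto simp: inj_def apply_box_def ratio_def entry_def split: if_splits)

lemma apply_box_open_square:
  assumes "v \<in> verts G" "e \<in> out_arcs G v"
  shows "apply_box (\<Psi> e) ` open_unit_square \<subseteq> open_unit_square"
  using rosc assms unfolding rosc_def by blast

lemma apply_box_unit_square:
  assumes "e \<in> arcs G"
  shows "apply_box (\<Psi> e) ` unit_square \<subseteq> unit_square"
proof -
  have cl: "closure open_unit_square = unit_square"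
    unfolding open_unit_square_def unit_square_def by (simp add: closure_Times)
  have "apply_box (\<Psi> e) ` open_unit_square \<subseteq> open_unit_square"
    using apply_box_open_square[of "tail G e" e] assms by simp
  then have sub: "apply_box (\<Psi> e) ` open_unit_square \<subseteq> closure open_unit_square"
    using closure_subset by blast
  show ?thesis
    using image_closure_subset[OF continuous_on_apply_box closed_closure sub] unfolding cl .
qed

lemma X_compact: "v \<in> verts G \<Longrightarrow> compact (X v)"
  and X_nonempty: "v \<in> verts G \<Longrightarrow> X v \<noteq> {}"
  and X_eq: "v \<in> verts G \<Longrightarrow> X v = (\<Union>e\<in>out_arcs G v. apply_box (\<Psi> e) ` X (head G e))"
  using family unfolding carpet_family_def by blast+

text \<open>
  Let \<open>g\<close> be the distance to the unit square, measured in the maximum norm. All maps send the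
  square into itself and contract \<open>g\<close> by \<open>rmax\<close>, so a point that maximises \<open>g\<close> over the union of all
  carpets has \<open>g \<xi> \<le> rmax * g \<xi>\<close>.
\<close>

lemma X_subset_unit_square:
  assumes "v \<in> verts G"
  shows "X v \<subseteq> unit_square"
proof -
  define f :: "real \<Rightarrow> real" where "f x = max 0 (max (- x) (x - 1))" for x
  define g where "g \<xi> = max (f (coord False \<xi>)) (f (coord True \<xi>))" for \<xi>
  have g_ge: "f (coord i \<xi>) \<le> g \<xi>" for i \<xi> unfolding g_def by (cases i) auto
  have f0: "0 \<le> f x" for x by (simp add: f_def)
  have cont: "continuous_on S g" for S
    unfolding g_def f_def by (intro continuous_intros)
  let ?K = "\<Union>v\<in>verts G. X v"
  have "compact ?K" using X_compact by (intro compact_UN) auto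
  moreover have "?K \<noteq> {}" using X_nonempty[OF assms] assms by blast
  ultimately obtain \<xi> where \<xi>: "\<xi> \<in> ?K" "\<And>\<eta>. \<eta> \<in> ?K \<Longrightarrow> g \<eta> \<le> g \<xi>"
    using continuous_attains_sup[OF _ _ cont] by metis
  obtain u where u: "u \<in> verts G" "\<xi> \<in> X u" using \<xi>(1) by blast
  obtain e \<eta> where e: "e \<in> arcs G" "\<eta> \<in> X (head G e)" "\<xi> = apply_box (\<Psi> e) \<eta>"
    using X_eq[OF u(1)] u(2) by auto
  have \<eta>: "\<eta> \<in> ?K" using e(1,2) by auto
  have "f (coord i \<xi>) \<le> rmax * g \<xi>" for i
  proof -
    let ?r = "entry i e" and ?c = "coord i (translation (\<Psi> e))" and ?y = "coord (turn i e) \<eta>"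
    have "?c \<in> {0..1} \<and> ?r + ?c \<in> {0..1}"
    proof -
      have "(0,0) \<in> unit_square" "(1,1) \<in> unit_square" by (auto simp: unit_square_def)
      then have "apply_box (\<Psi> e) (0,0) \<in> unit_square" "apply_box (\<Psi> e) (1,1) \<in> unit_square"
        using apply_box_unit_square[OF e(1)] by blast+
      then have "0 \<le> coord i (apply_box (\<Psi> e) (0,0))" "coord i (apply_box (\<Psi> e) (0,0)) \<le> 1"
        "0 \<le> coord i (apply_box (\<Psi> e) (1,1))" "coord i (apply_box (\<Psi> e) (1,1)) \<le> 1"
        unfolding mem_unit_square by blast+
      moreover have "coord j (0,0) = 0" "coord j (1,1) = 1" for j by (auto simp: coord_def)
      ultimately show ?thesis unfolding coord_apply_box by simp
    qed
    then have "f (?r * ?y + ?c) \<le> \<bar>?r\<bar> * f ?y"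
    proof -
      consider "?y \<in> {0..1}" | "?y < 0" | "1 < ?y" by fastforce
      then show ?thesis
      proof cases
        case 1
        have "?r * ?y + ?c = (1 - ?y) * ?c + ?y * (?r + ?c)" by (simp add: algebra_simps)
        also have "\<dots> \<in> {0..1}"
          using 1 \<open>?c \<in> {0..1} \<and> ?r + ?c \<in> {0..1}\<close> convex_bound_le[of ?c 1 "?r + ?c" "1 - ?y" ?y] by auto
        finally show ?thesis by (simp add: f_def)
      next
        case 2
        then have "f ?y = - ?y" by (simp add: f_def)
        moreover have "\<bar>?r * ?y\<bar> = \<bar>?r\<bar> * (- ?y)" using 2 by (simp add: abs_mult)
        ultimately show ?thesis
          using \<open>?c \<in> {0..1} \<and> ?r + ?c \<in> {0..1}\<close> unfolding f_def by (auto simp: abs_le_iff)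
      next
        case 3
        then have "f ?y = ?y - 1" by (simp add: f_def)
        moreover have "\<bar>?r * (?y - 1)\<bar> = \<bar>?r\<bar> * (?y - 1)" using 3 by (simp add: abs_mult)
        moreover have "?r * ?y + ?c = ?r * (?y - 1) + (?r + ?c)" by (simp add: algebra_simps)
        ultimately show ?thesis
          using \<open>?c \<in> {0..1} \<and> ?r + ?c \<in> {0..1}\<close> unfolding f_def by (smt (verit) atLeastAtMost_iff)
      qed
    qed
    also have "\<dots> \<le> rmax * f ?y"
      using ratio_le_rmax[OF e(1), of i] f0 by (intro mult_right_mono) (auto simp: ratio_def)
    also have "\<dots> \<le> rmax * g \<eta>" using g_ge rmax_pos by (intro mult_left_mono) auto
    also have "\<dots> \<le> rmax * g \<xi>" using \<xi>(2)[OF \<eta>] rmax_pos by (intro mult_left_mono) auto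
    finally show ?thesis using coord_apply_box[of i e \<eta>] e(3) by simp
  qed
  from this[of False] this[of True] have "g \<xi> \<le> rmax * g \<xi>" unfolding g_def by (rule max.boundedI)
  then have "(1 - rmax) * g \<xi> \<le> 0" by (simp add: algebra_simps)
  then have "g \<xi> \<le> 0" using rmax_less_1 by (simp add: mult_le_0_iff)
  then have "f (coord i \<eta>) \<le> 0" if "\<eta> \<in> X v" for i \<eta>
    using \<xi>(2)[of \<eta>] g_ge[of i \<eta>] that assms by fastforce
  then show ?thesis unfolding f_def by (fastforce simp: mem_unit_square)
qed

lemma wmap_X_subset:
  assumes "v \<in> verts G" "word v w"
  shows "cylinder v w \<subseteq> X v"
  using assms
proof (induction w arbitrary: v)
  case (Cons e w)
  then have "wmap w ` X (target (head G e) w) \<subseteq> X (head G e)" by auto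
  then have "wmap (e # w) ` X (target v (e # w)) \<subseteq> apply_box (\<Psi> e) ` X (head G e)"
    by (auto simp: image_comp[symmetric])
  also have "\<dots> \<subseteq> X v" using Cons.prems X_eq[of v] by auto
  finally show ?case .
qed simp

lemma wmap_open_square:
  assumes "v \<in> verts G" "word v w"
  shows "wmap w ` open_unit_square \<subseteq> open_unit_square"
  using assms
proof (induction w arbitrary: v)
  case (Cons e w)
  have "wmap w ` open_unit_square \<subseteq> open_unit_square"
    by (rule Cons.IH[of "head G e"]) (use Cons.prems in auto)
  then have "wmap (e # w) ` open_unit_square \<subseteq> apply_box (\<Psi> e) ` open_unit_square"
    by (auto simp: image_comp[symmetric])
  also have "\<dots> \<subseteq> open_unit_square" using Cons.prems apply_box_open_square[of v e] by auto
  finally show ?case .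
qed simp

lemma wmap_disjoint:
  assumes "v \<in> verts G" "word v w" "word v w'" "\<not> prefix w w'" "\<not> prefix w' w"
  shows "wmap w ` open_unit_square \<inter> wmap w' ` open_unit_square = {}"
  using assms
proof (induction w arbitrary: v w')
  case (Cons e u)
  then obtain e' u' where w': "w' = e' # u'" by (cases w') auto
  have e: "e \<in> arcs G" "tail G e = v" "e' \<in> arcs G" "tail G e' = v" using Cons.prems w' by auto
  have im: "wmap (e # u) ` open_unit_square = apply_box (\<Psi> e) ` wmap u ` open_unit_square"
    "wmap w' ` open_unit_square = apply_box (\<Psi> e') ` wmap u' ` open_unit_square"
    by (simp_all add: w' image_comp)
  show ?case
  proof (cases "e = e'")
    case True
    then have "wmap u ` open_unit_square \<inter> wmap u' ` open_unit_square = {}"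
      using Cons.IH[of "head G e" u'] Cons.prems w' e by auto
    then have "apply_box (\<Psi> e') ` (wmap u ` open_unit_square \<inter> wmap u' ` open_unit_square) = {}"
      by (simp only: image_empty)
    then have "apply_box (\<Psi> e) ` wmap u ` open_unit_square \<inter> apply_box (\<Psi> e') ` wmap u' ` open_unit_square = {}"
      unfolding True image_Int[OF inj_apply_box[OF e(3)]] .
    then show ?thesis by (simp only: im)
  next
    case False
    have "wmap u ` open_unit_square \<subseteq> open_unit_square" "wmap u' ` open_unit_square \<subseteq> open_unit_square"
      using wmap_open_square[of "head G e" u] wmap_open_square[of "head G e'" u'] Cons.prems w' e by auto
    moreover have "apply_box (\<Psi> e) ` open_unit_square \<inter> apply_box (\<Psi> e') ` open_unit_square = {}"
      using rosc Cons.prems(1) e False unfolding rosc_def disjoint_family_on_def by auto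
    ultimately show ?thesis unfolding im by blast
  qed
qed simp

section \<open>Stopping words\<close>

text \<open>
  The sizes \<open>\<phi>\<close> used for stopping are a side length of the box, the minimum or the maximum of
  both. They have in common that one more letter shrinks them by a factor between \<open>rmin\<close> and \<open>rmax\<close>.
\<close>

definition contracting :: "'v \<Rightarrow> ('e list \<Rightarrow> real) \<Rightarrow> bool" where
  "contracting v \<phi> \<longleftrightarrow> \<phi> [] = 1 \<and>
     (\<forall>w e. word v (w @ [e]) \<longrightarrow> rmin * \<phi> w \<le> \<phi> (w @ [e]) \<and> \<phi> (w @ [e]) \<le> rmax * \<phi> w)"

text \<open>
  The words at which \<open>\<phi>\<close> drops to \<open>\<theta>\<close> or below for the first time: \<open>butlast w\<close> suffices here because a
  contracting size decreases along prefixes.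
\<close>

definition cut :: "('e list \<Rightarrow> real) \<Rightarrow> 'v \<Rightarrow> real \<Rightarrow> 'e list set" where
  "cut \<phi> v \<theta> = {w. word v w \<and> w \<noteq> [] \<and> \<phi> w \<le> \<theta> \<and> \<theta> < \<phi> (butlast w)}"

lemma cut_snoc:
  assumes "w \<in> cut \<phi> v \<theta>"
  obtains u e where "w = u @ [e]" "word v (u @ [e])" "\<phi> (u @ [e]) \<le> \<theta>" "\<theta> < \<phi> u"
proof (cases w rule: rev_cases)
  case Nil
  then show ?thesis using assms by (simp add: cut_def)
next
  case (snoc u e)
  then show ?thesis using assms by (intro that[of u e]) (simp_all add: cut_def)
qed

lemma contracting_len: "contracting v (len i)"
  unfolding contracting_def
proof (intro conjI allI impI)
  fix w e assume "word v (w @ [e])"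
  then have w: "0 \<le> len i w" "rmin \<le> ratio (dir i w) e" "ratio (dir i w) e \<le> rmax"
    using len_pos[of v w i] rmin_le_ratio[of e "dir i w"] ratio_le_rmax[of e "dir i w"] by auto
  show "rmin * len i w \<le> len i (w @ [e])"
    using mult_right_mono[OF w(2,1)] by (simp add: mult.commute)
  show "len i (w @ [e]) \<le> rmax * len i w"
    using mult_right_mono[OF w(3,1)] by (simp add: mult.commute)
qed simp

lemma contracting_min:
  assumes "contracting v \<phi>" "contracting v \<phi>'"
  shows "contracting v (\<lambda>w. min (\<phi> w) (\<phi>' w))"
  using assms rmin_pos rmax_pos unfolding contracting_def
  by (auto simp: min_mult_distrib_left intro: min.coboundedI1 min.coboundedI2)

lemma contracting_bounds:
  assumes "contracting v \<phi>" "word v w"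
  shows "rmin ^ length w \<le> \<phi> w" "\<phi> w \<le> rmax ^ length w"
proof -
  have "rmin ^ length w \<le> \<phi> w \<and> \<phi> w \<le> rmax ^ length w"
    using assms(2)
  proof (induction w rule: rev_induct)
    case Nil
    then show ?case using assms(1) by (simp add: contracting_def)
  next
    case (snoc e w)
    then have IH: "rmin ^ length w \<le> \<phi> w" "\<phi> w \<le> rmax ^ length w" by auto
    have "rmin * \<phi> w \<le> \<phi> (w @ [e])" "\<phi> (w @ [e]) \<le> rmax * \<phi> w"
      using assms(1) snoc.prems unfolding contracting_def by blast+
    moreover have "rmin * rmin ^ length w \<le> rmin * \<phi> w" "rmax * \<phi> w \<le> rmax * rmax ^ length w"
      using IH rmin_pos rmax_pos by (intro mult_left_mono; simp)+
    ultimately show ?case by simp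
  qed
  then show "rmin ^ length w \<le> \<phi> w" "\<phi> w \<le> rmax ^ length w" by auto
qed

lemma contracting_pos: "contracting v \<phi> \<Longrightarrow> word v w \<Longrightarrow> 0 < \<phi> w"
  using contracting_bounds(1)[of v \<phi> w] zero_less_power[OF rmin_pos, of "length w"] by linarith

lemma contracting_append_le:
  assumes "contracting v \<phi>" "word v (w @ u)"
  shows "\<phi> (w @ u) \<le> \<phi> w"
  using assms(2)
proof (induction u rule: rev_induct)
  case (snoc e u)
  have "\<phi> ((w @ u) @ [e]) \<le> rmax * \<phi> (w @ u)"
    using assms(1) snoc.prems unfolding contracting_def by (metis append.assoc)
  also have "\<dots> \<le> 1 * \<phi> (w @ u)"
    using contracting_pos[OF assms(1), of "w @ u"] snoc.prems rmax_less_1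
    by (intro mult_right_mono) auto
  also have "\<dots> \<le> \<phi> w" using snoc by simp
  finally show ?case by simp
qed simp

lemma cut_bounds:
  assumes "contracting v \<phi>" "w \<in> cut \<phi> v \<theta>"
  shows "word v w" "\<phi> w \<le> \<theta>" "rmin * \<theta> \<le> \<phi> w"
proof -
  show "word v w" "\<phi> w \<le> \<theta>" using assms(2) by (auto simp: cut_def)
  obtain u e where w: "w = u @ [e]" using assms(2) by (rule cut_snoc)
  have "rmin * \<theta> \<le> rmin * \<phi> u" using assms(2) rmin_pos by (auto simp: cut_def w)
  also have "\<dots> \<le> \<phi> w" using assms unfolding contracting_def cut_def w by blast
  finally show "rmin * \<theta> \<le> \<phi> w" .
qed

lemma cut_antichain:
  assumes "contracting v \<phi>" "w \<in> cut \<phi> v \<theta>" "w' \<in> cut \<phi> v \<theta>" "prefix w w'"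
  shows "w = w'"
proof (rule ccontr)
  assume "w \<noteq> w'"
  then obtain u where u: "w' = w @ u" "u \<noteq> []" using assms(4) by (auto elim: prefixE)
  then have "butlast w' = w @ butlast u" by (simp add: butlast_append)
  moreover have "word v (w @ butlast u)"
  proof -
    have "word v (w @ butlast u @ [last u])" using assms(3) u by (simp add: cut_def)
    then show ?thesis by simp
  qed
  ultimately have "\<phi> (butlast w') \<le> \<phi> w" using contracting_append_le[OF assms(1), of w "butlast u"] by simp
  then show False using assms(2,3) by (auto simp: cut_def)
qed

lemma cut_disjoint:
  assumes "v \<in> verts G" "contracting v \<phi>" "w \<in> cut \<phi> v \<theta>" "w' \<in> cut \<phi> v \<theta>" "w \<noteq> w'"
  shows "wmap w ` open_unit_square \<inter> wmap w' ` open_unit_square = {}"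
  using wmap_disjoint[OF assms(1)] cut_antichain[OF assms(2)] assms(3-5) cut_bounds(1)[OF assms(2)] by metis

lemma cut_length_bound:
  assumes "contracting v \<phi>" "0 < \<theta>"
  shows "\<exists>n. \<forall>w. word v w \<and> \<theta> < \<phi> w \<longrightarrow> length w < n"
proof -
  obtain n where n: "rmax ^ n < \<theta>" using real_arch_pow_inv[OF assms(2) rmax_less_1] by blast
  have "length w < n" if "word v w" "\<theta> < \<phi> w" for w
  proof (rule ccontr)
    assume "\<not> length w < n"
    then have "rmax ^ length w \<le> rmax ^ n" using rmax_pos rmax_less_1 by (intro power_decreasing) auto
    then show False using contracting_bounds(2)[OF assms(1) that(1)] that(2) n by linarith
  qed
  then show ?thesis by blast
qed

lemma finite_cut:
  assumes "contracting v \<phi>" "0 < \<theta>"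
  shows "finite (cut \<phi> v \<theta>)"
proof -
  obtain n where n: "\<And>w. word v w \<Longrightarrow> \<theta> < \<phi> w \<Longrightarrow> length w < n"
    using cut_length_bound[OF assms] by blast
  have "cut \<phi> v \<theta> \<subseteq> {w. set w \<subseteq> arcs G \<and> length w \<le> n}"
  proof (rule subsetI, simp, rule conjI)
    fix w assume w: "w \<in> cut \<phi> v \<theta>"
    then have "word v w" by (simp add: cut_def)
    then show "set w \<subseteq> arcs G" by (rule word_set)
    obtain u e where u: "w = u @ [e]" using w by (rule cut_snoc)
    then have "length u < n" using n[of u] w by (auto simp: cut_def)
    then show "length w \<le> n" using u by simp
  qed
  then show ?thesis using finite_lists_length_le[OF finite_arcs] by (rule finite_subset)
qed

text \<open>
  Expand \<open>F []\<close> letter by letter, but leave a word alone once it is stopped; after finitely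
  many steps all words are stopped. \<open>F\<close> may be negative, so the lemma also yields upper bounds.
\<close>

lemma le_sum_cut:
  fixes F :: "'e list \<Rightarrow> real"
  assumes \<phi>: "contracting v \<phi>" and \<theta>: "0 < \<theta>" "\<theta> < 1"
    and F: "\<And>w. word v w \<Longrightarrow> F w \<le> (\<Sum>e\<in>out_arcs G (target v w). F (w @ [e]))"
  shows "F [] \<le> (\<Sum>w\<in>cut \<phi> v \<theta>. F w)"
proof -
  \<comment> \<open>\<open>T n\<close>: words of length \<open>n\<close> still running; \<open>C n\<close>: words stopped by time \<open>n\<close>.\<close>
  define T where "T n = {w. word v w \<and> length w = n \<and> \<theta> < \<phi> w}" for n
  define C where "C n = {w \<in> cut \<phi> v \<theta>. length w \<le> n}" for n
  have finT: "finite (T n)" for n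
    unfolding T_def by (rule finite_subset[OF _ finite_words[of v n]]) auto
  have finC: "finite (C n)" for n
    unfolding C_def using finite_cut[OF \<phi> \<theta>(1)] by simp
  have step: "F [] \<le> (\<Sum>w\<in>T n. F w) + (\<Sum>w\<in>C n. F w)" for n
  proof (induction n)
    case 0
    have "T 0 = {[]}" using \<phi> \<theta> unfolding T_def contracting_def by auto
    moreover have "C 0 = {}" unfolding C_def cut_def by auto
    ultimately show ?case by simp
  next
    case (Suc n)
    define D where "D = {w \<in> cut \<phi> v \<theta>. length w = Suc n}"
    define E where "E = (SIGMA w:T n. out_arcs G (target v w))"
    have finD: "finite D" unfolding D_def using finite_cut[OF \<phi> \<theta>(1)] by simp
    have inj: "inj_on (\<lambda>(w, e). w @ [e]) E" by (auto simp: inj_on_def)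
    have im: "(\<lambda>(w, e). w @ [e]) ` E = T (Suc n) \<union> D"
    proof (intro equalityI subsetI)
      fix x assume "x \<in> (\<lambda>(w, e). w @ [e]) ` E"
      then show "x \<in> T (Suc n) \<union> D" by (auto simp: E_def T_def D_def cut_def)
    next
      fix x assume x: "x \<in> T (Suc n) \<union> D"
      then have "x \<noteq> []" "word v x" "length x = Suc n" by (auto simp: T_def D_def cut_def)
      then obtain w e where we: "x = w @ [e]" by (cases x rule: rev_cases) auto
      have "\<theta> < \<phi> w"
      proof (cases "x \<in> D")
        case True
        then show ?thesis by (simp add: D_def cut_def we)
      next
        case False
        then have "\<theta> < \<phi> (w @ [e])" using x by (simp add: T_def we)
        also have "\<dots> \<le> \<phi> w" using contracting_append_le[OF \<phi>] \<open>word v x\<close> we by blast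
        finally show ?thesis .
      qed
      then have "(w, e) \<in> E" using \<open>word v x\<close> \<open>length x = Suc n\<close> by (auto simp: E_def T_def we)
      then show "x \<in> (\<lambda>(w, e). w @ [e]) ` E" using we by force
    qed
    have "(\<Sum>w\<in>T n. F w) \<le> (\<Sum>w\<in>T n. \<Sum>e\<in>out_arcs G (target v w). F (w @ [e]))"
      by (intro sum_mono F) (simp add: T_def)
    also have "\<dots> = (\<Sum>(w, e)\<in>E. F (w @ [e]))"
      unfolding E_def using finT by (intro sum.Sigma) auto
    also have "\<dots> = (\<Sum>x\<in>T (Suc n) \<union> D. F x)"
      unfolding im[symmetric] using inj by (subst sum.reindex) (auto simp: case_prod_unfold)
    also have "\<dots> = (\<Sum>x\<in>T (Suc n). F x) + (\<Sum>x\<in>D. F x)"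
      using finT finD by (intro sum.union_disjoint) (auto simp: T_def D_def cut_def)
    finally have "(\<Sum>w\<in>T n. F w) \<le> (\<Sum>x\<in>T (Suc n). F x) + (\<Sum>x\<in>D. F x)" .
    moreover have "(\<Sum>w\<in>C (Suc n). F w) = (\<Sum>w\<in>C n. F w) + (\<Sum>x\<in>D. F x)"
    proof -
      have "C (Suc n) = C n \<union> D" by (auto simp: C_def D_def)
      moreover have "C n \<inter> D = {}" by (auto simp: C_def D_def)
      ultimately show ?thesis using finC finD by (simp add: sum.union_disjoint)
    qed
    ultimately show ?case using Suc by linarith
  qed
  obtain n where n: "\<And>w. word v w \<Longrightarrow> \<theta> < \<phi> w \<Longrightarrow> length w < n"
    using cut_length_bound[OF \<phi> \<theta>(1)] by blast
  have "T n = {}" using n by (fastforce simp: T_def)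
  moreover have "C n = cut \<phi> v \<theta>"
  proof -
    have "length w \<le> n" if "w \<in> cut \<phi> v \<theta>" for w
    proof -
      obtain u e where u: "w = u @ [e]" using \<open>w \<in> cut \<phi> v \<theta>\<close> by (rule cut_snoc)
      then show ?thesis using n[of u] that by (auto simp: cut_def)
    qed
    then show ?thesis by (auto simp: C_def)
  qed
  ultimately show ?thesis using step[of n] by simp
qed

text \<open>
  Instance of \<open>le_sum_cut\<close> for the indicator of \<open>\<xi> \<in> \<psi>\<^sub>w(X)\<close>: the point lies in some stopped cylinder.
\<close>

lemma X_covered_by_cut:
  assumes v: "v \<in> verts G" and \<phi>: "contracting v \<phi>" and \<theta>: "0 < \<theta>" "\<theta> < 1"
  shows "X v = (\<Union>w\<in>cut \<phi> v \<theta>. cylinder v w)"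
proof (intro equalityI subsetI)
  fix \<xi> assume \<xi>: "\<xi> \<in> X v"
  define F :: "'e list \<Rightarrow> real" where
    "F w = (if \<xi> \<in> cylinder v w then 1 else 0)" for w
  have "F [] \<le> (\<Sum>w\<in>cut \<phi> v \<theta>. F w)"
  proof (rule le_sum_cut[OF \<phi> \<theta>])
    fix w assume w: "word v w"
    let ?S = "\<Sum>e\<in>out_arcs G (target v w). F (w @ [e])"
    show "F w \<le> ?S"
    proof (cases "\<xi> \<in> cylinder v w")
      case True
      then obtain e where e: "e \<in> out_arcs G (target v w)" "\<xi> \<in> wmap w ` apply_box (\<Psi> e) ` X (head G e)"
        using X_eq[OF target_in_verts[OF v w]] by auto
      then have "F (w @ [e]) = 1" by (simp add: F_def image_comp)
      moreover have "F (w @ [e]) \<le> ?S"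
        using e(1) by (intro member_le_sum) (auto simp: F_def)
      ultimately show ?thesis by (simp add: F_def)
    qed (simp add: F_def sum_nonneg)
  qed
  moreover have "F [] = 1" using \<xi> by (simp add: F_def)
  ultimately have "\<exists>w\<in>cut \<phi> v \<theta>. F w \<noteq> 0" by (metis not_one_le_zero sum.neutral)
  then show "\<xi> \<in> (\<Union>w\<in>cut \<phi> v \<theta>. cylinder v w)" by (auto simp: F_def split: if_splits)
qed (use wmap_X_subset[OF v] in \<open>auto simp: cut_def\<close>)

section \<open>Classes of states\<close>

definition states :: "('v \<times> bool) set" where
  "states = verts G \<times> UNIV"

definition reach :: "'v \<times> bool \<Rightarrow> 'v \<times> bool \<Rightarrow> bool" where
  "reach u u' \<longleftrightarrow> (\<exists>w. word (fst u) w \<and> target (fst u) w = fst u' \<and> dir (snd u) w = snd u')"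

lemma reach_refl: "reach u u"
  unfolding reach_def by (rule exI[of _ "[]"]) simp

lemma reach_trans: "reach u u' \<Longrightarrow> reach u' u'' \<Longrightarrow> reach u u''"
  unfolding reach_def
proof (elim exE conjE)
  fix w w'
  assume "word (fst u) w" "target (fst u) w = fst u'" "dir (snd u) w = snd u'"
    "word (fst u') w'" "target (fst u') w' = fst u''" "dir (snd u') w' = snd u''"
  then show "\<exists>w. word (fst u) w \<and> target (fst u) w = fst u'' \<and> dir (snd u) w = snd u''"
    by (intro exI[of _ "w @ w'"]) simp
qed

lemma reach_flip: "reach (v, i) (v', j) \<Longrightarrow> reach (v, \<not> i) (v', \<not> j)"
  unfolding reach_def by auto

lemma reach_some_direction:
  assumes "v \<in> verts G" "v' \<in> verts G"
  obtains j where "reach (v, i) (v', j)"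
proof -
  obtain w where "awalk v w v'" using conn assms unfolding strongly_connected_graph_def by blast
  then have "reach (v, i) (v', dir i w)" using word_of_awalk unfolding reach_def by fastforce
  then show ?thesis using that by blast
qed

text \<open>
  The states are a double cover of the strongly connected graph, and \<open>reach_flip\<close> is its
  deck transformation. If \<open>u\<close> reaches \<open>u'\<close>, then \<open>u'\<close> reaches \<open>u\<close> or its flip; in the second case \<open>u\<close>
  reaches its flip, so by symmetry the flip reaches \<open>u\<close>.
\<close>

lemma reach_sym:
  assumes "fst u \<in> verts G" "fst u' \<in> verts G" "reach u u'"
  shows "reach u' u"
proof -
  obtain v i v' j where u: "u = (v, i)" "u' = (v', j)" by (metis surj_pair)
  obtain k where k: "reach (v', j) (v, k)" using reach_some_direction assms u by (metis fst_conv)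
  show ?thesis
  proof (cases "k = i")
    case True
    then show ?thesis using k u by simp
  next
    case False
    then have k': "k = (\<not> i)" by blast
    have "reach (v, i) (v', j)" using assms(3) u by simp
    then have "reach (v, i) (v, \<not> i)" using k unfolding k' by (rule reach_trans)
    then have "reach (v, \<not> i) (v, i)" using reach_flip[of v i v "\<not> i"] by simp
    with k have "reach (v', j) (v, i)" unfolding k' by (rule reach_trans)
    then show ?thesis using u by simp
  qed
qed

lemma reach_edge: "e \<in> arcs G \<Longrightarrow> reach (tail G e, i) (head G e, turn i e)"
  unfolding reach_def by (rule exI[of _ "[e]"]) simp

section \<open>Projections of the carpets\<close>

definition proj :: "'v \<times> bool \<Rightarrow> real set" where
  "proj u = coord (snd u) ` X (fst u)"

lemma compact_proj: "u \<in> states \<Longrightarrow> compact (proj u)"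
  unfolding proj_def states_def by (intro compact_continuous_image continuous_intros X_compact) auto

lemma proj_nonempty: "u \<in> states \<Longrightarrow> proj u \<noteq> {}"
  unfolding proj_def states_def using X_nonempty by auto

lemma proj_subset: "u \<in> states \<Longrightarrow> proj u \<subseteq> {0..1}"
  unfolding proj_def states_def using X_subset_unit_square mem_unit_square by fastforce

lemma cov_cylinder:
  assumes "v \<in> verts G" "word v w" "0 < \<delta>"
  shows "cov \<delta> (coord i ` cylinder v w)
       = cov (\<delta> / len i w) (proj (target v w, dir i w))"
proof -
  obtain \<sigma> c where \<sigma>: "\<bar>\<sigma>\<bar> = len i w" "\<And>\<xi>. coord i (wmap w \<xi>) = \<sigma> * coord (dir i w) \<xi> + c"
    using coord_wmap by blast
  have "coord i ` cylinder v w = (\<lambda>x. \<sigma> * x + c) ` proj (target v w, dir i w)"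
    by (simp add: proj_def image_image \<sigma>)
  moreover have "compact (proj (target v w, dir i w))"
    using assms target_in_verts by (intro compact_proj) (auto simp: states_def)
  ultimately show ?thesis
    using cov_affine_image[of _ \<delta> \<sigma> c] \<sigma>(1) len_pos[OF assms(2), of i] assms(3) by fastforce
qed

lemma coord_cylinder_dist:
  assumes "v \<in> verts G" "word v w" "\<xi> \<in> cylinder v w" "\<eta> \<in> cylinder v w"
  shows "dist (coord i \<xi>) (coord i \<eta>) \<le> len i w"
proof -
  obtain \<sigma> c where \<sigma>: "\<bar>\<sigma>\<bar> = len i w" "\<And>\<xi>. coord i (wmap w \<xi>) = \<sigma> * coord (dir i w) \<xi> + c"
    using coord_wmap by blast
  obtain a b where ab: "\<xi> = wmap w a" "\<eta> = wmap w b" "a \<in> unit_square" "b \<in> unit_square"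
    using assms(3,4) X_subset_unit_square[OF target_in_verts[OF assms(1,2)]] by blast
  have "0 \<le> coord (dir i w) a" "coord (dir i w) a \<le> 1" "0 \<le> coord (dir i w) b" "coord (dir i w) b \<le> 1"
    using ab by (auto simp: mem_unit_square)
  then have "\<bar>coord (dir i w) a - coord (dir i w) b\<bar> \<le> 1" by (simp add: abs_le_iff)
  then have "\<bar>\<sigma>\<bar> * \<bar>coord (dir i w) a - coord (dir i w) b\<bar> \<le> \<bar>\<sigma>\<bar> * 1" by (rule mult_left_mono) simp
  moreover have "dist (coord i \<xi>) (coord i \<eta>) = \<bar>\<sigma>\<bar> * \<bar>coord (dir i w) a - coord (dir i w) b\<bar>"
    unfolding ab \<sigma>(2) dist_real_def by (simp flip: abs_mult right_diff_distrib)
  ultimately show ?thesis using \<sigma>(1) by simp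
qed

lemma finite_states: "finite states"
  unfolding states_def by simp

text \<open>
  Fix one word for each of the finitely many pairs of states that reach each other. The function
  \<open>f\<close> will be the contraction ratio of a word, or a normalised weight.
\<close>

lemma return_words:
  fixes f :: "'v \<times> bool \<Rightarrow> 'e list \<Rightarrow> real"
  assumes pos: "\<And>u w. u \<in> states \<Longrightarrow> word (fst u) w \<Longrightarrow> 0 < f u w"
  shows "\<exists>q>0. q \<le> 1 \<and> (\<forall>u u'. u \<in> states \<and> u' \<in> states \<and> reach u u' \<longrightarrow>
    (\<exists>w. word (fst u) w \<and> target (fst u) w = fst u' \<and> dir (snd u) w = snd u' \<and> q \<le> f u w))"
proof -
  define Q where "Q u u' w \<longleftrightarrow> word (fst u) w \<and> target (fst u) w = fst u' \<and> dir (snd u) w = snd u'" for u u' w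
  define W where "W u u' = (SOME w. Q u u' w)" for u u'
  define g where "g p = (if reach (fst p) (snd p) then f (fst p) (W (fst p) (snd p)) else 1)" for p
  have W: "Q u u' (W u u')" if "reach u u'" for u u'
    unfolding W_def by (rule someI_ex) (use that in \<open>simp add: reach_def Q_def\<close>)
  define q where "q = Min (insert 1 (g ` (states \<times> states)))"
  have fin: "finite (insert 1 (g ` (states \<times> states)))" using finite_states by simp
  have gpos: "0 < g p" if "p \<in> states \<times> states" for p
  proof (cases "reach (fst p) (snd p)")
    case True
    then show ?thesis using W[OF True] pos[of "fst p"] that by (auto simp: g_def Q_def mem_Times_iff)
  qed (simp add: g_def)
  have "\<exists>w. Q u u' w \<and> q \<le> f u w" if *: "u \<in> states" "u' \<in> states" "reach u u'" for u u'
  proof -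
    have "q \<le> g (u, u')" unfolding q_def using fin * by (intro Min_le) auto
    then show ?thesis using W[OF *(3)] *(3) by (auto simp: g_def)
  qed
  moreover have "0 < q" unfolding q_def using fin gpos by (subst Min_gr_iff) auto
  moreover have "q \<le> 1" unfolding q_def using fin by (intro Min_le) auto
  ultimately show ?thesis unfolding Q_def by blast
qed

lemma target_in_states: "v \<in> verts G \<Longrightarrow> word v w \<Longrightarrow> (target v w, j) \<in> states"
  unfolding states_def using target_in_verts by simp

lemma reach_word: "word v w \<Longrightarrow> reach (v, i) (target v w, dir i w)"
  unfolding reach_def by auto

text \<open>
  About \<open>N\<^sub>\<delta>(u)\<close> points of the projection \<open>u\<close> are \<open>\<delta>/2\<close>-separated. Around each of them there is a
  cylinder of length between \<open>rmin * \<delta>/8\<close> and \<open>\<delta>/8\<close>; append a return word to it so that it ends in the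
  state \<open>u'\<close>. The cylinders are further apart than \<open>c \<delta> \<delta>'\<close>, and each contains a copy of the
  projection \<open>u'\<close> scaled by at least \<open>c \<delta>\<close>, so each needs \<open>N\<^sub>\<delta>\<^sub>'(u')\<close> sets of
  diameter \<open>c \<delta> \<delta>'\<close>. No separation of the projected system is involved.
\<close>

lemma cov_supermultiplicative:
  "\<exists>c>0. c < 1 \<and> (\<forall>u u' \<delta> \<delta>'.
     u \<in> states \<and> u' \<in> states \<and> reach u u' \<and> 0 < \<delta> \<and> \<delta> \<le> 1 \<and> 0 < \<delta>' \<and> \<delta>' \<le> 1 \<longrightarrow>
       cov \<delta> (proj u) * cov \<delta>' (proj u') \<le> cov (c * \<delta> * \<delta>') (proj u))"
proof -
  obtain q where q: "0 < q" "q \<le> 1"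
    "\<And>u u'. \<lbrakk>u \<in> states; u' \<in> states; reach u u'\<rbrakk> \<Longrightarrow>
       \<exists>w. word (fst u) w \<and> target (fst u) w = fst u' \<and> dir (snd u) w = snd u' \<and> q \<le> len (snd u) w"
    using return_words[of "\<lambda>u w. len (snd u) w"] len_pos by blast
  define c where "c = rmin * q / 8"
  have "rmin * q \<le> (1/2) * 1" using rmin_le_half q rmin_pos by (intro mult_mono) auto
  then have c: "0 < c" "c \<le> 1/16" using rmin_pos q(1) unfolding c_def by (simp_all add: mult.commute)
  show ?thesis
  proof (intro exI[of _ c] conjI allI impI)
    show "0 < c" "c < 1" using c by auto
    fix u u' and \<delta> \<delta>' :: real
    assume "u \<in> states \<and> u' \<in> states \<and> reach u u' \<and> 0 < \<delta> \<and> \<delta> \<le> 1 \<and> 0 < \<delta>' \<and> \<delta>' \<le> 1"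
    then have u: "u \<in> states" "u' \<in> states" "reach u u'" and \<delta>: "0 < \<delta>" "\<delta> \<le> 1"
      and \<delta>': "0 < \<delta>'" "\<delta>' \<le> 1" by auto
    obtain v i where vi: "u = (v, i)" "v \<in> verts G" using u(1) by (auto simp: states_def)
    define \<epsilon> where "\<epsilon> = c * \<delta> * \<delta>'"
    have \<epsilon>: "0 < \<epsilon>" using c \<delta> \<delta>' by (simp add: \<epsilon>_def)
    have "c * \<delta> * \<delta>' \<le> 1/16 * \<delta> * 1" using c \<delta> \<delta>' by (intro mult_mono) auto
    then have \<epsilon>_le: "\<epsilon> \<le> \<delta>/16" by (simp add: \<epsilon>_def)
    obtain F where F: "F \<subseteq> proj u" "finite F" "cov \<delta> (proj u) \<le> card F"
      "\<And>x y. x \<in> F \<Longrightarrow> y \<in> F \<Longrightarrow> x \<noteq> y \<Longrightarrow> \<delta>/2 < dist x y"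
      using cov_le_separated[OF compact_proj[OF u(1)] \<delta>(1)] by blast
    have "\<exists>T. T \<subseteq> proj u \<and> T \<subseteq> cball x (\<delta>/8) \<and>
              cov \<delta>' (proj u') \<le> cov \<epsilon> T" if "x \<in> F" for x
    proof -
      obtain \<xi> where \<xi>: "\<xi> \<in> X v" "x = coord i \<xi>"
        using \<open>x \<in> F\<close> F(1) by (auto simp: proj_def vi(1))
      have \<theta>: "0 < \<delta>/8" "\<delta>/8 < 1" using \<delta> by auto
      obtain w where w: "w \<in> cut (len i) v (\<delta>/8)" "\<xi> \<in> cylinder v w"
        using \<xi>(1) X_covered_by_cut[OF vi(2) contracting_len \<theta>] by blast
      note wb = cut_bounds[OF contracting_len w(1)]
      have st: "(target v w, dir i w) \<in> states" using target_in_states vi(2) wb(1) by blast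
      have "reach (target v w, dir i w) u"
        using reach_sym[OF _ _ reach_word[OF wb(1), of i]] vi st by (auto simp: states_def)
      then have "reach (target v w, dir i w) u'" using u(3) by (rule reach_trans)
      then obtain p where p: "word (target v w) p" "target (target v w) p = fst u'"
        "dir (dir i w) p = snd u'" "q \<le> len (dir i w) p"
        using q(3)[OF st u(2)] by auto
      define T where "T = coord i ` cylinder v (w @ p)"
      have wp: "word v (w @ p)" using wb(1) p(1) by simp
      have sub: "cylinder v (w @ p) \<subseteq> cylinder v w"
        using wmap_X_subset[OF _ p(1)] target_in_verts[OF vi(2) wb(1)]
        by auto
      have "T \<subseteq> proj u"
        unfolding T_def proj_def vi(1) using wmap_X_subset[OF vi(2) wp] by auto
      moreover have "T \<subseteq> cball x (\<delta>/8)"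
      proof
        fix y assume "y \<in> T"
        then obtain \<eta> where "\<eta> \<in> cylinder v w" "y = coord i \<eta>"
          using sub unfolding T_def by blast
        then have "dist x y \<le> len i w"
          using coord_cylinder_dist[OF vi(2) wb(1) w(2)] \<xi>(2) by simp
        then show "y \<in> cball x (\<delta>/8)" using wb(2) by simp
      qed
      moreover have "cov \<delta>' (proj u') \<le> cov \<epsilon> T"
      proof -
        have "rmin * (\<delta>/8) * q \<le> len i w * len (dir i w) p"
          using wb(3) p(4) q(1) \<delta> rmin_pos len_pos[OF wb(1), of i] by (intro mult_mono) auto
        then have "c * \<delta> \<le> len i (w @ p)" by (simp add: c_def mult.commute mult.left_commute)
        then have "\<epsilon> \<le> len i (w @ p) * \<delta>'" unfolding \<epsilon>_def using \<delta>' by (intro mult_right_mono) auto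
        then have "\<epsilon> / len i (w @ p) \<le> \<delta>'"
          using len_pos[OF wp, of i] by (simp add: pos_divide_le_eq mult.commute)
        moreover have "cov \<epsilon> T = cov (\<epsilon> / len i (w @ p)) (proj u')"
          unfolding T_def using cov_cylinder[OF vi(2) wp \<epsilon>, of i] p(2,3) by simp
        ultimately show ?thesis
          using cov_antimono[OF compact_proj[OF u(2)]] \<epsilon> len_pos[OF wp, of i] by simp
      qed
      ultimately show ?thesis by blast
    qed
    then obtain T where T: "\<And>x. x \<in> F \<Longrightarrow> T x \<subseteq> proj u" "\<And>x. x \<in> F \<Longrightarrow> T x \<subseteq> cball x (\<delta>/8)"
      "\<And>x. x \<in> F \<Longrightarrow> cov \<delta>' (proj u') \<le> cov \<epsilon> (T x)" by metis
    have "cov \<delta> (proj u) * cov \<delta>' (proj u')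
        \<le> card F * cov \<delta>' (proj u')" using F(3) by (rule mult_right_mono) simp
    also have "\<dots> = (\<Sum>x\<in>F. cov \<delta>' (proj u'))" by simp
    also have "\<dots> \<le> (\<Sum>x\<in>F. cov \<epsilon> (T x))" using T(3) by (rule sum_mono)
    also have "\<dots> \<le> 1 * cov \<epsilon> (proj u)"
    proof (rule sum_cov_le[OF F(2) compact_proj[OF u(1)] \<epsilon>])
      fix U :: "real set" assume U: "\<And>x y. x \<in> U \<Longrightarrow> y \<in> U \<Longrightarrow> dist x y \<le> \<epsilon>"
      have "x = y" if xy: "x \<in> F" "y \<in> F" "U \<inter> T x \<noteq> {}" "U \<inter> T y \<noteq> {}" for x y
      proof (rule ccontr)
        assume "x \<noteq> y"
        obtain a b where ab: "a \<in> U" "a \<in> T x" "b \<in> U" "b \<in> T y" using xy by blast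
        then have "a \<in> cball x (\<delta>/8)" "b \<in> cball y (\<delta>/8)" "dist a b \<le> \<epsilon>"
          using T(2) xy(1,2) U by blast+
        then have "dist x a \<le> \<delta>/8" "dist y b \<le> \<delta>/8" "dist a b \<le> \<epsilon>" by simp_all
        then have "dist x y \<le> \<delta>/8 + \<epsilon> + \<delta>/8"
          unfolding dist_real_def by linarith
        then show False using F(4)[OF xy(1,2) \<open>x \<noteq> y\<close>] \<epsilon>_le \<delta>(1) by linarith
      qed
      then show "card {x \<in> F. U \<inter> T x \<noteq> {}} \<le> 1"
        using F(2) by (subst One_nat_def, subst card_le_Suc0_iff_eq) auto
    qed (use T(1) in auto)
    finally show "cov \<delta> (proj u) * cov \<delta>' (proj u')
        \<le> cov (c * \<delta> * \<delta>') (proj u)" by (simp add: \<epsilon>_def)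
  qed
qed

definition sdim :: "'v \<times> bool \<Rightarrow> real" where
  "sdim u = box_dimension (proj u)"

lemma has_box_dimension_proj:
  assumes "u \<in> states"
  shows "has_box_dimension (proj u) (sdim u)"
proof -
  obtain c where c: "0 < c" "c < 1"
    "\<And>u u' \<delta> \<delta>'. \<lbrakk>u \<in> states; u' \<in> states; reach u u'; 0 < \<delta>; \<delta> \<le> 1; 0 < \<delta>'; \<delta>' \<le> 1\<rbrakk> \<Longrightarrow>
       cov \<delta> (proj u) * cov \<delta>' (proj u') \<le> cov (c * \<delta> * \<delta>') (proj u)"
    using cov_supermultiplicative by blast
  have "\<exists>d. has_box_dimension (proj u) d"
  proof (rule box_dimension_of_supermultiplicative[OF compact_proj[OF assms] proj_nonempty[OF assms] c(1,2)])
    show "cov \<delta> (proj u) * cov \<delta>' (proj u) \<le> cov (c * \<delta> * \<delta>') (proj u)"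
      if "0 < \<delta>" "\<delta> \<le> 1" "0 < \<delta>'" "\<delta>' \<le> 1" for \<delta> \<delta>'
      using c(3)[OF assms assms reach_refl that] .
    show "real (cov \<delta> (proj u)) \<le> 2 / \<delta>" if "0 < \<delta>" "\<delta> \<le> 1" for \<delta>
    proof -
      have "real (cov \<delta> (proj u)) \<le> real (cov \<delta> {0..1::real})"
        using cov_mono[OF _ that(1) proj_subset[OF assms]] by simp
      then show ?thesis using cov_unit_interval[OF that] by linarith
    qed
  qed
  then show ?thesis unfolding sdim_def using box_dimension_eq by metis
qed

text \<open>
  Take \<open>\<delta> = 1\<close> in the supermultiplicativity.
\<close>

lemma sdim_le:
  assumes "u \<in> states" "u' \<in> states" "reach u u'"
  shows "sdim u' \<le> sdim u"
proof -
  obtain c where c: "0 < c" "c < 1"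
    "\<And>u u' \<delta> \<delta>'. \<lbrakk>u \<in> states; u' \<in> states; reach u u'; 0 < \<delta>; \<delta> \<le> 1; 0 < \<delta>'; \<delta>' \<le> 1\<rbrakk> \<Longrightarrow>
       cov \<delta> (proj u) * cov \<delta>' (proj u') \<le> cov (c * \<delta> * \<delta>') (proj u)"
    using cov_supermultiplicative by blast
  have "cov \<delta> (proj u') \<le> cov (c * \<delta>) (proj u)" if "0 < \<delta>" "\<delta> \<le> 1" for \<delta>
  proof -
    have "1 * cov \<delta> (proj u') \<le> cov 1 (proj u) * cov \<delta> (proj u')"
      using cov_pos[of "proj u" 1] compact_proj[OF assms(1)] proj_nonempty[OF assms(1)]
      by (intro mult_right_mono) auto
    also have "\<dots> \<le> cov (c * 1 * \<delta>) (proj u)"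
      by (rule c(3)[OF assms]) (use that in auto)
    finally show ?thesis by simp
  qed
  then show ?thesis
    using has_box_dimension_mono[OF compact_proj proj_nonempty has_box_dimension_proj
        compact_proj proj_nonempty has_box_dimension_proj] assms(1,2) c(1,2) by (meson less_imp_le)
qed

lemma sdim_eq:
  assumes "u \<in> states" "u' \<in> states" "reach u u'"
  shows "sdim u' = sdim u"
  using sdim_le[OF assms] sdim_le[OF assms(2,1) reach_sym] assms by (auto simp: states_def)

lemma sdim_turn: "e \<in> arcs G \<Longrightarrow> sdim (head G e, turn i e) = sdim (tail G e, i)"
  using sdim_eq[OF _ _ reach_edge] by (auto simp: states_def)

lemma sdim_word: "v \<in> verts G \<Longrightarrow> word v w \<Longrightarrow> sdim (target v w, dir i w) = sdim (v, i)"
  using sdim_eq[OF _ _ reach_word] target_in_states by (auto simp: states_def)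

text \<open>
  If \<open>(v, False)\<close> reaches \<open>(v', j)\<close>, then its flip \<open>(v, True)\<close> reaches \<open>(v', \<not> j)\<close>.
\<close>

lemma sdim_sum_eq:
  assumes "v \<in> verts G" "v' \<in> verts G"
  shows "sdim (v', False) + sdim (v', True) = sdim (v, False) + sdim (v, True)"
proof -
  obtain j where j: "reach (v, False) (v', j)" using reach_some_direction[OF assms] .
  then have "reach (v, True) (v', \<not> j)" using reach_flip by fastforce
  then have "sdim (v', j) = sdim (v, False)" "sdim (v', \<not> j) = sdim (v, True)"
    using sdim_eq[OF _ _ j] sdim_eq[of "(v, True)" "(v', \<not> j)"] assms by (auto simp: states_def)
  then show ?thesis by (cases j) auto
qed

section \<open>The transfer operator\<close>

text \<open>
  The exponents are attached to the direction in which the word started: \<open>x + s\<close> belongs to that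
  direction and \<open>y - s\<close> to the other one, with \<open>s\<close> the dimension of the projection in that direction.
\<close>

definition wt :: "real \<Rightarrow> real \<Rightarrow> 'v \<times> bool \<Rightarrow> 'e \<Rightarrow> real" where
  "wt x y u e = ratio (snd u) e powr (x + sdim u) * ratio (\<not> snd u) e powr (y - sdim u)"

definition transfer :: "real \<Rightarrow> real \<Rightarrow> ('v \<times> bool \<Rightarrow> real) \<Rightarrow> 'v \<times> bool \<Rightarrow> real" where
  "transfer x y f u = (\<Sum>e\<in>out_arcs G (fst u). wt x y u e * f (head G e, turn (snd u) e))"

definition growth :: "real \<Rightarrow> real \<Rightarrow> nat \<Rightarrow> 'v \<times> bool \<Rightarrow> real" where
  "growth x y k = (transfer x y ^^ k) (\<lambda>_. 1)"

text \<open>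
  This is multiplicative in the word (\<open>weight_Cons\<close>, \<open>weight_snoc\<close>) because \<open>sdim\<close> is constant
  along edges.
\<close>

definition weight :: "real \<Rightarrow> real \<Rightarrow> 'v \<times> bool \<Rightarrow> 'e list \<Rightarrow> real" where
  "weight x y u w = len (snd u) w powr (x + sdim u) * len (\<not> snd u) w powr (y - sdim u)"

lemma growth_0 [simp]: "growth x y 0 = (\<lambda>_. 1)"
  and growth_Suc: "growth x y (Suc k) = transfer x y (growth x y k)"
  by (simp_all add: growth_def)

lemma wt_nonneg: "0 \<le> wt x y u e"
  unfolding wt_def by simp

lemma wt_pos: "e \<in> arcs G \<Longrightarrow> 0 < wt x y u e"
  unfolding wt_def using ratio_pos[of e] by (simp add: less_imp_neq[symmetric])

lemma next_in_states: "u \<in> states \<Longrightarrow> e \<in> out_arcs G (fst u) \<Longrightarrow> (head G e, turn (snd u) e) \<in> states"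
  by (auto simp: states_def)

lemma transfer_mono:
  assumes "u \<in> states" "\<And>u'. u' \<in> states \<Longrightarrow> f u' \<le> g u'"
  shows "transfer x y f u \<le> transfer x y g u"
  unfolding transfer_def using assms next_in_states by (intro sum_mono mult_left_mono wt_nonneg) auto

lemma growth_nonneg: "0 \<le> growth x y k u"
  by (induction k arbitrary: u) (auto simp: growth_Suc transfer_def intro!: sum_nonneg mult_nonneg_nonneg wt_nonneg)

lemma transfer_cmult: "transfer x y (\<lambda>u. c * f u) u = c * transfer x y f u"
  unfolding transfer_def sum_distrib_left by (intro sum.cong) auto

lemma transfer_sum: "transfer x y (\<lambda>u. \<Sum>k\<in>K. f k u) u = (\<Sum>k\<in>K. transfer x y (f k) u)"
  unfolding transfer_def by (subst sum.swap) (simp add: sum_distrib_left)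

lemma weight_Nil [simp]: "weight x y u [] = 1"
  by (simp add: weight_def)

lemma weight_nonneg: "0 \<le> weight x y u w"
  by (simp add: weight_def)

lemma weight_pos: "word (fst u) w \<Longrightarrow> 0 < weight x y u w"
  unfolding weight_def using len_pos[of "fst u" w] by (simp add: less_imp_neq[symmetric])

lemma weight_snoc:
  assumes "v \<in> verts G" "word v (w @ [e])"
  shows "weight x y (v, i) (w @ [e]) = weight x y (v, i) w * wt x y (target v w, dir i w) e"
proof -
  have w: "word v w" "e \<in> arcs G" using assms(2) by auto
  have s: "sdim (target v w, dir i w) = sdim (v, i)" by (rule sdim_word[OF assms(1) w(1)])
  have p: "0 \<le> len j w" "0 \<le> ratio j e" for j
    using len_pos[OF w(1), of j] ratio_pos[OF w(2), of j] by auto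
  show ?thesis
    unfolding weight_def wt_def s using p by (simp add: powr_mult mult_ac)
qed

lemma weight_Cons:
  assumes "e \<in> out_arcs G (fst u)" "word (head G e) w"
  shows "weight x y u (e # w) = wt x y u e * weight x y (head G e, turn (snd u) e) w"
proof -
  have e: "e \<in> arcs G" using assms by simp
  have s: "sdim (head G e, turn (snd u) e) = sdim u" using sdim_turn[OF e, of "snd u"] assms(1) by (cases u) auto
  have p: "0 \<le> len j w" "0 \<le> ratio j e" for j
    using len_pos[OF assms(2), of j] ratio_pos[OF e, of j] by auto
  show ?thesis
    unfolding weight_def wt_def by (simp add: s p powr_mult mult_ac)
qed

text \<open>
  The hypothesis makes \<open>weight / r ^ length * h\<close> increase in total when a word is replaced by
  its one-letter extensions, so \<open>le_sum_cut\<close> applies.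
\<close>

lemma sum_cut_lower:
  fixes h :: "'v \<times> bool \<Rightarrow> real"
  assumes v: "v \<in> verts G" and cut: "contracting v \<phi>" "0 < \<theta>" "\<theta> < 1" and r: "0 < r"
    and h: "\<And>u. u \<in> states \<Longrightarrow> reach (v, i) u \<Longrightarrow> r * h u \<le> transfer x y h u"
  shows "h (v, i) \<le> (\<Sum>w\<in>cut \<phi> v \<theta>. weight x y (v, i) w / r ^ length w * h (target v w, dir i w))"
proof -
  define F where "F w = weight x y (v, i) w / r ^ length w * h (target v w, dir i w)" for w
  have "F [] \<le> (\<Sum>w\<in>cut \<phi> v \<theta>. F w)"
  proof (rule le_sum_cut[OF cut])
    fix w assume w: "word v w"
    let ?u = "(target v w, dir i w)"
    have u: "?u \<in> states" "reach (v, i) ?u" using target_in_states[OF v w] reach_word[OF w] by auto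
    have "F w = weight x y (v, i) w / r ^ Suc (length w) * (r * h ?u)"
      using r by (simp add: F_def field_simps)
    also have "\<dots> \<le> weight x y (v, i) w / r ^ Suc (length w) * transfer x y h ?u"
      using h[OF u] r weight_nonneg by (intro mult_left_mono divide_nonneg_nonneg) auto
    also have "\<dots> = (\<Sum>e\<in>out_arcs G (target v w). F (w @ [e]))"
      unfolding transfer_def sum_distrib_left
    proof (rule sum.cong)
      fix e assume "e \<in> out_arcs G (target v w)"
      then have "word v (w @ [e])" using w by simp
      then show "weight x y (v, i) w / r ^ Suc (length w) * (wt x y ?u e * h (head G e, turn (snd ?u) e)) = F (w @ [e])"
        unfolding F_def weight_snoc[OF v \<open>word v (w @ [e])\<close>] by simp
    qed simp
    finally show "F w \<le> (\<Sum>e\<in>out_arcs G (target v w). F (w @ [e]))" .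
  qed
  then show ?thesis by (simp add: F_def)
qed

lemma sum_cut_upper:
  fixes h :: "'v \<times> bool \<Rightarrow> real"
  assumes v: "v \<in> verts G" and cut: "contracting v \<phi>" "0 < \<theta>" "\<theta> < 1"
    and h: "\<And>u. u \<in> states \<Longrightarrow> transfer x y h u \<le> h u"
  shows "(\<Sum>w\<in>cut \<phi> v \<theta>. weight x y (v, i) w * h (target v w, dir i w)) \<le> h (v, i)"
proof -
  have "- h (v, i) \<le> (\<Sum>w\<in>cut \<phi> v \<theta>. weight x y (v, i) w / 1 ^ length w * (- h (target v w, dir i w)))"
  proof (rule sum_cut_lower[OF v cut, where h = "\<lambda>u. - h u"])
    fix u assume "u \<in> states"
    then show "1 * (- h u) \<le> transfer x y (\<lambda>u. - h u) u"
      using h[of u] transfer_cmult[of x y "-1" h u] by simp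
  qed simp
  then show ?thesis by (simp add: sum_negf)
qed

text \<open>
  The partial sum \<open>h\<close> of the iterates satisfies \<open>transfer h = h - 1 + growth n\<close>, and \<open>growth n\<close> is below
  1 for large \<open>n\<close>.
\<close>

lemma superinvariant_function:
  assumes "0 \<le> q" "q < 1" and C: "\<And>k u. u \<in> states \<Longrightarrow> growth x y k u \<le> C * q ^ k"
  shows "\<exists>h. \<forall>u\<in>states. 1 \<le> h u \<and> transfer x y h u \<le> h u"
proof -
  have "(\<lambda>k. C * q ^ k) \<longlonglongrightarrow> C * 0" using assms by (intro tendsto_mult tendsto_const LIMSEQ_power_zero) simp
  then have "eventually (\<lambda>k. C * q ^ k < 1) sequentially" by (rule order_tendstoD(2)) simp
  then obtain n0 where n0: "\<And>k. n0 \<le> k \<Longrightarrow> C * q ^ k < 1" unfolding eventually_sequentially by blast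
  define n where "n = Suc n0"
  define h where "h u = (\<Sum>k<n. growth x y k u)" for u
  have "1 \<le> h u \<and> transfer x y h u \<le> h u" if u: "u \<in> states" for u
  proof
    have "growth x y 0 u \<le> h u"
      unfolding h_def by (rule member_le_sum) (auto simp: n_def growth_nonneg)
    then show "1 \<le> h u" by simp
    have "transfer x y h u = (\<Sum>k<n. growth x y (Suc k) u)"
      unfolding h_def transfer_sum growth_Suc ..
    also have "\<dots> = h u + growth x y n u - 1"
      using sum.lessThan_Suc_shift[of "\<lambda>k. growth x y k u" n] by (simp add: h_def)
    also have "\<dots> \<le> h u" using C[OF u, of n] n0[of n] by (simp add: n_def)
    finally show "transfer x y h u \<le> h u" .
  qed
  then show ?thesis by blast
qed

lemma growth_le_word:
  assumes "u \<in> states" "word (fst u) w"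
  shows "weight x y u w * growth x y n (target (fst u) w, dir (snd u) w) \<le> growth x y (n + length w) u"
  using assms
proof (induction w arbitrary: u)
  case (Cons e w)
  let ?u = "(head G e, turn (snd u) e)"
  have e: "e \<in> out_arcs G (fst u)" "word (head G e) w" using Cons.prems by auto
  have "weight x y u (e # w) * growth x y n (target (fst u) (e # w), dir (snd u) (e # w))
      = wt x y u e * (weight x y ?u w * growth x y n (target (fst ?u) w, dir (snd ?u) w))"
    using weight_Cons[OF e] by simp
  also have "\<dots> \<le> wt x y u e * growth x y (n + length w) ?u"
    using Cons.IH[of ?u] next_in_states[OF Cons.prems(1) e(1)] e by (intro mult_left_mono wt_nonneg) auto
  also have "\<dots> \<le> growth x y (n + length (e # w)) u"
    unfolding length_Cons add_Suc_right growth_Suc transfer_def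
    using e(1) finite_out_arcs by (intro member_le_sum[where f = "\<lambda>e. wt x y u e * growth x y (n + length w) (head G e, turn (snd u) e)"])
      (auto intro!: mult_nonneg_nonneg wt_nonneg growth_nonneg)
  finally show ?case .
qed simp

lemma growth_add_le:
  assumes "0 \<le> B" "\<And>u. u \<in> states \<Longrightarrow> growth x y 1 u \<le> B" "u \<in> states"
  shows "growth x y (n + k) u \<le> B ^ k * growth x y n u"
  using assms(3)
proof (induction n arbitrary: u)
  case 0
  have "growth x y k u \<le> B ^ k" using 0
  proof (induction k arbitrary: u)
    case (Suc k)
    have "growth x y (Suc k) u \<le> transfer x y (\<lambda>u. B ^ k * 1) u"
      unfolding growth_Suc using Suc by (intro transfer_mono) auto
    also have "\<dots> = B ^ k * growth x y 1 u"
      using transfer_cmult[of x y "B ^ k" "\<lambda>_. 1" u] by (simp add: growth_Suc)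
    also have "\<dots> \<le> B ^ k * B" using assms(1,2) Suc.prems by (intro mult_left_mono) auto
    finally show ?case by (simp add: mult.commute)
  qed simp
  then show ?case by simp
next
  case (Suc n)
  have "growth x y (Suc n + k) u \<le> transfer x y (\<lambda>u. B ^ k * growth x y n u) u"
    using Suc by (auto simp: growth_Suc intro!: transfer_mono)
  then show ?case by (simp add: transfer_cmult growth_Suc)
qed

text \<open>
  If \<open>w\<close> leads from \<open>u\<close> to \<open>u'\<close>, then \<open>growth (n + length w) u\<close> is at least a positive multiple of
  \<open>growth n u'\<close>, and it is at most \<open>B ^ length w * growth n u\<close> with a uniform bound \<open>B\<close>.
\<close>

lemma growth_comparable:
  "\<exists>c>0. \<forall>u u' n. u \<in> states \<and> u' \<in> states \<and> reach u u' \<longrightarrow> c * growth x y n u' \<le> growth x y n u"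
proof -
  \<comment> \<open>a bound for one application of the operator to the constant 1\<close>
  define B where "B = 1 + (\<Sum>u\<in>states. growth x y 1 u)"
  have B: "1 \<le> B" "growth x y 1 u \<le> B" if "u \<in> states" for u
  proof -
    have "growth x y 1 u \<le> (\<Sum>u\<in>states. growth x y 1 u)"
      using that finite_states growth_nonneg by (intro member_le_sum) auto
    then show "growth x y 1 u \<le> B" by (simp add: B_def)
    show "1 \<le> B" unfolding B_def using growth_nonneg by (simp add: sum_nonneg)
  qed
  have "0 < weight x y u w / B ^ length w" if "u \<in> states" "word (fst u) w" for u w
    using B(1)[OF that(1)] weight_pos[OF that(2)] by simp
  then obtain c where c: "0 < c" "\<And>u u'. \<lbrakk>u \<in> states; u' \<in> states; reach u u'\<rbrakk> \<Longrightarrow> \<exists>w. word (fst u) w \<and>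
      target (fst u) w = fst u' \<and> dir (snd u) w = snd u' \<and> c \<le> weight x y u w / B ^ length w"
    using return_words[of "\<lambda>u w. weight x y u w / B ^ length w"] by blast
  have "c * growth x y n u' \<le> growth x y n u" if u: "u \<in> states" "u' \<in> states" "reach u u'" for u u' n
  proof -
    obtain w where w: "word (fst u) w" "target (fst u) w = fst u'" "dir (snd u) w = snd u'"
      "c \<le> weight x y u w / B ^ length w"
      using c(2)[OF u] by blast
    have Bp: "0 < B ^ length w" using B(1)[OF u(1)] by simp
    have "c * growth x y n u' \<le> weight x y u w / B ^ length w * growth x y n u'"
      using w(4) growth_nonneg by (intro mult_right_mono) auto
    also have "\<dots> \<le> growth x y (n + length w) u / B ^ length w"
      using growth_le_word[OF u(1) w(1), of x y n] w(2,3) Bp by (simp add: divide_right_mono)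
    also have "\<dots> \<le> growth x y n u"
      using growth_add_le[OF _ B(2) u(1), of n "length w"] B(1)[OF u(1)] Bp
      by (simp add: pos_divide_le_eq mult.commute)
    finally show ?thesis .
  qed
  then show ?thesis using c(1) by blast
qed

text \<open>
  Dual to \<open>superinvariant_function\<close>: \<open>h\<close> is the partial sum of the iterates discounted by powers
  of \<open>r\<close>, and \<open>transfer h = r * (h - 1 + growth n / r ^ n)\<close>. The choice \<open>r = sqrt \<rho>\<close> leaves room to
  carry the growth, which is known for one state \<open>u0\<close> only, to all states of its class. Another class may
  grow more slowly, which is why the conclusion speaks only of states reached from \<open>u0\<close>.
\<close>

lemma subinvariant_function:
  assumes "1 < \<rho>" and \<rho>: "\<And>k. \<exists>u\<in>states. \<rho> ^ k \<le> growth x y k u"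
  shows "\<exists>r>1. \<exists>u0\<in>states. \<exists>h H. \<forall>u\<in>states. reach u0 u \<longrightarrow>
           1 \<le> h u \<and> h u \<le> H \<and> r * h u \<le> transfer x y h u"
proof -
  obtain c where c: "0 < c"
    "\<And>u u' n. u \<in> states \<Longrightarrow> u' \<in> states \<Longrightarrow> reach u u' \<Longrightarrow> c * growth x y n u' \<le> growth x y n u"
    using growth_comparable by blast
  define r where "r = sqrt \<rho>"
  have r: "1 < r" "r * r = \<rho>" using assms(1) by (auto simp: r_def)
  obtain n0 where "1 / c < r ^ n0" using real_arch_pow[OF r(1)] by blast
  then obtain n where n: "1 / c < r ^ n" "0 < n"
    using r(1) by (metis less_le_trans power_increasing less_imp_le zero_less_Suc le_SucI order_refl)
  obtain u0 where u0: "u0 \<in> states" "\<rho> ^ n \<le> growth x y n u0" using \<rho> by blast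
  have big: "r ^ n \<le> growth x y n u" if "u \<in> states" "reach u0 u" for u
  proof -
    have "reach u u0" using reach_sym[OF _ _ that(2)] u0(1) that(1) by (auto simp: states_def)
    then have "c * growth x y n u0 \<le> growth x y n u" using c(2) that(1) u0(1) by blast
    moreover have "c * \<rho> ^ n \<le> c * growth x y n u0" using u0(2) c(1) by simp
    moreover have "r ^ n * 1 \<le> r ^ n * (c * r ^ n)"
      using n c(1) r(1) by (intro mult_left_mono) (auto simp: field_simps)
    moreover have "r ^ n * (c * r ^ n) = c * \<rho> ^ n" by (simp add: r(2)[symmetric] power_mult_distrib)
    ultimately show ?thesis by linarith
  qed
  define h where "h u = (\<Sum>k<n. growth x y k u / r ^ k)" for u
  define H where "H = (\<Sum>u\<in>states. h u)"
  have h0: "0 \<le> h u" for u unfolding h_def using r(1) growth_nonneg by (intro sum_nonneg divide_nonneg_nonneg) auto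
  have "1 \<le> h u \<and> h u \<le> H \<and> r * h u \<le> transfer x y h u" if u: "u \<in> states" "reach u0 u" for u
  proof (intro conjI)
    have "growth x y 0 u / r ^ 0 \<le> h u"
      unfolding h_def using n(2) r(1) growth_nonneg
      by (intro member_le_sum[where f = "\<lambda>k. growth x y k u / r ^ k"]) auto
    then show "1 \<le> h u" by simp
    show "h u \<le> H" unfolding H_def using u finite_states h0 by (intro member_le_sum) auto
    have "transfer x y h u = (\<Sum>k<n. transfer x y (\<lambda>u. (1 / r ^ k) * growth x y k u) u)"
      unfolding h_def by (simp add: transfer_sum)
    also have "\<dots> = (\<Sum>k<n. r * (growth x y (Suc k) u / r ^ Suc k))"
      unfolding transfer_cmult growth_Suc using r(1) by (intro sum.cong) auto
    also have "\<dots> = r * (\<Sum>k<n. growth x y (Suc k) u / r ^ Suc k)"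
      by (simp only: sum_distrib_left)
    also have "(\<Sum>k<n. growth x y (Suc k) u / r ^ Suc k) = h u + growth x y n u / r ^ n - 1"
      using sum.lessThan_Suc_shift[of "\<lambda>k. growth x y k u / r ^ k" n] by (simp add: h_def)
    finally have "transfer x y h u = r * (h u + growth x y n u / r ^ n - 1)" .
    moreover have "1 \<le> growth x y n u / r ^ n" using big[OF u] r(1) by simp
    ultimately show "r * h u \<le> transfer x y h u" using r(1) by simp
  qed
  then show ?thesis using r(1) u0(1) by blast
qed

lemma weight_shift_bounds:
  assumes "0 \<le> h" "e \<in> arcs G"
  shows "rmin powr h * wt x y u e \<le> wt x (y + h) u e" "wt x (y + h) u e \<le> rmax powr h * wt x y u e"
proof -
  let ?b = "ratio (\<not> snd u) e"
  have b: "0 < ?b" using ratio_pos assms by blast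
  have eq: "wt x (y + h) u e = ?b powr h * wt x y u e"
    unfolding wt_def using b by (simp add: powr_add[symmetric] algebra_simps)
  have "rmin powr h \<le> ?b powr h" "?b powr h \<le> rmax powr h"
    using assms rmin_pos b rmin_le_ratio ratio_le_rmax by (auto intro!: powr_mono2)
  then show "rmin powr h * wt x y u e \<le> wt x (y + h) u e" "wt x (y + h) u e \<le> rmax powr h * wt x y u e"
    unfolding eq by (auto intro!: mult_right_mono wt_nonneg)
qed

lemma growth_shift_bounds:
  assumes "0 \<le> h" "u \<in> states"
  shows "(rmin powr h) ^ k * growth x y k u \<le> growth x (y + h) k u"
    and "growth x (y + h) k u \<le> (rmax powr h) ^ k * growth x y k u"
proof -
  have "(rmin powr h) ^ k * growth x y k u \<le> growth x (y + h) k u \<and>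
        growth x (y + h) k u \<le> (rmax powr h) ^ k * growth x y k u"
    using assms(2)
  proof (induction k arbitrary: u)
    case (Suc k)
    let ?a = "rmin powr h" and ?b = "rmax powr h"
    have "?a ^ Suc k * growth x y (Suc k) u
        = (\<Sum>e\<in>out_arcs G (fst u). (?a * wt x y u e) * (?a ^ k * growth x y k (head G e, turn (snd u) e)))"
      unfolding growth_Suc transfer_def sum_distrib_left by (intro sum.cong) auto
    also have "\<dots> \<le> growth x (y + h) (Suc k) u"
      unfolding growth_Suc transfer_def
      using Suc next_in_states weight_shift_bounds(1)[OF assms(1)]
      by (intro sum_mono mult_mono) (auto intro!: wt_nonneg mult_nonneg_nonneg growth_nonneg)
    finally have 1: "?a ^ Suc k * growth x y (Suc k) u \<le> growth x (y + h) (Suc k) u" .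
    have "growth x (y + h) (Suc k) u
        \<le> (\<Sum>e\<in>out_arcs G (fst u). (?b * wt x y u e) * (?b ^ k * growth x y k (head G e, turn (snd u) e)))"
      unfolding growth_Suc transfer_def
      using Suc next_in_states weight_shift_bounds(2)[OF assms(1)]
      by (intro sum_mono mult_mono) (auto intro!: wt_nonneg mult_nonneg_nonneg growth_nonneg)
    also have "\<dots> = ?b ^ Suc k * growth x y (Suc k) u"
      unfolding growth_Suc transfer_def sum_distrib_left by (intro sum.cong) auto
    finally show ?case using 1 by blast
  qed simp
  then show "(rmin powr h) ^ k * growth x y k u \<le> growth x (y + h) k u"
    "growth x (y + h) k u \<le> (rmax powr h) ^ k * growth x y k u" by auto
qed

end

section \<open>Overlap of stopped boxes\<close>

text \<open>
  The interval \<open>\<sigma> * [0,1] + c\<close> contains a subinterval of length \<open>L\<close> around \<open>\<sigma> * t0 + c\<close>. The point of the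
  grid \<open>(L/3) \<int>\<close> just below its midpoint \<open>y\<close> lies well inside.
\<close>

lemma grid_point_in_interval:
  fixes \<sigma> c t0 L :: real
  assumes L: "0 < L" "L \<le> \<bar>\<sigma>\<bar>" and t0: "0 \<le> t0" "t0 \<le> 1"
  shows "\<exists>k::int. \<exists>t. 0 < t \<and> t < 1 \<and> of_int k * (L/3) = \<sigma> * t + c \<and>
           \<bar>of_int k * (L/3) - (\<sigma> * t0 + c)\<bar> \<le> L"
proof -
  define l where "l = L / \<bar>\<sigma>\<bar>"
  have \<sigma>: "0 < \<bar>\<sigma>\<bar>" using L by linarith
  have l: "0 < l" "l \<le> 1" using L \<sigma> by (auto simp: l_def)
  define m where "m = min t0 (1 - l) + l/2"
  have "l/2 \<le> m \<and> m \<le> 1 - l/2 \<and> \<bar>m - t0\<bar> \<le> l/2"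
  proof (cases "t0 \<le> 1 - l")
    case True
    then show ?thesis using l t0 by (simp add: m_def)
  next
    case False
    then have "m = 1 - l/2" by (simp add: m_def)
    then show ?thesis using False l t0 by (intro conjI abs_leI) linarith+
  qed
  then have m: "l/2 \<le> m" "m \<le> 1 - l/2" "\<bar>m - t0\<bar> \<le> l/2" by auto
  define y where "y = \<sigma> * m + c"
  define k where "k = \<lfloor>y / (L/3)\<rfloor>"
  have "of_int k \<le> y / (L/3)" "y / (L/3) < of_int k + 1" unfolding k_def by linarith+
  then have "of_int k * (L/3) \<le> y" "y < (of_int k + 1) * (L/3)"
    using L(1) by (simp_all add: field_simps)
  then have k: "\<bar>of_int k * (L/3) - y\<bar> \<le> L/3" by (simp add: abs_le_iff algebra_simps)
  define t where "t = (of_int k * (L/3) - c) / \<sigma>"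
  have t: "of_int k * (L/3) = \<sigma> * t + c" using \<sigma> by (simp add: t_def)
  have "\<bar>\<sigma>\<bar> * \<bar>t - m\<bar> = \<bar>of_int k * (L/3) - y\<bar>"
    unfolding t y_def by (simp flip: abs_mult add: algebra_simps)
  then have "\<bar>\<sigma>\<bar> * \<bar>t - m\<bar> \<le> L/3" using k by simp
  then have "\<bar>t - m\<bar> * \<bar>\<sigma>\<bar> \<le> L/3" by (simp only: mult.commute)
  then have "\<bar>t - m\<bar> \<le> (L/3) / \<bar>\<sigma>\<bar>" by (rule iffD2[OF pos_le_divide_eq[OF \<sigma>]])
  also have "\<dots> < l/2" using L \<sigma> by (simp add: l_def field_simps)
  finally have tm: "\<bar>t - m\<bar> < l/2" .
  have "\<bar>y - (\<sigma> * t0 + c)\<bar> = \<bar>\<sigma>\<bar> * \<bar>m - t0\<bar>"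
    unfolding y_def by (simp flip: abs_mult add: algebra_simps)
  also have "\<dots> \<le> \<bar>\<sigma>\<bar> * (l/2)" using m(3) by (intro mult_left_mono) auto
  also have "\<dots> = L/2" using \<sigma> by (simp add: l_def)
  finally have "\<bar>of_int k * (L/3) - (\<sigma> * t0 + c)\<bar> \<le> L" using k L(1) by linarith
  moreover have "0 < t" "t < 1" using tm m by linarith+
  ultimately show ?thesis using t by blast
qed

lemma finite_card_grid_points_near:
  fixes z g R :: real
  assumes "0 < g" "0 \<le> R"
  shows "finite {k::int. \<bar>of_int k * g - z\<bar> \<le> R}"
    and "real (card {k::int. \<bar>of_int k * g - z\<bar> \<le> R}) \<le> 2 * R / g + 1"
proof -
  have sub: "{k::int. \<bar>of_int k * g - z\<bar> \<le> R} \<subseteq> {\<lceil>(z - R) / g\<rceil>..\<lfloor>(z + R) / g\<rfloor>}"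
    using assms by (auto simp: abs_le_iff ceiling_le_iff le_floor_iff field_simps)
  then show "finite {k::int. \<bar>of_int k * g - z\<bar> \<le> R}" by (rule finite_subset) simp
  have "real (card {k::int. \<bar>of_int k * g - z\<bar> \<le> R}) \<le> real (nat (\<lfloor>(z + R) / g\<rfloor> - \<lceil>(z - R) / g\<rceil> + 1))"
    using card_mono[OF _ sub] by simp
  also have "\<dots> \<le> max 0 ((z + R) / g - (z - R) / g + 1)"
    by linarith
  also have "(z + R) / g - (z - R) / g = 2 * R / g" by (simp add: diff_divide_distrib[symmetric])
  finally show "real (card {k::int. \<bar>of_int k * g - z\<bar> \<le> R}) \<le> 2 * R / g + 1"
    using assms by simp
qed

context carpet
begin

lemma mem_wmap_open_square:
  assumes \<sigma>: "\<And>i \<xi>. coord i (wmap w \<xi>) = \<sigma> i * coord (dir i w) \<xi> + c i"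
    and t: "\<And>i. 0 < t i \<and> t i < 1 \<and> coord i \<zeta> = \<sigma> i * t i + c i"
  shows "\<zeta> \<in> wmap w ` open_unit_square"
proof -
  define \<xi> where "\<xi> = (if dir False w then (t True, t False) else (t False, t True))"
  have d: "dir True w = (\<not> dir False w)" using dir_Not[of False w] by simp
  have co: "coord (dir i w) \<xi> = t i" for i
    by (cases i) (auto simp: \<xi>_def coord_def d)
  have "coord i (wmap w \<xi>) = coord i \<zeta>" for i using \<sigma> t co by simp
  from this[of False] this[of True] have "wmap w \<xi> = \<zeta>" by (simp add: coord_def prod_eq_iff)
  moreover have "\<xi> \<in> open_unit_square" using t unfolding \<xi>_def open_unit_square_def by auto
  ultimately show ?thesis by blast
qed

definition side :: "'e list \<Rightarrow> real" where
  "side w = min (len False w) (len True w)"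

text \<open>
  The direction of the longer side of the box; a square counts as long in the direction \<open>False\<close>.
\<close>

definition long :: "'e list \<Rightarrow> bool" where
  "long w \<longleftrightarrow> len False w < len True w"

lemma len_long: "len (\<not> long w) w = side w" "side w \<le> len i w" "len i w \<le> len (long w) w"
proof -
  show "len (\<not> long w) w = side w" by (cases "long w") (simp_all add: long_def side_def)
  show "side w \<le> len i w" by (cases i) (simp_all add: side_def)
  show "len i w \<le> len (long w) w" by (cases i; cases "long w") (simp_all add: long_def)
qed

lemma contracting_side: "contracting v side"
  using contracting_min[OF contracting_len contracting_len] unfolding side_def .

text \<open>
  A box that meets \<open>U\<close> has sides of length at least \<open>L = rmin * \<delta>/2\<close>, so its interior contains a point of
  the grid \<open>(L/3) \<int>\<^sup>2\<close> near \<open>U\<close>. The interiors are disjoint by ROSC, so the boxes have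
  distinct grid points, and only boundedly many grid points are near \<open>U\<close>. A box may be much longer
  than \<open>\<delta>\<close>; the grid point is chosen close to a point of \<open>U\<close> in it.
\<close>

lemma finitely_many_boxes_meet:
  "\<exists>K. \<forall>v\<in>verts G. \<forall>\<delta>. \<forall>U :: (real \<times> real) set. 0 < \<delta> \<and> \<delta> \<le> 1 \<and> (\<forall>x\<in>U. \<forall>y\<in>U. dist x y \<le> \<delta>) \<longrightarrow>
      card {w \<in> cut side v (\<delta>/2). U \<inter> cylinder v w \<noteq> {}} \<le> K"
proof (intro exI ballI allI impI)
  fix v \<delta> and U :: "(real \<times> real) set"
  assume v: "v \<in> verts G" and "0 < \<delta> \<and> \<delta> \<le> 1 \<and> (\<forall>x\<in>U. \<forall>y\<in>U. dist x y \<le> \<delta>)"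
  then have \<delta>: "0 < \<delta>" "\<delta> \<le> 1" and U: "\<And>x y. x \<in> U \<Longrightarrow> y \<in> U \<Longrightarrow> dist x y \<le> \<delta>" by auto
  define I where "I = {w \<in> cut side v (\<delta>/2). U \<inter> cylinder v w \<noteq> {}}"
  define L where "L = rmin * (\<delta>/2)"
  have L: "0 < L" using rmin_pos \<delta> by (simp add: L_def)
  define P where "P k w \<longleftrightarrow> (of_int (fst k) * (L/3), of_int (snd k) * (L/3)) \<in> wmap w ` open_unit_square"
    for k :: "int \<times> int" and w
  show "card {w \<in> cut side v (\<delta>/2). U \<inter> cylinder v w \<noteq> {}} \<le> nat \<lceil>(7 + 12 / rmin) ^ 2\<rceil>"
  proof (cases "I = {}")
    case True
    then show ?thesis unfolding I_def[symmetric] by simp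
  next
    case False
    then obtain z where z: "z \<in> U" unfolding I_def by blast
    define N where "N i = {k::int. \<bar>of_int k * (L/3) - coord i z\<bar> \<le> L + \<delta>}" for i
    have N: "finite (N i)" "real (card (N i)) \<le> 7 + 12 / rmin" for i
    proof -
      show "finite (N i)" unfolding N_def using L \<delta> by (intro finite_card_grid_points_near) auto
      have "real (card (N i)) \<le> 2 * (L + \<delta>) / (L/3) + 1"
        unfolding N_def using L \<delta> by (intro finite_card_grid_points_near) auto
      also have "\<dots> = 7 + 12 / rmin" using L rmin_pos \<delta> by (simp add: L_def field_simps)
      finally show "real (card (N i)) \<le> 7 + 12 / rmin" .
    qed
    have "\<exists>k\<in>N False \<times> N True. P k w" if w: "w \<in> I" for w
    proof -
      have wc: "w \<in> cut side v (\<delta>/2)" using w by (simp add: I_def)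
      note wb = cut_bounds[OF contracting_side wc]
      obtain \<xi> where \<xi>: "\<xi> \<in> U" "\<xi> \<in> cylinder v w" using w unfolding I_def by blast
      then obtain a where a: "a \<in> unit_square" "\<xi> = wmap w a"
        using X_subset_unit_square[OF target_in_verts[OF v wb(1)]] by blast
      have "\<forall>i. \<exists>\<sigma> c. \<bar>\<sigma>\<bar> = len i w \<and> (\<forall>\<xi>. coord i (wmap w \<xi>) = \<sigma> * coord (dir i w) \<xi> + c)"
        using coord_wmap by blast
      then obtain \<sigma> c where \<sigma>: "\<And>i. \<bar>\<sigma> i\<bar> = len i w"
        "\<And>i \<xi>. coord i (wmap w \<xi>) = \<sigma> i * coord (dir i w) \<xi> + c i" by metis
      have "\<forall>i. \<exists>k::int. \<exists>t. 0 < t \<and> t < 1 \<and> of_int k * (L/3) = \<sigma> i * t + c i \<and>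
           \<bar>of_int k * (L/3) - (\<sigma> i * coord (dir i w) a + c i)\<bar> \<le> L"
      proof
        fix i
        have "L \<le> \<bar>\<sigma> i\<bar>" using wb(3) len_long(2)[of w i] \<sigma>(1)[of i] by (simp add: L_def)
        then show "\<exists>k::int. \<exists>t. 0 < t \<and> t < 1 \<and> of_int k * (L/3) = \<sigma> i * t + c i \<and>
           \<bar>of_int k * (L/3) - (\<sigma> i * coord (dir i w) a + c i)\<bar> \<le> L"
          using grid_point_in_interval[OF L] a(1) unfolding mem_unit_square by blast
      qed
      then obtain k :: "bool \<Rightarrow> int" and t where k: "\<And>i. 0 < t i \<and> t i < 1 \<and> of_int (k i) * (L/3) = \<sigma> i * t i + c i"
        "\<And>i. \<bar>of_int (k i) * (L/3) - (\<sigma> i * coord (dir i w) a + c i)\<bar> \<le> L" by metis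
      have "k i \<in> N i" for i
      proof -
        have "dist (coord i \<xi>) (coord i z) \<le> dist \<xi> z"
          unfolding coord_def by (simp add: dist_fst_le dist_snd_le)
        also have "\<dots> \<le> \<delta>" using U \<xi>(1) z by blast
        finally have "\<bar>coord i \<xi> - coord i z\<bar> \<le> \<delta>" by (simp add: dist_real_def)
        moreover have "\<bar>of_int (k i) * (L/3) - coord i \<xi>\<bar> \<le> L" using k(2)[of i] \<sigma>(2) a(2) by simp
        ultimately have "\<bar>of_int (k i) * (L/3) - coord i z\<bar> \<le> L + \<delta>" by linarith
        then show ?thesis by (simp add: N_def)
      qed
      moreover have "P (k False, k True) w"
        unfolding P_def
        by (rule mem_wmap_open_square[OF \<sigma>(2), where t = t]) (use k(1) in \<open>auto simp: coord_def\<close>)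
      ultimately show ?thesis by blast
    qed
    then obtain f where f: "\<And>w. w \<in> I \<Longrightarrow> f w \<in> N False \<times> N True \<and> P (f w) w" by metis
    have "inj_on f I"
    proof (rule inj_onI, rule ccontr)
      fix w w' assume *: "w \<in> I" "w' \<in> I" "f w = f w'" "w \<noteq> w'"
      then have "wmap w ` open_unit_square \<inter> wmap w' ` open_unit_square = {}"
        using cut_disjoint[OF v contracting_side] unfolding I_def by blast
      moreover have "P (f w) w" "P (f w) w'" using f *(1-3) by metis+
      ultimately show False unfolding P_def by blast
    qed
    then have "card I \<le> card (N False \<times> N True)"
      using f N(1) by (intro card_inj_on_le image_subsetI finite_SigmaI) blast+
    then have "real (card I) \<le> real (card (N False)) * real (card (N True))"
      by (simp add: card_cartesian_product flip: of_nat_mult)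
    also have "\<dots> \<le> (7 + 12 / rmin) * (7 + 12 / rmin)"
      using N(2) rmin_pos by (intro mult_mono) auto
    finally show ?thesis unfolding I_def[symmetric] by (simp add: power2_eq_square le_nat_iff le_ceiling_iff)
  qed
qed

section \<open>Covering the carpets by stopped boxes\<close>

lemma uniform_projection_bounds:
  assumes "0 < \<epsilon>" "0 < K"
  shows "\<exists>C>0. \<forall>u\<in>states. \<forall>\<delta>. 0 < \<delta> \<and> \<delta> \<le> K \<longrightarrow>
      real (cov \<delta> (proj u)) \<le> C * \<delta> powr (- (sdim u + \<epsilon>)) \<and>
      \<delta> powr (- (sdim u - \<epsilon>)) \<le> C * real (cov \<delta> (proj u))"
proof -
  have "\<forall>u\<in>states. \<exists>C>0. \<forall>\<delta>. 0 < \<delta> \<and> \<delta> \<le> K \<longrightarrow>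
      real (cov \<delta> (proj u)) \<le> C * \<delta> powr (- (sdim u + \<epsilon>)) \<and>
      \<delta> powr (- (sdim u - \<epsilon>)) \<le> C * real (cov \<delta> (proj u))"
    using has_box_dimensionD[OF compact_proj proj_nonempty has_box_dimension_proj assms] by blast
  then obtain c where c: "\<And>u. u \<in> states \<Longrightarrow> 0 < c u"
    "\<And>u \<delta>. u \<in> states \<Longrightarrow> 0 < \<delta> \<Longrightarrow> \<delta> \<le> K \<Longrightarrow> real (cov \<delta> (proj u)) \<le> c u * \<delta> powr (- (sdim u + \<epsilon>))"
    "\<And>u \<delta>. u \<in> states \<Longrightarrow> 0 < \<delta> \<Longrightarrow> \<delta> \<le> K \<Longrightarrow> \<delta> powr (- (sdim u - \<epsilon>)) \<le> c u * real (cov \<delta> (proj u))"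
    by metis
  define C where "C = 1 + (\<Sum>u\<in>states. c u)"
  have cC: "c u \<le> C" if "u \<in> states" for u
  proof -
    have "c u \<le> (\<Sum>u\<in>states. c u)" using that c(1) finite_states by (intro member_le_sum) (auto intro: less_imp_le)
    then show ?thesis by (simp add: C_def)
  qed
  have "0 < C" unfolding C_def using c(1) by (intro add_pos_nonneg sum_nonneg) (auto intro: less_imp_le)
  moreover have "real (cov \<delta> (proj u)) \<le> C * \<delta> powr (- (sdim u + \<epsilon>))"
    "\<delta> powr (- (sdim u - \<epsilon>)) \<le> C * real (cov \<delta> (proj u))"
    if "u \<in> states" "0 < \<delta>" "\<delta> \<le> K" for u \<delta>
  proof -
    have "c u * \<delta> powr (- (sdim u + \<epsilon>)) \<le> C * \<delta> powr (- (sdim u + \<epsilon>))"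
      "c u * real (cov \<delta> (proj u)) \<le> C * real (cov \<delta> (proj u))"
      using cC[OF that(1)] by (auto intro!: mult_right_mono)
    then show "real (cov \<delta> (proj u)) \<le> C * \<delta> powr (- (sdim u + \<epsilon>))"
      "\<delta> powr (- (sdim u - \<epsilon>)) \<le> C * real (cov \<delta> (proj u))"
      using c(2,3)[OF that] by linarith+
  qed
  ultimately show ?thesis by blast
qed

lemma compact_cylinder: "v \<in> verts G \<Longrightarrow> word v w \<Longrightarrow> compact (cylinder v w)"
proof (rule compact_continuous_image[OF _ X_compact])
  show "continuous_on S (wmap w)" for S
  proof (induction w arbitrary: S)
    case (Cons e w)
    have "continuous_on S (\<lambda>x. apply_box (\<Psi> e) (wmap w x))"
      by (rule continuous_on_compose2[OF continuous_on_apply_box[of UNIV] Cons.IH]) simp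
    then show ?case by (simp add: comp_def)
  qed simp
qed (rule target_in_verts)

lemma cov_le_coords:
  fixes T :: "(real \<times> real) set"
  assumes "compact T" "0 < \<theta>"
  shows "cov (2 * \<theta>) T \<le> cov \<theta> (coord i ` T) * cov \<theta> (coord (\<not> i) ` T)"
proof -
  have "coord False = fst" "coord True = snd" by (auto simp: coord_def fun_eq_iff)
  then show ?thesis using cov_le_projections[OF assms] by (cases i) (auto simp: mult.commute)
qed

text \<open>
  The shorter side is at most \<open>\<theta>\<close>, so one interval covers the projection to it, and a cover of the
  projection to the longer side is enough.
\<close>

lemma cov_cylinder_le:
  assumes v: "v \<in> verts G" and w: "word v w" and \<theta>: "0 < \<theta>" "side w \<le> \<theta>"
  shows "cov (2 * \<theta>) (cylinder v w)
       \<le> cov (\<theta> / len (long w) w) (proj (target v w, dir (long w) w))"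
proof -
  let ?T = "cylinder v w" and ?i = "long w"
  have "cov \<theta> (coord (\<not> ?i) ` ?T) \<le> 1"
  proof (rule cov_le_1)
    fix x y assume "x \<in> coord (\<not> ?i) ` ?T" "y \<in> coord (\<not> ?i) ` ?T"
    then have "dist x y \<le> len (\<not> ?i) w" using coord_cylinder_dist[OF v w] by blast
    then show "dist x y \<le> \<theta>" using \<theta>(2) len_long(1) by simp
  qed (use \<theta> in simp)
  then have "cov \<theta> (coord ?i ` ?T) * cov \<theta> (coord (\<not> ?i) ` ?T)
      \<le> cov \<theta> (coord ?i ` ?T) * 1" by (rule mult_left_mono) simp
  from order_trans[OF cov_le_coords[OF compact_cylinder[OF v w] \<theta>(1), of ?i] this]
  show ?thesis using cov_cylinder[OF v w \<theta>(1), of ?i] by simp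
qed

lemma cov_cylinder_ge:
  assumes v: "v \<in> verts G" and w: "word v w" and \<delta>: "0 < \<delta>"
  shows "cov (\<delta> / len i w) (proj (target v w, dir i w))
       \<le> cov \<delta> (cylinder v w)"
proof -
  have "cov (1 * \<delta>) (coord i ` cylinder v w) \<le> cov \<delta> (cylinder v w)"
    by (rule cov_Lipschitz_image[OF compact_cylinder[OF v w] \<delta>])
      (auto simp: coord_def dist_fst_le dist_snd_le)
  then show ?thesis using cov_cylinder[OF v w \<delta>] by simp
qed

text \<open>
  In a stopped box the number of sets needed is at most \<open>(L/\<theta>)\<close> to the power \<open>s + \<epsilon>\<close>, with \<open>L\<close> the longer
  side. Up to a constant this is \<open>\<theta>\<close> to the power \<open>-(\<gamma> + \<epsilon>)\<close> times the weight in the longer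
  direction. Which direction that is depends on the word, so the weights in both directions are
  added; \<open>sum_cut_upper\<close> bounds each of the two sums.
\<close>

lemma cov_upper:
  assumes v: "v \<in> verts G" and \<epsilon>: "0 < \<epsilon>"
    and h: "\<And>u. u \<in> states \<Longrightarrow> 1 \<le> h u \<and> transfer 0 \<gamma> h u \<le> h u"
  shows "\<exists>C>0. \<forall>\<delta>. 0 < \<delta> \<and> \<delta> \<le> 1 \<longrightarrow> real (cov \<delta> (X v)) \<le> C * \<delta> powr (- (\<gamma> + \<epsilon>))"
proof -
  obtain C where C: "0 < C" "\<And>u \<delta>. u \<in> states \<Longrightarrow> 0 < \<delta> \<Longrightarrow> \<delta> \<le> 1 / rmin \<Longrightarrow>
      real (cov \<delta> (proj u)) \<le> C * \<delta> powr (- (sdim u + \<epsilon>))"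
    using uniform_projection_bounds[OF \<epsilon>, of "1 / rmin"] rmin_pos by auto
  define M where "M = (\<Sum>i\<in>UNIV. 1 powr (\<gamma> - sdim (v, i)) + (1/rmin) powr (\<gamma> - sdim (v, i)))"
  have M0: "0 \<le> M" unfolding M_def by (intro sum_nonneg) auto
  define D where "D = C * M * (\<Sum>i\<in>UNIV. h (v, i)) * 2 powr (\<gamma> + \<epsilon>) + 1"
  have "0 \<le> h (v, i)" for i using h[of "(v, i)"] v by (simp add: states_def)
  then have hv: "0 \<le> (\<Sum>i\<in>UNIV. h (v, i))" by (intro sum_nonneg) simp
  have box: "real (cov (2 * \<theta>) (cylinder v w))
      \<le> C * M * \<theta> powr (- (\<gamma> + \<epsilon>)) * (\<Sum>i\<in>UNIV. weight 0 \<gamma> (v, i) w * h (target v w, dir i w))"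
    if \<theta>: "0 < \<theta>" "\<theta> < 1" and w: "w \<in> cut side v \<theta>" for \<theta> w
  proof -
    note wb = cut_bounds[OF contracting_side w]
    define i where "i = long w"
    define l where "l = len i w"
    define m where "m = len (\<not> i) w"
    define s where "s = sdim (v, i)"
    have s: "sdim (target v w, dir i w) = s" unfolding s_def by (rule sdim_word[OF v wb(1)])
    have l: "0 < l" "l \<le> 1" using len_pos[OF wb(1)] len_le_1[OF wb(1)] by (auto simp: l_def)
    have m: "m = side w" unfolding m_def i_def by (rule len_long)
    have "rmin * \<theta> \<le> l" using wb(3) len_long(2)[of w i] by (simp add: l_def)
    then have K: "\<theta> / l \<le> 1 / rmin" using l rmin_pos by (simp add: field_simps)
    have "real (cov (2 * \<theta>) (cylinder v w))
        \<le> real (cov (\<theta> / l) (proj (target v w, dir i w)))"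
      using cov_cylinder_le[OF v wb(1) \<theta>(1) wb(2)] by (simp add: l_def i_def)
    also have "\<dots> \<le> C * (\<theta> / l) powr (- (s + \<epsilon>))"
      using C(2)[OF target_in_states[OF v wb(1)], of "\<theta> / l" "dir i w"] K l \<theta> s by simp
    also have "(\<theta> / l) powr (- (s + \<epsilon>)) = l powr (s + \<epsilon>) * \<theta> powr (- (s + \<epsilon>))"
      using l \<theta> by (intro powr_divide_minus) auto
    also have "\<dots> \<le> l powr s * (\<theta> powr (- (\<gamma> + \<epsilon>)) * (M * m powr (\<gamma> - s)))"
    proof (rule mult_mono)
      show "l powr (s + \<epsilon>) \<le> l powr s" using l \<epsilon> by (intro powr_mono') auto
      have "\<theta> powr (- (s + \<epsilon>)) = \<theta> powr (- (\<gamma> + \<epsilon>)) * \<theta> powr (\<gamma> - s)"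
        by (simp flip: powr_add add: algebra_simps)
      also have "\<theta> powr (\<gamma> - s) \<le> (1 powr (\<gamma> - s) + (1/rmin) powr (\<gamma> - s)) * m powr (\<gamma> - s)"
        using wb m rmin_pos \<theta> contracting_pos[OF contracting_side wb(1)]
        by (intro powr_ratio_le) (auto simp: field_simps)
      also have "\<dots> \<le> M * m powr (\<gamma> - s)"
      proof (rule mult_right_mono)
        show "1 powr (\<gamma> - s) + (1/rmin) powr (\<gamma> - s) \<le> M"
          unfolding M_def s_def
          by (rule member_le_sum[where f = "\<lambda>i. 1 powr (\<gamma> - sdim (v, i)) + (1/rmin) powr (\<gamma> - sdim (v, i))"]) auto
      qed simp
      finally show "\<theta> powr (- (s + \<epsilon>)) \<le> \<theta> powr (- (\<gamma> + \<epsilon>)) * (M * m powr (\<gamma> - s))"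
        by (simp add: mult_left_mono)
    qed auto
    also have "\<dots> = M * \<theta> powr (- (\<gamma> + \<epsilon>)) * weight 0 \<gamma> (v, i) w"
      by (simp add: weight_def l_def m_def s_def)
    also have "\<dots> \<le> M * \<theta> powr (- (\<gamma> + \<epsilon>)) * (\<Sum>i\<in>UNIV. weight 0 \<gamma> (v, i) w * h (target v w, dir i w))"
    proof (rule mult_left_mono)
      have h1: "1 \<le> h (target v w, dir i w)" for i using h target_in_states[OF v wb(1)] by blast
      have "weight 0 \<gamma> (v, i) w * 1 \<le> weight 0 \<gamma> (v, i) w * h (target v w, dir i w)"
        using h1 by (intro mult_left_mono weight_nonneg)
      also have "\<dots> \<le> (\<Sum>i\<in>UNIV. weight 0 \<gamma> (v, i) w * h (target v w, dir i w))"
      proof (rule member_le_sum[where f = "\<lambda>i. weight 0 \<gamma> (v, i) w * h (target v w, dir i w)"])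
        show "0 \<le> weight 0 \<gamma> (v, k) w * h (target v w, dir k w)" for k
          using order_trans[OF zero_le_one h1] by (rule mult_nonneg_nonneg[OF weight_nonneg])
      qed simp_all
      finally show "weight 0 \<gamma> (v, i) w \<le> (\<Sum>i\<in>UNIV. weight 0 \<gamma> (v, i) w * h (target v w, dir i w))" by simp
    qed (use M0 in simp)
    finally show ?thesis using C(1) by (simp add: mult_left_mono mult.assoc)
  qed
  have "real (cov \<delta> (X v)) \<le> D * \<delta> powr (- (\<gamma> + \<epsilon>))" if \<delta>: "0 < \<delta>" "\<delta> \<le> 1" for \<delta>
  proof -
    define \<theta> where "\<theta> = \<delta> / 2"
    have \<theta>: "0 < \<theta>" "\<theta> < 1" "\<delta> = 2 * \<theta>" using \<delta> by (auto simp: \<theta>_def)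
    let ?W = "cut side v \<theta>"
    have "cov \<delta> (X v) = cov \<delta> (\<Union>w\<in>?W. cylinder v w)"
      using X_covered_by_cut[OF v contracting_side \<theta>(1,2)] by simp
    also have "\<dots> \<le> (\<Sum>w\<in>?W. cov \<delta> (cylinder v w))"
      using finite_cut[OF contracting_side \<theta>(1)] \<delta>(1) compact_cylinder[OF v] cut_bounds(1)[OF contracting_side]
      by (intro cov_UN_le) auto
    finally have "real (cov \<delta> (X v)) \<le> (\<Sum>w\<in>?W. real (cov \<delta> (cylinder v w)))"
      by (simp flip: of_nat_sum)
    also have "\<dots> \<le> (\<Sum>w\<in>?W. C * M * \<theta> powr (- (\<gamma> + \<epsilon>)) *
                 (\<Sum>i\<in>UNIV. weight 0 \<gamma> (v, i) w * h (target v w, dir i w)))"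
      unfolding \<theta>(3) using box[OF \<theta>(1,2)] by (intro sum_mono) auto
    also have "\<dots> = C * M * \<theta> powr (- (\<gamma> + \<epsilon>)) *
                 (\<Sum>i\<in>UNIV. \<Sum>w\<in>?W. weight 0 \<gamma> (v, i) w * h (target v w, dir i w))"
      by (subst sum.swap) (simp only: sum_distrib_left)
    also have "\<dots> \<le> C * M * \<theta> powr (- (\<gamma> + \<epsilon>)) * (\<Sum>i\<in>UNIV. h (v, i))"
      using C(1) M0 h sum_cut_upper[OF v contracting_side \<theta>(1,2)]
      by (intro mult_left_mono sum_mono) auto
    also have "\<theta> powr (- (\<gamma> + \<epsilon>)) = 2 powr (\<gamma> + \<epsilon>) * \<delta> powr (- (\<gamma> + \<epsilon>))"
      unfolding \<theta>_def using \<delta> by (intro powr_divide_minus) auto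
    also have "C * M * (2 powr (\<gamma> + \<epsilon>) * \<delta> powr (- (\<gamma> + \<epsilon>))) * (\<Sum>i\<in>UNIV. h (v, i))
        \<le> D * \<delta> powr (- (\<gamma> + \<epsilon>))"
      unfolding D_def using \<delta> by (simp add: algebra_simps)
    finally show ?thesis .
  qed
  moreover have "0 < D" unfolding D_def using C(1) M0 hv by (intro add_nonneg_pos mult_nonneg_nonneg) auto
  ultimately show ?thesis by blast
qed

definition tdim :: "'v \<Rightarrow> real" where
  "tdim v = sdim (v, False) + sdim (v, True)"

lemma tdim_eq: "sdim (v, i) + sdim (v, \<not> i) = tdim v"
  unfolding tdim_def by (cases i) auto

lemma cov_upper_tdim:
  assumes v: "v \<in> verts G" and \<epsilon>: "0 < \<epsilon>"
  shows "\<exists>C>0. \<forall>\<delta>. 0 < \<delta> \<and> \<delta> \<le> 1 \<longrightarrow> real (cov \<delta> (X v)) \<le> C * \<delta> powr (- (tdim v + \<epsilon>))"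
proof -
  have "0 < \<epsilon>/2" using \<epsilon> by simp
  from uniform_projection_bounds[OF this, of 1] obtain C where C: "0 < C"
    "\<And>u \<delta>. u \<in> states \<Longrightarrow> 0 < \<delta> \<Longrightarrow> \<delta> \<le> 1 \<Longrightarrow>
      real (cov \<delta> (proj u)) \<le> C * \<delta> powr (- (sdim u + \<epsilon>/2))" by auto
  have u: "(v, i) \<in> states" for i using v by (simp add: states_def)
  have "real (cov \<delta> (X v)) \<le> C * C * 2 powr (tdim v + \<epsilon>) * \<delta> powr (- (tdim v + \<epsilon>))"
    if \<delta>: "0 < \<delta>" "\<delta> \<le> 1" for \<delta>
  proof -
    define \<theta> where "\<theta> = \<delta> / 2"
    have \<theta>: "0 < \<theta>" "\<theta> \<le> 1" "\<delta> = 2 * \<theta>" using \<delta> by (auto simp: \<theta>_def)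
    have "cov \<delta> (X v) \<le> cov \<theta> (proj (v, False)) * cov \<theta> (proj (v, True))"
      unfolding \<theta>(3) using cov_le_coords[OF X_compact[OF v] \<theta>(1), of False] by (simp add: proj_def)
    then have "real (cov \<delta> (X v)) \<le> real (cov \<theta> (proj (v, False))) * real (cov \<theta> (proj (v, True)))"
      by (simp flip: of_nat_mult)
    also have "\<dots> \<le> (C * \<theta> powr (- (sdim (v, False) + \<epsilon>/2))) * (C * \<theta> powr (- (sdim (v, True) + \<epsilon>/2)))"
      using C u \<theta> by (intro mult_mono) auto
    also have "\<dots> = C * C * (\<theta> powr (- (sdim (v, False) + \<epsilon>/2)) * \<theta> powr (- (sdim (v, True) + \<epsilon>/2)))"
      by (simp only: mult_ac)
    also have "\<theta> powr (- (sdim (v, False) + \<epsilon>/2)) * \<theta> powr (- (sdim (v, True) + \<epsilon>/2))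
        = \<theta> powr (- (tdim v + \<epsilon>))"
      unfolding powr_add[symmetric] by (rule arg_cong[where f = "\<lambda>p. \<theta> powr p"]) (simp add: tdim_def)
    also have "\<theta> powr (- (tdim v + \<epsilon>)) = 2 powr (tdim v + \<epsilon>) * \<delta> powr (- (tdim v + \<epsilon>))"
      unfolding \<theta>_def using \<delta> by (intro powr_divide_minus) auto
    finally show ?thesis by simp
  qed
  then show ?thesis using C(1) by (intro exI[of _ "C * C * 2 powr (tdim v + \<epsilon>)"]) auto
qed

text \<open>
  Here the sum over stopped words is known to be large only for weights in one direction \<open>j\<close>. The weight
  in the longer direction is at least that large: their ratio is \<open>L\<close> over the shorter
  side, to the power \<open>tdim v - \<gamma> \<ge> 0\<close>. The gain \<open>\<kappa>\<close> comes from \<open>r > 1\<close>: a stopped word has at least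
  \<open>ln \<delta> / ln rmin\<close> letters.
\<close>

lemma cov_lower:
  assumes \<gamma>: "\<And>v. v \<in> verts G \<Longrightarrow> \<gamma> \<le> tdim v" and r: "1 < r" and u0: "u0 \<in> states"
    and h: "\<And>u. u \<in> states \<Longrightarrow> reach u0 u \<Longrightarrow> 1 \<le> h u \<and> h u \<le> H \<and> r * h u \<le> transfer 0 \<gamma> h u"
  shows "\<exists>\<kappa>>0. \<forall>v\<in>verts G. \<forall>\<epsilon>>0. \<exists>C>0. \<forall>\<delta>. 0 < \<delta> \<and> \<delta> \<le> 1 \<longrightarrow>
           \<delta> powr (- (\<gamma> + \<kappa> - \<epsilon>)) \<le> C * real (cov \<delta> (X v))"
proof -
  obtain K where K0: "\<forall>v\<in>verts G. \<forall>\<delta>. \<forall>U. 0 < \<delta> \<and> \<delta> \<le> 1 \<and> (\<forall>x\<in>U. \<forall>y\<in>U. dist x y \<le> \<delta>) \<longrightarrow>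
      card {w \<in> cut side v (\<delta>/2). U \<inter> cylinder v w \<noteq> {}} \<le> K"
    using finitely_many_boxes_meet by blast
  have K: "card {w \<in> cut side v (\<delta>/2). U \<inter> cylinder v w \<noteq> {}} \<le> K"
    if "v \<in> verts G" "0 < \<delta>" "\<delta> \<le> 1" "\<And>x y. x \<in> U \<Longrightarrow> y \<in> U \<Longrightarrow> dist x y \<le> \<delta>" for v \<delta> U
    using K0[rule_format, OF that(1), of \<delta> U] that(2-4) by simp
  \<comment> \<open>such that \<open>1 / r\<close> is \<open>rmin\<close> to the power \<open>\<kappa>\<close>, and \<open>rmin ^ length w \<le> side w\<close>\<close>
  define \<kappa> where "\<kappa> = ln r / (- ln rmin)"
  have lnr: "0 < - ln rmin" using rmin_pos rmin_less_1 by simp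
  have \<kappa>: "0 < \<kappa>" unfolding \<kappa>_def using r lnr by (intro divide_pos_pos) auto
  have r_eq: "1 / r = rmin powr \<kappa>"
  proof -
    have "rmin powr \<kappa> = exp (- ln r)" using lnr rmin_pos unfolding \<kappa>_def powr_def by (simp add: field_simps)
    then show ?thesis using r by (simp add: exp_minus inverse_eq_divide)
  qed
  have H: "1 \<le> H" using h[OF u0 reach_refl] by linarith
  have "\<exists>C>0. \<forall>\<delta>. 0 < \<delta> \<and> \<delta> \<le> 1 \<longrightarrow> \<delta> powr (- (\<gamma> + \<kappa> - \<epsilon>)) \<le> C * real (cov \<delta> (X v))"
    if v: "v \<in> verts G" and \<epsilon>: "0 < \<epsilon>" for v \<epsilon>
  proof -
    obtain C where C: "0 < C" "\<And>u \<delta>. u \<in> states \<Longrightarrow> 0 < \<delta> \<Longrightarrow> \<delta> \<le> 2 / rmin \<Longrightarrow>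
        \<delta> powr (- (sdim u - \<epsilon>)) \<le> C * real (cov \<delta> (proj u))"
      using uniform_projection_bounds[OF \<epsilon>, of "2 / rmin"] rmin_pos by auto
    obtain j where j: "reach u0 (v, j)"
      using reach_some_direction[of "fst u0" v "snd u0"] u0 v unfolding states_def
      by (metis mem_Times_iff prod.collapse)
    define M where "M = (\<Sum>i\<in>UNIV. (rmin/2) powr (\<gamma> - sdim (v, i)) + (1/2) powr (\<gamma> - sdim (v, i)))"
    have M0: "0 \<le> M" unfolding M_def by (intro sum_nonneg) auto
    have box: "weight 0 \<gamma> (v, j) w / r ^ length w * h (target v w, dir j w)
        \<le> H * M * C * \<delta> powr (\<gamma> - \<epsilon> + \<kappa>) * real (cov \<delta> (cylinder v w))"
      if \<delta>: "0 < \<delta>" "\<delta> \<le> 1" and w: "w \<in> cut side v (\<delta>/2)" for \<delta> w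
    proof -
      note wb = cut_bounds[OF contracting_side w]
      define i where "i = long w"
      define l where "l = len i w"
      define m where "m = len (\<not> i) w"
      define s where "s = sdim (v, i)"
      let ?N = "real (cov \<delta> (cylinder v w))"
      have s: "sdim (target v w, dir i w) = s" unfolding s_def by (rule sdim_word[OF v wb(1)])
      have l: "0 < l" "l \<le> 1" using len_pos[OF wb(1)] len_le_1[OF wb(1)] by (auto simp: l_def)
      have m: "m = side w" "0 < m" "m \<le> l"
        unfolding m_def l_def i_def by (rule len_long(1) len_long(3) len_pos[OF wb(1)])+
      have "weight 0 \<gamma> (v, j) w \<le> l powr s * m powr (\<gamma> - s)"
      proof (cases "j = i")
        case True
        then show ?thesis by (simp add: weight_def l_def m_def s_def)
      next
        case False
        then have ji: "j = (\<not> i)" by blast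
        have "weight 0 \<gamma> (v, j) w = m powr (tdim v - s) * l powr (\<gamma> - (tdim v - s))"
        proof -
          have "sdim (v, \<not> i) = tdim v - s" using tdim_eq[of v i] by (simp add: s_def)
          then show ?thesis unfolding weight_def ji by (simp add: l_def m_def)
        qed
        also have "\<dots> = m powr (\<gamma> - s) * (m powr (tdim v - \<gamma>) * l powr (\<gamma> - (tdim v - s)))"
          by (simp flip: powr_add)
        also have "\<dots> \<le> m powr (\<gamma> - s) * (l powr (tdim v - \<gamma>) * l powr (\<gamma> - (tdim v - s)))"
          using m \<gamma>[OF v] by (intro mult_left_mono mult_right_mono powr_mono2) auto
        also have "\<dots> = l powr s * m powr (\<gamma> - s)" by (simp flip: powr_add)
        finally show ?thesis .
      qed
      also have "m powr (\<gamma> - s) \<le> ((rmin/2) powr (\<gamma> - s) + (1/2) powr (\<gamma> - s)) * \<delta> powr (\<gamma> - s)"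
        using wb m rmin_pos \<delta> by (intro powr_ratio_le) auto
      also have "\<dots> \<le> M * \<delta> powr (\<gamma> - s)"
      proof (rule mult_right_mono)
        show "(rmin/2) powr (\<gamma> - s) + (1/2) powr (\<gamma> - s) \<le> M"
          unfolding M_def s_def
          by (rule member_le_sum[where f = "\<lambda>i. (rmin/2) powr (\<gamma> - sdim (v, i)) + (1/2) powr (\<gamma> - sdim (v, i))"]) auto
      qed simp
      finally have 1: "weight 0 \<gamma> (v, j) w \<le> l powr s * (M * \<delta> powr (\<gamma> - s))"
        by (simp add: mult_left_mono)
      have "l powr s \<le> l powr (s - \<epsilon>)" using l \<epsilon> by (intro powr_mono') auto
      also have "\<dots> = \<delta> powr (s - \<epsilon>) * (\<delta> / l) powr (- (s - \<epsilon>))"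
        using l \<delta> powr_divide_minus[of \<delta> l "s - \<epsilon>"] powr_add[of \<delta> "s - \<epsilon>" "- (s - \<epsilon>)"] by simp
      also have "\<dots> \<le> \<delta> powr (s - \<epsilon>) * (C * ?N)"
      proof (rule mult_left_mono)
        have "rmin * (\<delta>/2) \<le> l" using wb(3) len_long(2)[of w i] by (simp add: l_def)
        then have "\<delta> / l \<le> 2 / rmin" using l rmin_pos by (simp add: field_simps)
        then have "(\<delta> / l) powr (- (s - \<epsilon>)) \<le> C * real (cov (\<delta> / l) (proj (target v w, dir i w)))"
          using C(2)[OF target_in_states[OF v wb(1)], of "\<delta> / l" "dir i w"] l \<delta> s by simp
        also have "\<dots> \<le> C * ?N"
          using cov_cylinder_ge[OF v wb(1) \<delta>(1), of i] C(1) by (simp add: l_def)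
        finally show "(\<delta> / l) powr (- (s - \<epsilon>)) \<le> C * ?N" .
      qed simp
      finally have 2: "l powr s \<le> \<delta> powr (s - \<epsilon>) * (C * ?N)" .
      have "weight 0 \<gamma> (v, j) w \<le> (\<delta> powr (s - \<epsilon>) * (C * ?N)) * (M * \<delta> powr (\<gamma> - s))"
        using 1 mult_right_mono[OF 2, of "M * \<delta> powr (\<gamma> - s)"] M0 by (meson order_trans mult_nonneg_nonneg powr_ge_zero)
      also have "\<dots> = M * C * \<delta> powr (\<gamma> - \<epsilon>) * ?N"
        using powr_add[of \<delta> "s - \<epsilon>" "\<gamma> - s"] by (simp add: algebra_simps)
      finally have 3: "weight 0 \<gamma> (v, j) w \<le> M * C * \<delta> powr (\<gamma> - \<epsilon>) * ?N" .
      have "1 / r ^ length w = (rmin ^ length w) powr \<kappa>"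
        using rmin_pos r_eq by (simp add: power_one_over[symmetric] powr_realpow[symmetric] powr_powr mult.commute)
      also have "\<dots> \<le> \<delta> powr \<kappa>"
        using contracting_bounds(1)[OF contracting_side wb(1)] wb(2) \<delta> \<kappa> rmin_pos by (intro powr_mono2) auto
      finally have 4: "1 / r ^ length w \<le> \<delta> powr \<kappa>" .
      have st: "(target v w, dir j w) \<in> states" "reach u0 (target v w, dir j w)"
        using target_in_states[OF v wb(1)] reach_trans[OF j reach_word[OF wb(1)]] by auto
      have "weight 0 \<gamma> (v, j) w / r ^ length w * h (target v w, dir j w)
          = weight 0 \<gamma> (v, j) w * (1 / r ^ length w) * h (target v w, dir j w)" by simp
      also have "\<dots> \<le> (M * C * \<delta> powr (\<gamma> - \<epsilon>) * ?N) * \<delta> powr \<kappa> * H"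
        using 3 4 h[OF st] r M0 C(1) weight_nonneg by (intro mult_mono mult_nonneg_nonneg) auto
      also have "\<dots> = H * M * C * \<delta> powr (\<gamma> - \<epsilon> + \<kappa>) * ?N"
        by (simp add: powr_add)
      finally show ?thesis .
    qed
    define D where "D = H * M * C * real K + 1"
    have "\<delta> powr (- (\<gamma> + \<kappa> - \<epsilon>)) \<le> D * real (cov \<delta> (X v))" if \<delta>: "0 < \<delta>" "\<delta> \<le> 1" for \<delta>
    proof -
      have \<theta>: "0 < \<delta>/2" "\<delta>/2 < 1" using \<delta> by auto
      let ?W = "cut side v (\<delta>/2)" and ?N = "real (cov \<delta> (X v))"
      have st: "(v, j) \<in> states" using v by (simp add: states_def)
      have "1 \<le> h (v, j)" using h[OF st j] by simp
      also have "\<dots> \<le> (\<Sum>w\<in>?W. weight 0 \<gamma> (v, j) w / r ^ length w * h (target v w, dir j w))"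
        using r h reach_trans[OF j] by (intro sum_cut_lower[OF v contracting_side \<theta>]) auto
      also have "\<dots> \<le> (\<Sum>w\<in>?W. H * M * C * \<delta> powr (\<gamma> - \<epsilon> + \<kappa>) * real (cov \<delta> (cylinder v w)))"
        using box[OF \<delta>] by (intro sum_mono) auto
      also have "\<dots> = H * M * C * \<delta> powr (\<gamma> - \<epsilon> + \<kappa>) * real (\<Sum>w\<in>?W. cov \<delta> (cylinder v w))"
        by (simp add: sum_distrib_left)
      also have "\<dots> \<le> H * M * C * \<delta> powr (\<gamma> - \<epsilon> + \<kappa>) * real (K * cov \<delta> (X v))"
      proof (intro mult_left_mono of_nat_mono)
        show "(\<Sum>w\<in>?W. cov \<delta> (cylinder v w)) \<le> K * cov \<delta> (X v)"
        proof (rule sum_cov_le[OF finite_cut[OF contracting_side \<theta>(1)] X_compact[OF v] \<delta>(1)])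
          show "cylinder v w \<subseteq> X v" if "w \<in> ?W" for w
            using wmap_X_subset[OF v] cut_bounds(1)[OF contracting_side that] by blast
          show "card {w \<in> ?W. U \<inter> cylinder v w \<noteq> {}} \<le> K"
            if "\<And>x y. x \<in> U \<Longrightarrow> y \<in> U \<Longrightarrow> dist x y \<le> \<delta>" for U
            using K[OF v \<delta> that] .
        qed
      qed (use H M0 C(1) in auto)
      also have "\<dots> = H * M * C * real K * ?N * \<delta> powr (\<gamma> + \<kappa> - \<epsilon>)" by (simp add: algebra_simps)
      also have "\<dots> \<le> D * ?N * \<delta> powr (\<gamma> + \<kappa> - \<epsilon>)"
        unfolding D_def by (intro mult_right_mono) auto
      finally have "1 * \<delta> powr (- (\<gamma> + \<kappa> - \<epsilon>)) \<le> (D * ?N * \<delta> powr (\<gamma> + \<kappa> - \<epsilon>)) * \<delta> powr (- (\<gamma> + \<kappa> - \<epsilon>))"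
        by (rule mult_right_mono) simp
      also have "\<dots> = D * ?N" using \<delta> powr_add[of \<delta> "\<gamma> + \<kappa> - \<epsilon>" "- (\<gamma> + \<kappa> - \<epsilon>)"] by simp
      finally show ?thesis by simp
    qed
    moreover have "0 < D" unfolding D_def using H M0 C(1) by (intro add_nonneg_pos mult_nonneg_nonneg) auto
    ultimately show ?thesis by blast
  qed
  then show ?thesis using \<kappa> by blast
qed

lemma growth_antimono:
  assumes "y' \<le> y" "u \<in> states"
  shows "growth x y k u \<le> growth x y' k u"
proof -
  have "growth x (y' + (y - y')) k u \<le> (rmax powr (y - y')) ^ k * growth x y' k u"
    using assms by (intro growth_shift_bounds(2)) auto
  moreover have "(rmax powr (y - y')) ^ k * growth x y' k u \<le> 1 * growth x y' k u"
    using assms rmax_pos rmax_less_1 growth_nonneg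
    by (intro mult_right_mono power_le_one powr_le1) auto
  ultimately show ?thesis by simp
qed

text \<open>
  The lower bound is applied at \<open>min (g - \<epsilon>) (tdim v)\<close>, where the growth is at least that at \<open>g - \<epsilon>\<close>.
  If the minimum were \<open>tdim v\<close>, the gain \<open>\<kappa>\<close> would push the dimension of \<open>X v\<close> above \<open>tdim v\<close>,
  against \<open>cov_upper_tdim\<close>.
\<close>

theorem box_dimension_eq_critical_exponent:
  assumes upper: "\<And>\<gamma>. g < \<gamma> \<Longrightarrow> \<exists>q C. 0 \<le> q \<and> q < 1 \<and> (\<forall>k. \<forall>u\<in>states. growth 0 \<gamma> k u \<le> C * q ^ k)"
    and lower: "\<And>\<gamma>. \<gamma> < g \<Longrightarrow> \<exists>\<rho>>1. \<forall>k. \<exists>u\<in>states. \<rho> ^ k \<le> growth 0 \<gamma> k u"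
    and v: "v \<in> verts G"
  shows "has_box_dimension (X v) g"
proof (rule has_box_dimensionI[OF X_compact[OF v] X_nonempty[OF v]])
  fix \<epsilon> :: real assume \<epsilon>: "0 < \<epsilon>"
  show "\<exists>C>0. \<forall>\<delta>. 0 < \<delta> \<and> \<delta> \<le> 1 \<longrightarrow> real (cov \<delta> (X v)) \<le> C * \<delta> powr (- (g + \<epsilon>))"
  proof -
    have "g < g + \<epsilon>/2" using \<epsilon> by simp
    from upper[OF this] obtain h where "\<And>u. u \<in> states \<Longrightarrow> 1 \<le> h u \<and> transfer 0 (g + \<epsilon>/2) h u \<le> h u"
      using superinvariant_function[of _ 0 "g + \<epsilon>/2"] by metis
    from cov_upper[OF v _ this, of "\<epsilon>/2"] show ?thesis using \<epsilon> by (simp add: algebra_simps)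
  qed
  define \<gamma> where "\<gamma> = min (g - \<epsilon>) (tdim v)"
  obtain \<rho> where \<rho>: "1 < \<rho>" "\<And>k. \<exists>u\<in>states. \<rho> ^ k \<le> growth 0 (g - \<epsilon>) k u"
    using lower[of "g - \<epsilon>"] \<epsilon> by auto
  have "\<exists>u\<in>states. \<rho> ^ k \<le> growth 0 \<gamma> k u" for k
  proof -
    obtain u where u: "u \<in> states" "\<rho> ^ k \<le> growth 0 (g - \<epsilon>) k u" using \<rho>(2) by blast
    have "growth 0 (g - \<epsilon>) k u \<le> growth 0 \<gamma> k u"
      by (rule growth_antimono) (use u(1) in \<open>simp_all add: \<gamma>_def\<close>)
    then show ?thesis using u by (meson order_trans)
  qed
  from subinvariant_function[OF \<rho>(1) this] obtain r u0 h H where rh: "1 < r" "u0 \<in> states"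
    "\<And>u. u \<in> states \<Longrightarrow> reach u0 u \<Longrightarrow> 1 \<le> h u \<and> h u \<le> H \<and> r * h u \<le> transfer 0 \<gamma> h u" by blast
  have t: "\<gamma> \<le> tdim v'" if "v' \<in> verts G" for v'
    using sdim_sum_eq[OF v that] by (simp add: \<gamma>_def tdim_def)
  obtain \<kappa> where \<kappa>: "0 < \<kappa>" "\<And>\<epsilon>. 0 < \<epsilon> \<Longrightarrow> \<exists>C>0. \<forall>\<delta>. 0 < \<delta> \<and> \<delta> \<le> 1 \<longrightarrow>
           \<delta> powr (- (\<gamma> + \<kappa> - \<epsilon>)) \<le> C * real (cov \<delta> (X v))"
    using cov_lower[OF t rh] v by blast
  obtain C where C: "0 < C" "\<And>\<delta>. 0 < \<delta> \<Longrightarrow> \<delta> \<le> 1 \<Longrightarrow>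
      \<delta> powr (- (\<gamma> + \<kappa> - \<kappa>/2)) \<le> C * real (cov \<delta> (X v))"
    using \<kappa>(2)[of "\<kappa>/2"] \<kappa>(1) by auto
  have "\<gamma> \<noteq> tdim v"
  proof
    assume \<gamma>: "\<gamma> = tdim v"
    obtain D where D: "0 < D" "\<And>\<delta>. 0 < \<delta> \<Longrightarrow> \<delta> \<le> 1 \<Longrightarrow>
        real (cov \<delta> (X v)) \<le> D * \<delta> powr (- (tdim v + \<kappa>/4))"
      using cov_upper_tdim[OF v, of "\<kappa>/4"] \<kappa>(1) by auto
    have "\<gamma> + \<kappa> - \<kappa>/2 \<le> tdim v + \<kappa>/4"
    proof (rule powr_bound_imp_le[where C = "C * D"])
      fix \<delta> :: real assume \<delta>: "0 < \<delta>" "\<delta> \<le> 1"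
      have "C * real (cov \<delta> (X v)) \<le> C * (D * \<delta> powr (- (tdim v + \<kappa>/4)))"
        using D(2)[OF \<delta>] C(1) by (intro mult_left_mono) auto
      then show "\<delta> powr (- (\<gamma> + \<kappa> - \<kappa>/2)) \<le> C * D * \<delta> powr (- (tdim v + \<kappa>/4))"
        using C(2)[OF \<delta>] by (simp only: mult.assoc)
    qed
    then show False using \<gamma> \<kappa>(1) by simp
  qed
  then have \<gamma>: "\<gamma> = g - \<epsilon>" by (auto simp: \<gamma>_def min_def split: if_splits)
  have "\<delta> powr (- (g - \<epsilon>)) \<le> C * real (cov \<delta> (X v))" if \<delta>: "0 < \<delta>" "\<delta> \<le> 1" for \<delta>
  proof -
    have "\<delta> powr (- (g - \<epsilon>)) \<le> \<delta> powr (- (\<gamma> + \<kappa> - \<kappa>/2))"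
      using \<delta> \<kappa>(1) \<gamma> by (intro powr_mono') auto
    then show ?thesis using C(2)[OF \<delta>] by linarith
  qed
  then show "\<exists>C>0. \<forall>\<delta>. 0 < \<delta> \<and> \<delta> \<le> 1 \<longrightarrow> \<delta> powr (- (g - \<epsilon>)) \<le> C * real (cov \<delta> (X v))"
    using C(1) by blast
qed

end

section \<open>Supports of the invariant measures\<close>

text \<open>
  The complement of the support is a countable union of null sets from a countable basis.
\<close>

lemma emeasure_Compl_support:
  fixes M :: "'a::second_countable_topology measure"
  assumes M: "sets M = sets borel"
  shows "emeasure M (- measure_support M) = 0"
proof -
  obtain B :: "'a set set" where B: "countable B" "topological_basis B"
    using ex_countable_basis by blast
  define N where "N = {b \<in> B. emeasure M b = 0}"
  have "- measure_support M = \<Union>N"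
  proof (intro equalityI subsetI)
    fix x assume "x \<in> - measure_support M"
    then obtain U where U: "open U" "x \<in> U" "emeasure M U = 0"
      unfolding measure_support_def by auto
    obtain b where b: "b \<in> B" "x \<in> b" "b \<subseteq> U"
      using topological_basisE[OF B(2) U(1,2)] by blast
    then have "emeasure M b \<le> emeasure M U" using U(1) M by (intro emeasure_mono) auto
    then show "x \<in> \<Union>N" using b U(3) unfolding N_def by auto
  next
    fix x assume "x \<in> \<Union>N"
    then obtain b where "b \<in> B" "emeasure M b = 0" "x \<in> b" unfolding N_def by blast
    then show "x \<in> - measure_support M"
      using topological_basis_open[OF B(2)] unfolding measure_support_def by force
  qed
  moreover have "\<Union>N \<in> null_sets M"
  proof -
    have "countable N" using B(1) unfolding N_def by (rule countable_subset[rotated]) auto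
    moreover have "b \<in> null_sets M" if "b \<in> N" for b
      using topological_basis_open[OF B(2), of b] M that unfolding N_def by (auto intro: null_setsI)
    ultimately have "(\<Union>b\<in>N. b) \<in> null_sets M" by (rule null_sets_UN')
    then show ?thesis by simp
  qed
  ultimately show ?thesis by (simp add: null_setsD1)
qed

locale carpet_measures = carpet G \<Psi> X
  for G :: "('v, 'e) pre_digraph" and \<Psi> X +
  fixes p :: "'e \<Rightarrow> real" and \<mu> :: "'v \<Rightarrow> (real \<times> real) measure"
  assumes positive: "positive_vector G p"
    and invariant: "invariant_measures G \<Psi> X p \<mu>"
begin

lemma
  assumes "v \<in> verts G"
  shows prob_space_mu: "prob_space (\<mu> v)"
    and sets_mu: "sets (\<mu> v) = sets borel"
    and support_mu_subset: "measure_support (\<mu> v) \<subseteq> X v"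
    and measure_mu: "A \<in> sets borel \<Longrightarrow> measure (\<mu> v) A =
      (\<Sum>e\<in>out_arcs G v. p e * measure (\<mu> (head G e)) (apply_box (\<Psi> e) -` A))"
  using invariant assms unfolding invariant_measures_def by blast+

lemma emeasure_Compl_X: "v \<in> verts G \<Longrightarrow> emeasure (\<mu> v) (- X v) = 0"
proof -
  assume v: "v \<in> verts G"
  have "open (- X v)" using compact_imp_closed[OF X_compact[OF v]] by auto
  moreover have "- measure_support (\<mu> v) = \<Union>{U. open U \<and> emeasure (\<mu> v) U = 0}"
    unfolding measure_support_def by auto
  then have "open (- measure_support (\<mu> v))" by auto
  ultimately have "emeasure (\<mu> v) (- X v) \<le> emeasure (\<mu> v) (- measure_support (\<mu> v))"
    using support_mu_subset[OF v] sets_mu[OF v] by (intro emeasure_mono) auto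
  then show ?thesis using emeasure_Compl_support[OF sets_mu[OF v]] by simp
qed

lemma measure_pos_of_cylinder:
  assumes "v \<in> verts G" "word v w" "A \<in> sets borel" "X (target v w) \<subseteq> wmap w -` A"
  shows "0 < measure (\<mu> v) A"
  using assms
proof (induction w arbitrary: v A)
  case Nil
  interpret prob_space "\<mu> v" using prob_space_mu Nil.prems by blast
  have sp: "space (\<mu> v) = UNIV" using sets_eq_imp_space_eq[OF sets_mu] Nil.prems by simp
  have "emeasure (\<mu> v) (- A) \<le> emeasure (\<mu> v) (- X v)"
    using Nil.prems sets_mu[OF Nil.prems(1)] compact_imp_closed[OF X_compact[OF Nil.prems(1)]]
    by (intro emeasure_mono) auto
  then have "measure (\<mu> v) (- A) = 0"
    using emeasure_Compl_X[OF Nil.prems(1)] by (simp add: measure_def)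
  then have "measure (\<mu> v) A = 1"
    using prob_compl[of A] Nil.prems(3) sets_mu[OF Nil.prems(1)] sp by (simp add: Compl_eq_Diff_UNIV)
  then show ?case by simp
next
  case (Cons e w)
  have e: "e \<in> out_arcs G v" "head G e \<in> verts G" "word (head G e) w" using Cons.prems by auto
  have m: "apply_box (\<Psi> e) -` A \<in> sets borel"
    using measurable_sets[OF borel_measurable_continuous_onI[OF continuous_on_apply_box] Cons.prems(3)] by simp
  have p: "0 < p e'" if "e' \<in> out_arcs G v" for e'
    using positive that unfolding positive_vector_def by auto
  have "0 < measure (\<mu> (head G e)) (apply_box (\<Psi> e) -` A)"
    using Cons.IH[OF e(2,3) m] Cons.prems(4) by (auto simp: vimage_def)
  then have "0 < p e * measure (\<mu> (head G e)) (apply_box (\<Psi> e) -` A)" using p[OF e(1)] by simp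
  also have "\<dots> \<le> (\<Sum>e\<in>out_arcs G v. p e * measure (\<mu> (head G e)) (apply_box (\<Psi> e) -` A))"
    using e(1) less_imp_le[OF p]
    by (intro member_le_sum[where f = "\<lambda>e. p e * measure (\<mu> (head G e)) (apply_box (\<Psi> e) -` A)"])
      (auto intro!: mult_nonneg_nonneg)
  also have "\<dots> = measure (\<mu> v) A" using measure_mu[OF Cons.prems(1,3)] by simp
  finally show ?case .
qed

text \<open>
  A neighbourhood of \<open>\<xi>\<close> contains a small cylinder, which has positive mass because all \<open>p e\<close> are
  positive.
\<close>

lemma emeasure_open_pos:
  assumes v: "v \<in> verts G" and \<xi>: "\<xi> \<in> X v" and U: "open U" "\<xi> \<in> U"
  shows "0 < emeasure (\<mu> v) U"
proof -
  obtain r where r: "0 < r" "ball \<xi> r \<subseteq> U" using U openE by blast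
  define \<theta> where "\<theta> = min (1/2) (r/3)"
  have \<theta>: "0 < \<theta>" "\<theta> < 1" "2 * \<theta> < r" using r by (auto simp: \<theta>_def)
  define \<phi> where "\<phi> w = max (len False w) (len True w)" for w
  have \<phi>: "contracting v \<phi>"
    using contracting_len[of v False] contracting_len[of v True] rmin_pos rmax_pos
    unfolding contracting_def \<phi>_def
    by (auto simp del: len_append simp: max_mult_distrib_left intro: max.coboundedI1 max.coboundedI2)
  obtain w where w: "w \<in> cut \<phi> v \<theta>" "\<xi> \<in> cylinder v w"
    using \<xi> X_covered_by_cut[OF v \<phi> \<theta>(1,2)] by blast
  note wb = cut_bounds[OF \<phi> w(1)]
  have len: "len i w \<le> \<theta>" for i using wb(2) by (cases i) (auto simp: \<phi>_def)
  have "X (target v w) \<subseteq> wmap w -` U"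
  proof
    fix \<eta> assume "\<eta> \<in> X (target v w)"
    then have "wmap w \<eta> \<in> cylinder v w" by blast
    then have "dist (coord i \<xi>) (coord i (wmap w \<eta>)) \<le> \<theta>" for i
      using coord_cylinder_dist[OF v wb(1) w(2), of _ i] len[of i] by (meson order_trans)
    from this[of False] this[of True] have "dist (fst \<xi>) (fst (wmap w \<eta>)) \<le> \<theta>" "dist (snd \<xi>) (snd (wmap w \<eta>)) \<le> \<theta>"
      by (simp_all add: coord_def)
    moreover have "dist \<xi> (wmap w \<eta>) \<le> dist (fst \<xi>) (fst (wmap w \<eta>)) + dist (snd \<xi>) (snd (wmap w \<eta>))"
      by (simp add: dist_prod_def sqrt_sum_squares_le_sum)
    ultimately have "dist \<xi> (wmap w \<eta>) < r" using \<theta>(3) by linarith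
    then show "\<eta> \<in> wmap w -` U" using r(2) by auto
  qed
  then have "0 < measure (\<mu> v) U" using measure_pos_of_cylinder[OF v wb(1)] U(1) by simp
  then show ?thesis
    using prob_space.finite_measure[OF prob_space_mu[OF v]] by (simp add: finite_measure.emeasure_eq_measure)
qed

lemma support_projection:
  assumes v: "v \<in> verts G"
  shows "measure_support (distr (\<mu> v) borel (coord i)) = proj (v, i)"
proof -
  have meas: "coord i \<in> measurable (\<mu> v) borel"
    using borel_measurable_continuous_onI[OF continuous_on_coord] measurable_cong_sets[OF sets_mu[OF v] refl] by blast
  have sp: "space (\<mu> v) = UNIV" using sets_eq_imp_space_eq[OF sets_mu[OF v]] by simp
  have em: "emeasure (distr (\<mu> v) borel (coord i)) U = emeasure (\<mu> v) (coord i -` U)" if "open U" for U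
    using that meas sp by (simp add: emeasure_distr)
  show ?thesis
  proof (intro equalityI subsetI)
    fix x assume "x \<in> proj (v, i)"
    then obtain \<xi> where \<xi>: "\<xi> \<in> X v" "x = coord i \<xi>" by (auto simp: proj_def)
    show "x \<in> measure_support (distr (\<mu> v) borel (coord i))"
      unfolding measure_support_def
    proof (safe)
      fix U :: "real set" assume U: "open U" "x \<in> U"
      have "open (coord i -` U)" using continuous_on_coord[of UNIV i] U(1) by (simp add: continuous_on_open_vimage)
      then show "0 < emeasure (distr (\<mu> v) borel (coord i)) U"
        unfolding em[OF U(1)] using emeasure_open_pos[OF v \<xi>(1)] U(2) \<xi>(2) by simp
    qed
  next
    fix x assume x: "x \<in> measure_support (distr (\<mu> v) borel (coord i))"
    show "x \<in> proj (v, i)"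
    proof (rule ccontr)
      assume "x \<notin> proj (v, i)"
      have "closed (proj (v, i))" using compact_proj[of "(v, i)"] v by (intro compact_imp_closed) (simp add: states_def)
      then have o: "open (- proj (v, i))" by auto
      have "coord i -` (- proj (v, i)) \<subseteq> - X v" by (auto simp: proj_def)
      then have "emeasure (\<mu> v) (coord i -` (- proj (v, i))) \<le> emeasure (\<mu> v) (- X v)"
        using compact_imp_closed[OF X_compact[OF v]] sets_mu[OF v] by (intro emeasure_mono) auto
      then have "emeasure (distr (\<mu> v) borel (coord i)) (- proj (v, i)) = 0"
        unfolding em[OF o] using emeasure_Compl_X[OF v] by simp
      then show False using x o \<open>x \<notin> proj (v, i)\<close> unfolding measure_support_def by force
    qed
  qed
qed

lemma tau_x_eq: "v \<in> verts G \<Longrightarrow> tau_x \<mu> v = sdim (v, False)"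
proof -
  assume "v \<in> verts G"
  moreover have "coord False = fst" by (simp add: coord_def fun_eq_iff)
  ultimately show ?thesis
    unfolding tau_x_def lq_spectrum_0_def sdim_def using support_projection[of v False] by simp
qed

lemma tau_y_eq: "v \<in> verts G \<Longrightarrow> tau_y \<mu> v = sdim (v, True)"
proof -
  assume "v \<in> verts G"
  moreover have "coord True = snd" by (simp add: coord_def fun_eq_iff)
  ultimately show ?thesis
    unfolding tau_y_def lq_spectrum_0_def sdim_def using support_projection[of v True] by simp
qed

lemma t_zero_eq: "v \<in> verts G \<Longrightarrow> t_zero G \<mu> = tdim v"
proof -
  assume v: "v \<in> verts G"
  have sum: "tau_x \<mu> v' + tau_y \<mu> v' = tdim v" if "v' \<in> verts G" for v'
    using sdim_sum_eq[OF v that] tau_x_eq[OF that] tau_y_eq[OF that] by (simp add: tdim_def)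
  show ?thesis
    unfolding t_zero_def
  proof (rule the_equality)
    show "\<forall>v'\<in>verts G. tdim v = tau_x \<mu> v' + tau_y \<mu> v'" using sum by simp
    fix t assume "\<forall>v\<in>verts G. t = tau_x \<mu> v + tau_y \<mu> v"
    then show "t = tdim v" using sum v by metis
  qed
qed

end

section \<open>Spectral radius and growth\<close>

text \<open>
  Growth rates are compared by letting \<open>k\<close> tend to infinity.
\<close>

lemma power_bound_imp_le:
  fixes a b C :: real
  assumes b: "0 < b" and le: "\<And>k. a ^ k \<le> C * b ^ k"
  shows "a \<le> b"
proof (rule ccontr)
  assume "\<not> a \<le> b"
  then have "1 < a / b" using b by simp
  then obtain k where "C < (a / b) ^ k" using real_arch_pow by blast
  then have "C * b ^ k < a ^ k" using b by (simp add: power_divide pos_less_divide_eq)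
  then show False using le[of k] by simp
qed

lemma mult_mat_vec_index:
  assumes "A \<in> carrier_mat n n" "w \<in> carrier_vec n" "m < n"
  shows "vec_index (A *\<^sub>v w) m = (\<Sum>j<n. A $$ (m, j) * vec_index w j)"
  using assms by (auto simp: scalar_prod_def atLeast0LessThan intro!: sum.cong)

lemma spectral_radius_smult_less_1:
  assumes A: "A \<in> carrier_mat n n" and n: "0 < n" and r: "0 < r" "spectral_radius A < r"
  shows "spectral_radius (complex_of_real (1 / r) \<cdot>\<^sub>m A) < 1"
proof -
  let ?B = "complex_of_real (1 / r) \<cdot>\<^sub>m A"
  have B: "?B \<in> carrier_mat n n" using A by simp
  obtain ev where ev: "eigenvalue ?B ev" "spectral_radius ?B = norm ev"
    using spectral_radius_mem_max(1)[OF B n] unfolding spectrum_def by auto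
  obtain w where w: "w \<in> carrier_vec n" "w \<noteq> 0\<^sub>v n" "?B *\<^sub>v w = ev \<cdot>\<^sub>v w"
    using ev(1) A unfolding eigenvalue_def eigenvector_def by auto
  have "A *\<^sub>v w = (complex_of_real r * ev) \<cdot>\<^sub>v w"
  proof (rule eq_vecI)
    fix m assume "m < dim_vec ((complex_of_real r * ev) \<cdot>\<^sub>v w)"
    then have m: "m < n" using w by simp
    have "(\<Sum>j<n. ?B $$ (m, j) * vec_index w j) = ev * vec_index w m"
      using mult_mat_vec_index[OF B w(1) m] w(1,3) m by simp
    moreover have "(\<Sum>j<n. ?B $$ (m, j) * vec_index w j) = complex_of_real (1 / r) * (\<Sum>j<n. A $$ (m, j) * vec_index w j)"
      using A m by (simp add: sum_distrib_left mult.assoc)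
    ultimately have "(\<Sum>j<n. A $$ (m, j) * vec_index w j) = complex_of_real r * ev * vec_index w m"
      using r(1) by (simp add: field_simps)
    then show "vec_index (A *\<^sub>v w) m = vec_index ((complex_of_real r * ev) \<cdot>\<^sub>v w) m"
      using mult_mat_vec_index[OF A w(1) m] w(1) m by simp
  qed (use A w in auto)
  then have "eigenvalue A (complex_of_real r * ev)"
    using A w unfolding eigenvalue_def eigenvector_def by auto
  then have "norm (complex_of_real r * ev) \<le> spectral_radius A"
    using spectral_radius_mem_max(2)[OF A n] unfolding spectrum_def by blast
  then have "r * norm ev < r" using r by (simp only: norm_mult norm_of_real abs_of_pos)
  then show ?thesis unfolding ev(2) using r(1) by simp
qed

lemma sum_double: "(\<Sum>n<2 * N. g n) = (\<Sum>k<N. g (2 * k) + g (2 * k + 1))" for g :: "nat \<Rightarrow> 'a::comm_monoid_add"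
  by (induction N) (simp_all add: algebra_simps)

context carpet_measures
begin

abbreviation matrix_size :: nat where
  "matrix_size \<equiv> 2 * card (arcs G)"

abbreviation pressure_radius :: "real \<Rightarrow> real \<Rightarrow> real" where
  "pressure_radius x y \<equiv> spectral_radius (pressure_matrix G \<Psi> \<mu> x y)"

definition arc_of :: "nat \<Rightarrow> 'e" where
  "arc_of m = from_nat_into (arcs G) (m div 2)"

text \<open>
  The row and column indices \<open>e(1)\<close> and \<open>e(2)\<close> of the pressure matrix stand for the states at the head of
  \<open>e\<close>; the entry depends on the row only through this state.
\<close>

definition state_of :: "nat \<Rightarrow> 'v \<times> bool" where
  "state_of m = (head G (arc_of m), odd m)"

lemma arc_of_in_arcs: "m < matrix_size \<Longrightarrow> arc_of m \<in> arcs G"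
  unfolding arc_of_def by (rule from_nat_into) auto

lemma state_of_in_states: "m < matrix_size \<Longrightarrow> state_of m \<in> states"
  unfolding state_of_def states_def using arc_of_in_arcs by auto

text \<open>
  By strong connectivity every vertex is the head of some arc, so the matrix sees every state.
\<close>

lemma state_of_surj:
  assumes "u \<in> states"
  obtains m where "m < matrix_size" "state_of m = u"
proof -
  obtain v i where u: "u = (v, i)" "v \<in> verts G" using assms by (auto simp: states_def)
  obtain w where w: "w \<noteq> []" "awalk v w v" using conn u(2) unfolding strongly_connected_graph_def by blast
  then obtain w' e where "w = w' @ [e]" by (metis rev_exhaust)
  then have e: "e \<in> arcs G" "head G e = v" using word_of_awalk[OF w(2)] by auto
  obtain k where k: "k < card (arcs G)" "from_nat_into (arcs G) k = e"
    using bij_betw_from_nat_into_finite[OF finite_arcs] e(1) unfolding bij_betw_def by (metis imageE lessThan_iff)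
  show ?thesis
    by (rule that[of "2 * k + (if i then 1 else 0)"]) (use k e u in \<open>auto simp: state_of_def arc_of_def\<close>)
qed

lemma matrix_size_pos:
  assumes "verts G \<noteq> {}"
  shows "0 < matrix_size"
proof -
  obtain v where "v \<in> verts G" using assms by blast
  then have "(v, False) \<in> states" by (simp add: states_def)
  then show ?thesis by (metis state_of_surj gr_zeroI less_nat_zero_code)
qed

lemma pressure_block_eq:
  assumes "e \<in> arcs G"
  shows "pressure_block (\<Psi> e) (tau_x \<mu> (head G e)) (tau_y \<mu> (head G e)) x y (of_bool i) (of_bool j)
       = (if j = turn i e then wt x y (tail G e, i) e else 0)"
proof -
  have h: "head G e \<in> verts G" using assms by simp
  have s: "sdim (tail G e, k) = sdim (head G e, turn k e)" for k using sdim_turn[OF assms(1), of k] by simp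
  show ?thesis
    unfolding pressure_block_def Let_def tau_x_eq[OF h] tau_y_eq[OF h] wt_def s
    by (cases i; cases j) (auto simp: turn_def ratio_def entry_def box_a_def box_b_def)
qed

lemma pressure_matrix_carrier: "pressure_matrix G \<Psi> \<mu> x y \<in> carrier_mat matrix_size matrix_size"
  unfolding pressure_matrix_def by simp

definition pentry :: "real \<Rightarrow> real \<Rightarrow> nat \<Rightarrow> nat \<Rightarrow> real" where
  "pentry x y m n = (if fst (state_of m) = tail G (arc_of n) \<and> odd n = turn (odd m) (arc_of n)
     then wt x y (state_of m) (arc_of n) else 0)"

lemma pressure_matrix_index:
  assumes "m < matrix_size" "n < matrix_size"
  shows "pressure_matrix G \<Psi> \<mu> x y $$ (m, n) = complex_of_real (pentry x y m n)"
  using assms pressure_block_eq[OF arc_of_in_arcs[OF assms(2)], of x y "odd m" "odd n"]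
  unfolding pressure_matrix_def pentry_def state_of_def
  by (simp add: Let_def arc_of_def mod_2_eq_odd)

lemma pentry_nonneg: "0 \<le> pentry x y m n"
  unfolding pentry_def using wt_nonneg by simp

text \<open>
  The pressure matrix acts on functions of states as the transfer operator.
\<close>

lemma sum_pentry:
  assumes m: "m < matrix_size"
  shows "(\<Sum>n<matrix_size. pentry x y m n * f (state_of n)) = transfer x y f (state_of m)"
proof -
  let ?v = "fst (state_of m)" and ?e = "from_nat_into (arcs G)"
  define T where "T e = (if tail G e = ?v then wt x y (state_of m) e * f (head G e, turn (odd m) e) else 0)" for e
  have "(\<Sum>n<matrix_size. pentry x y m n * f (state_of n))
      = (\<Sum>k<card (arcs G). pentry x y m (2 * k) * f (state_of (2 * k)) + pentry x y m (2 * k + 1) * f (state_of (2 * k + 1)))"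
    by (rule sum_double)
  also have "\<dots> = (\<Sum>k<card (arcs G). T (?e k))"
  proof (rule sum.cong)
    fix k
    have a: "arc_of (2 * k) = ?e k" "arc_of (2 * k + 1) = ?e k" by (simp_all add: arc_of_def)
    show "pentry x y m (2 * k) * f (state_of (2 * k)) + pentry x y m (2 * k + 1) * f (state_of (2 * k + 1)) = T (?e k)"
      unfolding pentry_def T_def a state_of_def by (cases "turn (odd m) (?e k)") auto
  qed simp
  also have "\<dots> = (\<Sum>e\<in>arcs G. T e)"
    by (rule sum.reindex_bij_betw[OF bij_betw_from_nat_into_finite[OF finite_arcs]])
  also have "\<dots> = (\<Sum>e\<in>out_arcs G ?v. T e)"
    by (rule sum.mono_neutral_right) (auto simp: T_def)
  also have "\<dots> = transfer x y f (state_of m)"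
    unfolding transfer_def by (rule sum.cong) (auto simp: T_def state_of_def)
  finally show ?thesis .
qed

text \<open>
  Let \<open>w\<close> be an eigenvector for an eigenvalue of maximal modulus. As the matrix is nonnegative, the
  moduli of the entries of \<open>w\<close> satisfy the eigenvalue equation as an inequality. Iterating it
  from the entry of largest modulus gives the bound, with a state that is the same for all \<open>k\<close>.
\<close>

lemma growth_ge_spectral_radius:
  assumes "verts G \<noteq> {}"
  shows "\<exists>u\<in>states. \<forall>k. pressure_radius x y ^ k \<le> growth x y k u"
proof -
  let ?n = "matrix_size" and ?A = "pressure_matrix G \<Psi> \<mu> x y"
  note A = pressure_matrix_carrier[of x y]
  have n: "0 < ?n" by (rule matrix_size_pos[OF assms(1)])
  obtain ev where ev: "eigenvalue ?A ev" "spectral_radius ?A = norm ev"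
    using spectral_radius_mem_max(1)[OF A n] unfolding spectrum_def by auto
  obtain w where w: "w \<in> carrier_vec ?n" "w \<noteq> 0\<^sub>v ?n" "?A *\<^sub>v w = ev \<cdot>\<^sub>v w"
    using ev(1) A unfolding eigenvalue_def eigenvector_def by auto
  define a where "a m = norm (vec_index w m)" for m
  define B where "B = Max (a ` {..<?n})"
  have fin: "finite (a ` {..<?n})" "a ` {..<?n} \<noteq> {}" using n by (auto simp: lessThan_empty_iff)
  obtain m0 where m0: "m0 < ?n" "a m0 = B" using Max_in[OF fin] unfolding B_def by auto
  have aB: "a m \<le> B" if "m < ?n" for m unfolding B_def using fin that by (intro Max_ge) auto
  have "\<exists>m<?n. vec_index w m \<noteq> 0"
  proof (rule ccontr)
    assume "\<not> ?thesis"
    then have "w = 0\<^sub>v ?n" using w(1) by (intro eq_vecI) auto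
    then show False using w(2) by simp
  qed
  then obtain m1 where "m1 < ?n" "0 < a m1" unfolding a_def by auto
  then have B: "0 < B" using aB[of m1] by linarith
  have key: "norm ev ^ k * a m \<le> B * growth x y k (state_of m)" if "m < ?n" for k m
    using that
  proof (induction k arbitrary: m)
    case 0
    then show ?case using aB by simp
  next
    case (Suc k)
    have "ev * vec_index w m = (\<Sum>j<?n. ?A $$ (m, j) * vec_index w j)"
      using mult_mat_vec_index[OF A w(1) Suc.prems] w(1,3) Suc.prems by simp
    then have "norm ev * a m = norm (\<Sum>j<?n. ?A $$ (m, j) * vec_index w j)"
      by (simp add: a_def flip: norm_mult)
    also have "\<dots> \<le> (\<Sum>j<?n. norm (?A $$ (m, j) * vec_index w j))" by (rule norm_sum)
    also have "\<dots> = (\<Sum>j<?n. pentry x y m j * a j)"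
      using pressure_matrix_index[OF Suc.prems] pentry_nonneg
      by (intro sum.cong) (auto simp: norm_mult a_def)
    finally have "norm ev * a m \<le> (\<Sum>j<?n. pentry x y m j * a j)" .
    then have "norm ev ^ k * (norm ev * a m) \<le> norm ev ^ k * (\<Sum>j<?n. pentry x y m j * a j)"
      by (rule mult_left_mono) simp
    then have "norm ev ^ Suc k * a m \<le> norm ev ^ k * (\<Sum>j<?n. pentry x y m j * a j)"
      by (simp add: mult_ac)
    also have "\<dots> = (\<Sum>j<?n. pentry x y m j * (norm ev ^ k * a j))"
      by (simp add: sum_distrib_left mult_ac)
    also have "\<dots> \<le> (\<Sum>j<?n. pentry x y m j * (B * growth x y k (state_of j)))"
      using Suc.IH pentry_nonneg by (intro sum_mono mult_left_mono) auto
    also have "\<dots> = B * (\<Sum>j<?n. pentry x y m j * growth x y k (state_of j))"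
      by (simp add: sum_distrib_left mult_ac)
    also have "\<dots> = B * growth x y (Suc k) (state_of m)"
      unfolding sum_pentry[OF Suc.prems] growth_Suc ..
    finally show ?case .
  qed
  have "spectral_radius ?A ^ k \<le> growth x y k (state_of m0)" for k
    using key[OF m0(1), of k] B m0(2) unfolding ev(2) by (simp add: mult.commute)
  then show ?thesis using state_of_in_states[OF m0(1)] by blast
qed

text \<open>
  The powers of the matrix divided by \<open>r\<close> are bounded by the Jordan normal form, and applied to the
  constant vector they give the iterates of the transfer operator.
\<close>

lemma growth_le_of_spectral_radius_less:
  assumes "verts G \<noteq> {}" and r: "0 < r" "pressure_radius x y < r"
  shows "\<exists>C. \<forall>k. \<forall>u\<in>states. growth x y k u \<le> C * r ^ k"
proof -
  let ?n = "matrix_size" and ?A = "pressure_matrix G \<Psi> \<mu> x y"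
  note A = pressure_matrix_carrier[of x y]
  define A' where "A' = complex_of_real (1 / r) \<cdot>\<^sub>m ?A"
  have A': "A' \<in> carrier_mat ?n ?n" using A by (simp add: A'_def)
  have n: "0 < ?n" by (rule matrix_size_pos[OF assms(1)])
  have "spectral_radius A' < 1"
    unfolding A'_def by (rule spectral_radius_smult_less_1[OF A n r])
  then obtain c where c: "\<And>k. norm_bound (A' ^\<^sub>m k) c"
    using spectral_radius_jnf_norm_bound_less_1_upper_triangular[OF A'] by blast
  have step: "A' *\<^sub>v Matrix.vec ?n (\<lambda>m. complex_of_real (f (state_of m)))
      = Matrix.vec ?n (\<lambda>m. complex_of_real (transfer x y (\<lambda>u. f u / r) (state_of m)))" for f
  proof (rule eq_vecI)
    fix m assume "m < dim_vec (Matrix.vec ?n (\<lambda>m. complex_of_real (transfer x y (\<lambda>u. f u / r) (state_of m))))"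
    then have m: "m < ?n" by simp
    have "vec_index (A' *\<^sub>v Matrix.vec ?n (\<lambda>m. complex_of_real (f (state_of m)))) m
        = (\<Sum>j<?n. A' $$ (m, j) * vec_index (Matrix.vec ?n (\<lambda>m. complex_of_real (f (state_of m)))) j)"
      by (rule mult_mat_vec_index[OF A' _ m]) simp
    also have "\<dots> = (\<Sum>j<?n. complex_of_real (pentry x y m j * (f (state_of j) / r)))"
    proof (rule sum.cong)
      fix j assume "j \<in> {..<?n}"
      then have "A' $$ (m, j) = complex_of_real (1 / r) * complex_of_real (pentry x y m j)"
        using A m pressure_matrix_index[OF m, of j x y] by (simp add: A'_def)
      then show "A' $$ (m, j) * vec_index (Matrix.vec ?n (\<lambda>m. complex_of_real (f (state_of m)))) j
          = complex_of_real (pentry x y m j * (f (state_of j) / r))"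
        using \<open>j \<in> {..<?n}\<close> by simp
    qed simp
    also have "\<dots> = complex_of_real (transfer x y (\<lambda>u. f u / r) (state_of m))"
      unfolding of_real_sum[symmetric] using sum_pentry[OF m, of x y "\<lambda>u. f u / r"] by simp
    finally show "vec_index (A' *\<^sub>v Matrix.vec ?n (\<lambda>m. complex_of_real (f (state_of m)))) m
        = vec_index (Matrix.vec ?n (\<lambda>m. complex_of_real (transfer x y (\<lambda>u. f u / r) (state_of m)))) m"
      using m by simp
  qed (use A' in simp)
  have pow: "A' ^\<^sub>m k *\<^sub>v Matrix.vec ?n (\<lambda>m. complex_of_real (growth x y l (state_of m) / r ^ l))
      = Matrix.vec ?n (\<lambda>m. complex_of_real (growth x y (k + l) (state_of m) / r ^ (k + l)))" for k l
  proof (induction k arbitrary: l)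
    case 0
    show ?case using A' by simp
  next
    case (Suc k)
    have "transfer x y (\<lambda>u. growth x y l u / r ^ l / r) u = growth x y (Suc l) u / r ^ Suc l" for u
      using transfer_cmult[of x y "1 / r ^ Suc l" "growth x y l" u] by (simp add: growth_Suc mult.commute)
    then have "A' *\<^sub>v Matrix.vec ?n (\<lambda>m. complex_of_real (growth x y l (state_of m) / r ^ l))
        = Matrix.vec ?n (\<lambda>m. complex_of_real (growth x y (Suc l) (state_of m) / r ^ Suc l))"
      using step[of "\<lambda>u. growth x y l u / r ^ l"] by simp
    then show ?case
      using Suc.IH[of "Suc l"] A' by (simp add: assoc_mult_mat_vec[of _ ?n ?n])
  qed
  have "growth x y k (state_of m) \<le> (real ?n * c) * r ^ k" if m: "m < ?n" for k m
  proof -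
    have Ak: "A' ^\<^sub>m k \<in> carrier_mat ?n ?n" using A' by simp
    have "complex_of_real (growth x y k (state_of m) / r ^ k)
        = vec_index (A' ^\<^sub>m k *\<^sub>v Matrix.vec ?n (\<lambda>m. 1)) m"
      using pow[of k 0] m by simp
    also have "\<dots> = (\<Sum>j<?n. (A' ^\<^sub>m k) $$ (m, j))"
      using mult_mat_vec_index[OF Ak _ m, of "Matrix.vec ?n (\<lambda>m. 1)"] by simp
    finally have "norm (complex_of_real (growth x y k (state_of m) / r ^ k)) = norm (\<Sum>j<?n. (A' ^\<^sub>m k) $$ (m, j))"
      by simp
    also have "\<dots> \<le> (\<Sum>j<?n. norm ((A' ^\<^sub>m k) $$ (m, j)))" by (rule norm_sum)
    also have "\<dots> \<le> (\<Sum>j<?n. c)"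
    proof (rule sum_mono)
      fix j assume "j \<in> {..<?n}"
      then show "norm ((A' ^\<^sub>m k) $$ (m, j)) \<le> c"
        using c[of k] carrier_matD[OF Ak] m unfolding norm_bound_def by auto
    qed
    finally have "\<bar>growth x y k (state_of m) / r ^ k\<bar> \<le> real ?n * c"
      by (simp only: norm_of_real sum_constant card_lessThan)
    then have "growth x y k (state_of m) / r ^ k \<le> real ?n * c" by linarith
    then show ?thesis using r(1) by (simp add: pos_divide_le_eq)
  qed
  then show ?thesis by (metis state_of_surj)
qed

lemma spectral_radius_nonneg:
  assumes "verts G \<noteq> {}"
  shows "0 \<le> pressure_radius x y"
  using spectral_radius_mem_max(1)[OF pressure_matrix_carrier[of x y] matrix_size_pos[OF assms]] by auto

text \<open>
  Both radii are growth rates of iterates, so they compare as the iterates do. This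
  replaces Perron-Frobenius theory and continuity of eigenvalues in what follows.
\<close>

lemma spectral_radius_compare:
  assumes ne: "verts G \<noteq> {}" and q: "0 < q"
    and le: "\<And>k u. u \<in> states \<Longrightarrow> \<exists>u'\<in>states. growth x y k u \<le> q ^ k * growth x' y' k u'"
  shows "pressure_radius x y \<le> q * pressure_radius x' y'"
proof -
  let ?\<rho> = "pressure_radius x y"
  let ?\<rho>' = "pressure_radius x' y'"
  have "?\<rho> / q \<le> r" if "?\<rho>' < r" for r
  proof -
    have r: "0 < r" using that spectral_radius_nonneg[OF ne] by (meson le_less_trans)
    obtain C where C: "\<And>k u. u \<in> states \<Longrightarrow> growth x' y' k u \<le> C * r ^ k"
      using growth_le_of_spectral_radius_less[OF ne r \<open>?\<rho>' < r\<close>] by blast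
    obtain u where u: "u \<in> states" "\<And>k. ?\<rho> ^ k \<le> growth x y k u"
      using growth_ge_spectral_radius[OF ne] by blast
    have "(?\<rho> / q) ^ k \<le> C * r ^ k" for k
    proof -
      obtain u' where u': "u' \<in> states" "growth x y k u \<le> q ^ k * growth x' y' k u'" using le[OF u(1)] by blast
      have "?\<rho> ^ k \<le> growth x y k u" by (rule u(2))
      also have "\<dots> \<le> q ^ k * growth x' y' k u'" by (rule u'(2))
      also have "\<dots> \<le> q ^ k * (C * r ^ k)" using C[OF u'(1)] q by (intro mult_left_mono) auto
      finally show ?thesis using q by (simp add: power_divide pos_divide_le_eq mult.commute)
    qed
    then show ?thesis by (rule power_bound_imp_le[OF r])
  qed
  then have "?\<rho> / q \<le> ?\<rho>'" by (rule dense_ge)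
  then show ?thesis using q by (simp add: pos_divide_le_eq mult.commute)
qed

section \<open>The critical exponent\<close>

definition radius :: "real \<Rightarrow> real" where
  "radius y = pressure_radius 0 y"

lemma radius_shift:
  assumes ne: "verts G \<noteq> {}" and h: "0 \<le> h"
  shows "radius (y + h) \<le> rmax powr h * radius y" "rmin powr h * radius y \<le> radius (y + h)"
proof -
  show "radius (y + h) \<le> rmax powr h * radius y"
    unfolding radius_def
  proof (rule spectral_radius_compare[OF ne])
    fix k u assume u: "u \<in> states"
    then show "\<exists>u'\<in>states. growth 0 (y + h) k u \<le> (rmax powr h) ^ k * growth 0 y k u'"
      using growth_shift_bounds(2)[OF h u] by blast
  qed (use rmax_pos in simp)
  have "radius y \<le> (1 / rmin powr h) * radius (y + h)"
    unfolding radius_def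
  proof (rule spectral_radius_compare[OF ne])
    fix k u assume u: "u \<in> states"
    have "growth 0 y k u \<le> (1 / rmin powr h) ^ k * growth 0 (y + h) k u"
      using growth_shift_bounds(1)[OF h u, of k 0 y] rmin_pos by (simp add: power_divide field_simps)
    then show "\<exists>u'\<in>states. growth 0 y k u \<le> (1 / rmin powr h) ^ k * growth 0 (y + h) k u'"
      using u by blast
  qed (use rmin_pos in simp)
  then show "rmin powr h * radius y \<le> radius (y + h)" using rmin_pos by (simp add: field_simps)
qed

text \<open>
  Every state has an outgoing edge, so the iterates decay at most exponentially.
\<close>

lemma radius_pos:
  assumes ne: "verts G \<noteq> {}"
  shows "0 < radius y"
proof (rule ccontr)
  assume "\<not> 0 < radius y"
  define c where "c = Min (insert 1 ((\<lambda>(u, e). wt 0 y u e) ` (states \<times> arcs G)))"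
  have fin: "finite (insert 1 ((\<lambda>(u, e). wt 0 y u e) ` (states \<times> arcs G)))" using finite_states by simp
  have c: "0 < c" unfolding c_def using fin wt_pos by (subst Min_gr_iff) auto
  have c_le: "c \<le> wt 0 y u e" if "u \<in> states" "e \<in> arcs G" for u e
    unfolding c_def using fin that by (intro Min_le) (auto intro!: image_eqI[where x = "(u, e)"])
  have low: "c ^ k \<le> growth 0 y k u" if "u \<in> states" for k u
    using that
  proof (induction k arbitrary: u)
    case (Suc k)
    have "fst u \<in> verts G" using Suc.prems by (auto simp: states_def)
    then obtain e where e: "e \<in> out_arcs G (fst u)" using out_arcs_nonempty by blast
    have "c * c ^ k \<le> wt 0 y u e * growth 0 y k (head G e, turn (snd u) e)"
      using c_le[OF Suc.prems] Suc.IH[OF next_in_states[OF Suc.prems e]] e c wt_nonneg by (intro mult_mono) auto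
    also have "\<dots> \<le> growth 0 y (Suc k) u"
      unfolding growth_Suc transfer_def using e wt_nonneg growth_nonneg
      by (intro member_le_sum[where f = "\<lambda>e. wt 0 y u e * growth 0 y k (head G e, turn (snd u) e)"]) auto
    finally show ?case by simp
  qed simp
  have "radius y < c / 2" using \<open>\<not> 0 < radius y\<close> c by simp
  then obtain C where C: "\<And>k u. u \<in> states \<Longrightarrow> growth 0 y k u \<le> C * (c / 2) ^ k"
    using growth_le_of_spectral_radius_less[OF ne, of "c / 2" 0 y] c unfolding radius_def by auto
  obtain v where "v \<in> verts G" using ne by blast
  then have u: "(v, False) \<in> states" by (simp add: states_def)
  have "c \<le> c / 2"
    by (rule power_bound_imp_le[where C = C]) (use c low[OF u] C[OF u] in \<open>auto intro: order_trans\<close>)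
  then show False using c by simp
qed

lemma radius_strict_antimono:
  assumes "verts G \<noteq> {}" "y < y'"
  shows "radius y' < radius y"
proof -
  have "radius (y + (y' - y)) \<le> rmax powr (y' - y) * radius y"
    using assms by (intro radius_shift) auto
  also have "\<dots> < 1 * radius y"
    using radius_pos[OF assms(1), of y] assms(2) rmax_pos rmax_less_1
    using powr_less_mono2[of "y' - y" rmax 1] by (intro mult_strict_right_mono) auto
  finally show ?thesis by simp
qed

text \<open>
  By \<open>radius_shift\<close>, the logarithm of the radius is Lipschitz continuous and decreases at least
  linearly, so it has a zero.
\<close>

lemma ex_radius_eq_1:
  assumes ne: "verts G \<noteq> {}"
  shows "\<exists>y. radius y = 1"
proof -
  define f where "f y = ln (radius y)" for y
  have up: "f (y + h) \<le> f y + h * ln rmax" and low: "f y + h * ln rmin \<le> f (y + h)" if h: "0 \<le> h" for y h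
  proof -
    have "f (y + h) \<le> ln (rmax powr h * radius y)"
      unfolding f_def using radius_shift(1)[OF ne h] radius_pos[OF ne] by (intro ln_mono) auto
    then show "f (y + h) \<le> f y + h * ln rmax"
      using radius_pos[OF ne, of y] rmax_pos by (simp add: f_def ln_mult ln_powr)
    have "ln (rmin powr h * radius y) \<le> f (y + h)"
      unfolding f_def using radius_shift(2)[OF ne h] radius_pos[OF ne] rmin_pos by (intro ln_mono) auto
    then show "f y + h * ln rmin \<le> f (y + h)"
      using radius_pos[OF ne, of y] rmin_pos by (simp add: f_def ln_mult ln_powr)
  qed
  have neg: "ln rmin < 0" "ln rmax < 0" using rmin_pos rmin_less_1 rmax_pos rmax_less_1 by auto
  have lip: "\<bar>f a - f b\<bar> \<le> (- ln rmin) * (b - a)" if "a \<le> b" for a b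
  proof -
    have "f b \<le> f a" using up[of "b - a" a] neg that by (smt (verit) mult_nonneg_nonpos)
    then show ?thesis using low[of "b - a" a] that by (simp add: algebra_simps)
  qed
  have "(- ln rmin)-lipschitz_on UNIV f"
  proof (rule lipschitz_onI)
    fix a b
    show "dist (f a) (f b) \<le> (- ln rmin) * dist a b"
    proof (cases "a \<le> b")
      case True
      then show ?thesis using lip[OF True] by (simp add: dist_real_def)
    next
      case False
      then show ?thesis using lip[of b a] by (simp add: dist_real_def abs_minus_commute)
    qed
  qed (use neg in simp)
  then have cont: "continuous_on S f" for S
    using lipschitz_on_continuous_on continuous_on_subset by blast
  define h where "h = \<bar>f 0\<bar> / (- ln rmax)"
  have h: "0 \<le> h" "h * ln rmax = - \<bar>f 0\<bar>" using neg by (auto simp: h_def field_simps)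
  have "f h \<le> 0" using up[OF h(1), of 0] h(2) by simp
  moreover have "0 \<le> f (- h)" using up[OF h(1), of "- h"] h(2) by simp
  ultimately obtain y where "f y = 0" using IVT2'[of f h 0 "- h", OF _ _ _ cont] h(1) by auto
  then have "radius y = 1" using radius_pos[OF ne, of y] by (simp add: f_def)
  then show ?thesis ..
qed

text \<open>
  With \<open>t = s\<^sub>x + s\<^sub>y\<close>, the weight of an edge with parameters \<open>y - t\<close> and \<open>t\<close> in one direction is its
  weight with parameters \<open>0\<close> and \<open>y\<close> in the other direction.
\<close>

lemma growth_flip:
  assumes "u \<in> states"
  shows "growth (y - t_zero G \<mu>) (t_zero G \<mu>) k u = growth 0 y k (fst u, \<not> snd u)"
  using assms
proof (induction k arbitrary: u)
  case (Suc k)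
  let ?t = "t_zero G \<mu>"
  obtain v i where u: "u = (v, i)" "v \<in> verts G" using Suc.prems by (auto simp: states_def)
  have s: "sdim (v, \<not> i) = ?t - sdim (v, i)" using t_zero_eq[OF u(2)] tdim_eq[of v i] by simp
  have "wt (y - ?t) ?t (v, i) e = wt 0 y (v, \<not> i) e" for e
    unfolding wt_def s by (simp add: mult.commute algebra_simps)
  moreover have "growth (y - ?t) ?t k (head G e, turn i e) = growth 0 y k (head G e, turn (\<not> i) e)"
    if "e \<in> out_arcs G v" for e
    using Suc.IH[of "(head G e, turn i e)"] that by (simp add: states_def)
  ultimately show ?case
    unfolding growth_Suc transfer_def u fst_conv snd_conv by (intro sum.cong) auto
qed simp

lemma spectral_radius_flip:
  assumes ne: "verts G \<noteq> {}"
  shows "pressure_radius (y - t_zero G \<mu>) (t_zero G \<mu>) = radius y"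
proof (rule antisym)
  let ?t = "t_zero G \<mu>"
  have "pressure_radius (y - ?t) ?t \<le> 1 * radius y"
    unfolding radius_def
  proof (rule spectral_radius_compare[OF ne])
    fix k u assume "u \<in> states"
    then show "\<exists>u'\<in>states. growth (y - ?t) ?t k u \<le> 1 ^ k * growth 0 y k u'"
      using growth_flip[of u y k] by (intro bexI[of _ "(fst u, \<not> snd u)"]) (auto simp: states_def)
  qed simp
  then show "pressure_radius (y - ?t) ?t \<le> radius y" by simp
  have "radius y \<le> 1 * pressure_radius (y - ?t) ?t"
    unfolding radius_def
  proof (rule spectral_radius_compare[OF ne])
    fix k u assume "u \<in> states"
    then show "\<exists>u'\<in>states. growth 0 y k u \<le> 1 ^ k * growth (y - ?t) ?t k u'"
      using growth_flip[of "(fst u, \<not> snd u)" y k] by (intro bexI[of _ "(fst u, \<not> snd u)"]) (auto simp: states_def)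
  qed simp
  then show "radius y \<le> pressure_radius (y - ?t) ?t" by simp
qed

lemma radius_gamma_hat_0:
  assumes ne: "verts G \<noteq> {}"
  shows "radius (gamma_hat_0 G \<Psi> \<mu>) = 1"
proof -
  obtain y where y: "radius y = 1" using ex_radius_eq_1[OF ne] by blast
  have "gamma_hat_0 G \<Psi> \<mu> = y"
    unfolding gamma_hat_0_def spectral_radius_flip[OF ne] radius_def[symmetric]
  proof (rule the_equality)
    fix z assume "radius z = 1 \<and> radius z = 1"
    then show "z = y"
      using y radius_strict_antimono[OF ne, of y z] radius_strict_antimono[OF ne, of z y]
      by (cases y z rule: linorder_cases) auto
  qed (use y in simp)
  then show ?thesis using y by simp
qed

theorem has_box_dimension_gamma_hat_0:
  assumes v: "v \<in> verts G"
  shows "has_box_dimension (X v) (gamma_hat_0 G \<Psi> \<mu>)"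
proof -
  have ne: "verts G \<noteq> {}" using v by blast
  let ?g = "gamma_hat_0 G \<Psi> \<mu>"
  note g = radius_gamma_hat_0[OF ne]
  show ?thesis
  proof (rule box_dimension_eq_critical_exponent[OF _ _ v])
    fix \<gamma> assume "?g < \<gamma>"
    then have "radius \<gamma> < 1" using radius_strict_antimono[OF ne] g by metis
    define q where "q = (radius \<gamma> + 1) / 2"
    have q: "0 < q" "radius \<gamma> < q" "q < 1" using \<open>radius \<gamma> < 1\<close> radius_pos[OF ne, of \<gamma>] by (auto simp: q_def)
    then show "\<exists>q C. 0 \<le> q \<and> q < 1 \<and> (\<forall>k. \<forall>u\<in>states. growth 0 \<gamma> k u \<le> C * q ^ k)"
      using growth_le_of_spectral_radius_less[OF ne q(1), of 0 \<gamma>] unfolding radius_def by (meson less_imp_le)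
  next
    fix \<gamma> assume "\<gamma> < ?g"
    then have "1 < radius \<gamma>" using radius_strict_antimono[OF ne] g by metis
    then show "\<exists>\<rho>>1. \<forall>k. \<exists>u\<in>states. \<rho> ^ k \<le> growth 0 \<gamma> k u"
      using growth_ge_spectral_radius[OF ne, of 0 \<gamma>] unfolding radius_def by blast
  qed
qed

end

theorem corollary2p8:
  fixes G :: "('v, 'e) pre_digraph"
    and \<Psi> :: "'e \<Rightarrow> box_map"
    and X :: "'v \<Rightarrow> (real \<times> real) set"
    and p :: "'e \<Rightarrow> real"
    and \<mu> :: "'v \<Rightarrow> (real \<times> real) measure"
  assumes "box_like_gifs G \<Psi>"
    and "strongly_connected_graph G"
    and "rosc G \<Psi>"
    and "carpet_family G \<Psi> X"
    and "positive_vector G p"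
    and "invariant_measures G \<Psi> X p \<mu>"
  shows "\<forall>v\<in>verts G. has_box_dimension (X v) (gamma_hat_0 G \<Psi> \<mu>)"
proof -
  interpret carpet_measures G \<Psi> X p \<mu>
    using assms by unfold_locales
  show ?thesis using has_box_dimension_gamma_hat_0 by blast
qed

end
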